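(* For all integers $k\ge 1$ and $n\ge 3$, $GR_k(C_{2n+1})=n\cdot 2^k+1$.
   Context: A Gallai coloring of a complete graph is an edge-coloring with no rainbow triangle (a triangle whose three edges receive three distinct colors); a Gallai $k$-coloring is a Gallai coloring using $k$ colors. For a graph $H$ and integer $k\ge1$, the Gallai-Ramsey number $GR_k(H)$ is the least positive integer $N$ such that every Gallai $k$-coloring of the complete graph $K_N$ contains a monochromatic copy of $H$. $C_m$ denotes the cycle on $m$ vertices. *)

theory Defs
  imports "HOL-Library.Ramsey"
begin

text \<open>Simple graphs are pairs of a vertex set and a set of two-element subsets of it.\<close>

type_synonym 'a sgraph = "'a set \<times> 'a set set"

definition complete_graph :: "nat \<Rightarrow> nat sgraph" where
  "complete_graph N = ({..<N}, [{..<N}]\<^bsup>2\<^esup>)"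

text \<open>For \<open>m < 3\<close> this is not a cycle (and not a simple graph when \<open>m = 1\<close>).\<close>

definition cycle_graph :: "nat \<Rightarrow> nat sgraph" where
  "cycle_graph m = ({..<m}, {{i, (i + 1) mod m} | i. i < m})"

definition rainbow_triangle :: "'a sgraph \<Rightarrow> ('a set \<Rightarrow> nat) \<Rightarrow> 'a \<Rightarrow> 'a \<Rightarrow> 'a \<Rightarrow> bool" where
  "rainbow_triangle G f x y z \<longleftrightarrow>
     {x, y} \<in> snd G \<and> {y, z} \<in> snd G \<and> {x, z} \<in> snd G \<and>
     f {x, y} \<noteq> f {y, z} \<and> f {y, z} \<noteq> f {x, z} \<and> f {x, y} \<noteq> f {x, z}"

text \<open>The \<open>k\<close> colors are \<open>0, \<dots>, k - 1\<close>. As usual in Ramsey theory, not all of them need to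
  occur: if they did, the complete graphs with fewer than \<open>k\<close> edges would have no \<open>k\<close>-coloring at
  all, and the Gallai-Ramsey number would always be 1.\<close>

definition gallai_coloring :: "nat \<Rightarrow> nat \<Rightarrow> (nat set \<Rightarrow> nat) \<Rightarrow> bool" where
  "gallai_coloring k N f \<longleftrightarrow>
     f \<in> snd (complete_graph N) \<rightarrow> {..<k} \<and>
     (\<nexists>x y z. rainbow_triangle (complete_graph N) f x y z)"

text \<open>A copy of \<open>H\<close> in \<open>G\<close> is a not necessarily induced subgraph of \<open>G\<close> isomorphic to \<open>H\<close>,
  given here by an embedding \<open>g\<close>.\<close>

definition has_monochromatic_copy :: "'a sgraph \<Rightarrow> 'b sgraph \<Rightarrow> ('b set \<Rightarrow> nat) \<Rightarrow> bool" where
  "has_monochromatic_copy H G f \<longleftrightarrow>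
     (\<exists>g c. inj_on g (fst H) \<and> g ` fst H \<subseteq> fst G \<and>
        (\<forall>e \<in> snd H. g ` e \<in> snd G \<and> f (g ` e) = c))"

definition gallai_ramsey :: "nat \<Rightarrow> 'a sgraph \<Rightarrow> nat" where
  "gallai_ramsey k H =
     (LEAST N. N > 0 \<and>
        (\<forall>f. gallai_coloring k N f \<longrightarrow> has_monochromatic_copy H (complete_graph N) f))"

end

theory Submission
  imports Defs
begin

text \<open>For the lower bound, colour two vertices by the highest binary digit in which their quotients by
  \<open>n\<close> differ. Colour \<open>0\<close> then consists of disjoint cliques on \<open>2 n\<close> vertices, and all other colours are
  bipartite.

  For the upper bound, induct on the vertex set, with vertices that are joined to everything else in one
  colour set aside. Take a Gallai partition, whose parts are homogeneous and joined in only two colours,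
  red and blue. If some part \<open>M\<close> has at least \<open>n\<close> vertices, its red
  neighbourhood either is small and can be set aside, or is so large that there are no red edges in
  \<open>M\<close> and in the neighbourhood itself, and the induction hypothesis applies to both with
  fewer colours; the same holds for blue. If all parts are small, or if there are only two colours, then
  any two disjoint sets of \<open>n + 1\<close> and \<open>n\<close> vertices are joined in both
  colours. One of the colours is dense, so Dirac's longest path argument yields a monochromatic cycle of
  length at least \<open>2 n + 1\<close>. Odd cycles can be shortened by two, possibly changing the
  colour, and the two classes of a long even cycle contradict joinedness.\<close>

text \<open>The count must be exact, and dropping fewer than \<open>n\<close> vertices per step
  would cost an additive term. So the vertices set aside stay in the bounded quantity,
  \<open>card W + (\<Sum>i\<in>K. card (X i)) \<le> n * 2 ^ card K\<close>, and cycles are forbidden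
  on all of them together. Each colour that vanishes from a set halves its bound; a large part with
  two large neighbourhoods takes one quarter of the total and the neighbourhoods three quarters.

  The slack varies. With two colours the bound is the Ramsey bound \<open>4 * n\<close>, so complete
  graphs are treated precisely and the edges between vertices set aside are repaired afterwards.
  With three colours the bound is \<open>8 * n\<close>, of which the third colour's apex set takes
  less than \<open>n\<close>; small parts can then be handled crudely on about \<open>7 * n\<close>
  vertices.

  Parity is the other obstacle, since Dirac's argument does not control it. For small parts, an even
  cycle is extended to length at least \<open>4 * n - 2\<close>: anything that breaks its
  bipartition then closes two odd cycles, one of which is long enough.\<close>

definition is_path :: "('a \<Rightarrow> 'a \<Rightarrow> bool) \<Rightarrow> 'a list \<Rightarrow> bool" where
  "is_path E xs \<longleftrightarrow> xs \<noteq> [] \<and> distinct xs \<and> successively E xs"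

definition is_cycle :: "('a \<Rightarrow> 'a \<Rightarrow> bool) \<Rightarrow> 'a list \<Rightarrow> bool" where
  "is_cycle E xs \<longleftrightarrow> is_path E xs \<and> E (last xs) (hd xs)"

definition has_cycle :: "('a \<Rightarrow> 'a \<Rightarrow> bool) \<Rightarrow> 'a set \<Rightarrow> nat \<Rightarrow> bool" where
  "has_cycle E V m \<longleftrightarrow> (\<exists>xs. is_cycle E xs \<and> set xs \<subseteq> V \<and> length xs = m)"

lemma is_path_append:
  assumes "is_path E xs" "is_path E ys" "set xs \<inter> set ys = {}" "E (last xs) (hd ys)"
  shows "is_path E (xs @ ys)"
  using assms by (auto simp: is_path_def successively_append_iff)

lemma is_cycle_append:
  assumes "is_path E xs" "is_path E ys" "set xs \<inter> set ys = {}" "E (last xs) (hd ys)" "E (last ys) (hd xs)"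
  shows "is_cycle E (xs @ ys)"
  using is_path_append[OF assms(1-4)] assms by (auto simp: is_cycle_def is_path_def)

lemma is_path_singleton [simp]: "is_path E [x]"
  by (simp add: is_path_def)

lemma is_path_rev:
  assumes "symp E" "is_path E xs"
  shows "is_path E (rev xs)"
  using assms by (auto simp: is_path_def elim!: successively_mono dest: sympD)

lemma is_path_appendD:
  assumes "is_path E (xs @ ys)"
  shows "xs \<noteq> [] \<Longrightarrow> is_path E xs" "ys \<noteq> [] \<Longrightarrow> is_path E ys"
  using assms by (auto simp: is_path_def successively_append_iff)

lemma has_cycleI: "is_cycle E xs \<Longrightarrow> set xs \<subseteq> V \<Longrightarrow> length xs = m \<Longrightarrow> has_cycle E V m"
  by (auto simp: has_cycle_def)

lemma has_cycle_mono: "has_cycle E V m \<Longrightarrow> V \<subseteq> V' \<Longrightarrow> has_cycle E V' m"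
  by (auto simp: has_cycle_def)

lemma is_path_mono:
  assumes "is_path E xs" "\<And>x y. x \<in> set xs \<Longrightarrow> y \<in> set xs \<Longrightarrow> E x y \<Longrightarrow> F x y"
  shows "is_path F xs"
  using assms by (auto simp: is_path_def elim!: successively_mono)

lemma has_cycle_rel_mono:
  assumes "has_cycle E V m" "\<And>x y. x \<in> V \<Longrightarrow> y \<in> V \<Longrightarrow> E x y \<Longrightarrow> F x y"
  shows "has_cycle F V m"
proof -
  obtain xs where xs: "is_cycle E xs" "set xs \<subseteq> V" "length xs = m"
    using assms(1) by (auto simp: has_cycle_def)
  have "is_path F xs"
    using xs assms(2) by (intro is_path_mono[of E xs F]) (auto simp: is_cycle_def)
  moreover have "F (last xs) (hd xs)"
    using xs assms(2) unfolding is_cycle_def is_path_def by (metis hd_in_set last_in_set subsetD)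
  ultimately show ?thesis
    using xs by (auto simp: has_cycle_def is_cycle_def)
qed

section \<open>Complete bipartite graphs\<close>

lemma bipartite_path_even:
  assumes "symp E" "finite S" "finite T" "S \<inter> T = {}" "\<And>s t. s \<in> S \<Longrightarrow> t \<in> T \<Longrightarrow> E s t"
    and "s \<in> S" "t \<in> T" "m \<ge> 1" "card S \<ge> m" "card T \<ge> m"
  shows "\<exists>xs. is_path E xs \<and> set xs \<subseteq> S \<union> T \<and> length xs = 2 * m \<and> hd xs = s \<and> last xs = t"
  using assms(8,2-7,9,10)
proof (induction m arbitrary: S T s t rule: dec_induct)
  case base
  then show ?case
    by (intro exI[of _ "[s, t]"]) (auto simp: is_path_def)
next
  case (step m)
  have "card (T - {t}) \<ge> m" "card (S - {s}) \<ge> m"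
    using step.prems by auto
  moreover from this have "T - {t} \<noteq> {}" "S - {s} \<noteq> {}"
    using step.hyps by fastforce+
  then obtain t' s' where "t' \<in> T - {t}" "s' \<in> S - {s}"
    by blast
  ultimately obtain xs where xs: "is_path E xs" "set xs \<subseteq> (S - {s}) \<union> (T - {t'})"
    "length xs = 2 * m" "hd xs = s'" "last xs = t"
    using step.IH[of "S - {s}" "T - {t'}" s' t] step.prems by auto
  have "is_path E ([s, t'] @ xs)"
    using xs \<open>t' \<in> T - {t}\<close> \<open>s' \<in> S - {s}\<close> step.prems sympD[OF assms(1)]
    by (intro is_path_append) (auto simp: is_path_def)
  then show ?case
    using xs \<open>t' \<in> T - {t}\<close> step.prems
    by (intro exI[of _ "[s, t'] @ xs"]) (auto simp: is_path_def)
qed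

lemma bipartite_path_odd:
  assumes "symp E" "finite S" "finite T" "S \<inter> T = {}" "\<And>s t. s \<in> S \<Longrightarrow> t \<in> T \<Longrightarrow> E s t"
    and "s \<in> S" "s' \<in> S" "s \<noteq> s'" "m \<ge> 1" "card S \<ge> m + 1" "card T \<ge> m"
  shows "\<exists>xs. is_path E xs \<and> set xs \<subseteq> S \<union> T \<and> length xs = 2 * m + 1 \<and> hd xs = s \<and> last xs = s'"
proof -
  obtain t where t: "t \<in> T"
    using assms by fastforce
  obtain xs where xs: "is_path E xs" "set xs \<subseteq> (S - {s'}) \<union> T" "length xs = 2 * m" "hd xs = s" "last xs = t"
  proof (atomize_elim, rule bipartite_path_even[OF assms(1)])
    show "card (S - {s'}) \<ge> m"
      using assms by simp
  qed (use assms t in auto)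
  have "is_path E (xs @ [s'])"
    using xs assms t sympD[OF assms(1)] by (intro is_path_append) auto
  then show ?thesis
    using xs assms by (intro exI[of _ "xs @ [s']"]) (auto simp: is_path_def)
qed

text \<open>An odd cycle needs something that breaks the bipartition. The lemmas of this locale
  supply it in the three ways met later: an edge inside a side, a vertex adjacent to both sides, and
  an edge whose ends are attached to different vertices of the same side.\<close>

locale complete_bipartite =
  fixes E :: "'a \<Rightarrow> 'a \<Rightarrow> bool" and S T :: "'a set"
  assumes sym: "symp E" and finite_S: "finite S" and finite_T: "finite T" and disjoint: "S \<inter> T = {}"
    and complete: "\<And>s t. s \<in> S \<Longrightarrow> t \<in> T \<Longrightarrow> E s t"
begin

lemma cycle_inner_edge:
  assumes "s \<in> S" "s' \<in> S" "s \<noteq> s'" "E s s'" "card S \<ge> n + 1" "card T \<ge> n" "n \<ge> 1"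
  shows "has_cycle E (S \<union> T) (2 * n + 1)"
proof -
  obtain xs where "is_path E xs" "set xs \<subseteq> S \<union> T" "length xs = 2 * n + 1" "hd xs = s'" "last xs = s"
    using bipartite_path_odd[OF sym finite_S finite_T disjoint complete, of s' s n] assms by auto
  then show ?thesis
    using assms by (intro has_cycleI[of E xs]) (auto simp: is_cycle_def)
qed

lemma cycle_outer_vertex:
  assumes "s \<in> S" "t \<in> T" "E v s" "E v t" "v \<notin> S \<union> T" "card S \<ge> n" "card T \<ge> n" "n \<ge> 1"
  shows "has_cycle E (insert v (S \<union> T)) (2 * n + 1)"
proof -
  obtain xs where xs: "is_path E xs" "set xs \<subseteq> S \<union> T" "length xs = 2 * n" "hd xs = s" "last xs = t"
    using bipartite_path_even[OF sym finite_S finite_T disjoint complete, of s t n] assms by auto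
  have "is_cycle E ([v] @ xs)"
    using xs assms sympD[OF sym] by (intro is_cycle_append) auto
  then show ?thesis
    using xs by (intro has_cycleI[of E "[v] @ xs"]) auto
qed

lemma cycle_outer_edge:
  assumes "s \<in> S" "s' \<in> S" "s \<noteq> s'" "E u u'" "u \<noteq> u'" "E u s" "E u' s'"
    and "u \<notin> S \<union> T" "u' \<notin> S \<union> T" "card S \<ge> n" "card T \<ge> n - 1" "n \<ge> 2"
  shows "has_cycle E ({u, u'} \<union> S \<union> T) (2 * n + 1)"
proof -
  obtain xs where xs: "is_path E xs" "set xs \<subseteq> S \<union> T" "length xs = 2 * (n - 1) + 1" "hd xs = s'" "last xs = s"
  proof (atomize_elim, rule bipartite_path_odd[OF sym finite_S finite_T disjoint complete])
    show "n - 1 \<ge> 1" "n - 1 + 1 \<le> card S"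
      using assms by simp_all
  qed (use assms in auto)
  have "is_cycle E ([u, u'] @ xs)"
    using xs assms sympD[OF sym] by (intro is_cycle_append) (auto simp: is_path_def)
  then show ?thesis
    using xs assms by (intro has_cycleI[of E "[u, u'] @ xs"]) auto
qed

end

section \<open>Complete multipartite graphs\<close>

text \<open>List the vertices class by class. Two vertices at distance at least \<open>n\<close> in this list are
  in different classes, and the step \<open>n\<close> is coprime to the length \<open>2 n + 1\<close>.\<close>

lemma multipartite_cycle:
  fixes q :: "'a \<Rightarrow> 'b :: linorder"
  assumes "finite U" "card U \<ge> 2 * n + 1" "n \<ge> 1" "\<And>i. card {x \<in> U. q x = i} \<le> n"
    and E: "\<And>x y. x \<in> U \<Longrightarrow> y \<in> U \<Longrightarrow> q x \<noteq> q y \<Longrightarrow> E x y"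
  shows "has_cycle E U (2 * n + 1)"
proof -
  obtain us where us: "distinct us" "set us = U"
    using finite_distinct_list[OF assms(1)] by blast
  define ys where "ys = sort_key q us"
  have ys: "distinct ys" "set ys = U" "sorted (map q ys)" "length ys \<ge> 2 * n + 1"
    using us assms(2) distinct_card[OF us(1)] by (auto simp: ys_def)
  \<comment> \<open>Otherwise the \<open>j - i + 1 \<ge> n + 1\<close> vertices at positions
    \<open>i\<close> to \<open>j\<close> of the sorted list would all lie in one class.\<close>
  have far: "q (ys ! i) \<noteq> q (ys ! j)" if "i + n \<le> j" "j < length ys" for i j
  proof
    assume eq: "q (ys ! i) = q (ys ! j)"
    have same: "q (ys ! k) = q (ys ! i)" if k: "k \<in> {i..j}" for k
    proof -
      have "q (ys ! i) \<le> q (ys ! k)" "q (ys ! k) \<le> q (ys ! j)"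
        using sorted_nth_mono[OF ys(3), of i k] sorted_nth_mono[OF ys(3), of k j] k \<open>j < length ys\<close>
        by auto
      then show ?thesis
        using eq by simp
    qed
    have "(!) ys ` {i..j} \<subseteq> {x \<in> U. q x = q (ys ! i)}"
    proof (intro image_subsetI CollectI conjI same)
      show "ys ! k \<in> U" if "k \<in> {i..j}" for k
        using that \<open>j < length ys\<close> ys(2) by (metis atLeastAtMost_iff le_less_trans nth_mem)
    qed
    moreover have "inj_on ((!) ys) {i..j}"
      using ys(1) \<open>j < length ys\<close> by (intro inj_on_nth) auto
    ultimately have "card {i..j} \<le> card {x \<in> U. q x = q (ys ! i)}"
      using assms(1) by (intro card_inj_on_le[of "(!) ys"]) auto
    then show False
      using assms(4)[of "q (ys ! i)"] that by auto
  qed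
  have far_E: "E (ys ! i) (ys ! j)" if "i + n \<le> j \<or> j + n \<le> i" "i < length ys" "j < length ys" for i j
  proof (rule E)
    show "ys ! i \<in> U" "ys ! j \<in> U"
      using that nth_mem[of _ ys] unfolding ys(2) by blast+
    show "q (ys ! i) \<noteq> q (ys ! j)"
      using far[of i j] far[of j i] that by metis
  qed
  define M where "M = 2 * n + 1"
  define h where "h i = ys ! ((i * n) mod M)" for i
  have step: "E (h i) (h (Suc i))" for i
  proof -
    define a b where "a = (i * n) mod M" and "b = (Suc i * n) mod M"
    have b: "b = (a + n) mod M"
      by (simp add: a_def b_def mod_add_right_eq add.commute)
    have "a < M" "b < M"
      by (auto simp: a_def b_def M_def)
    moreover have "b = a + n \<or> b + M = a + n"
      using \<open>a < M\<close> b by (auto simp: M_def mod_if)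
    \<comment> \<open>After a wrap-around the two positions differ by \<open>M - n = n + 1\<close>,
      which is still far enough.\<close>
    ultimately have "a + n \<le> b \<or> b + n \<le> a"
      by (auto simp: M_def)
    then show ?thesis
      using far_E[of a b] \<open>a < M\<close> \<open>b < M\<close> ys(4) unfolding h_def a_def[symmetric] b_def[symmetric] by (simp add: M_def)
  qed
  have cop: "coprime n M"
  proof -
    have "coprime n (1 + n * 2)"
      by (metis coprime_1_right coprime_iff_gcd_eq_1 gcd_add_mult mult.commute add.commute)
    then show ?thesis
      by (simp add: M_def mult.commute)
  qed
  have inj: "inj_on h {..<M}"
  proof (rule inj_onI)
    fix i j assume ij: "i \<in> {..<M}" "j \<in> {..<M}" "h i = h j"
    have "(i * n) mod M < length ys" "(j * n) mod M < length ys"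
      using ys(4) by (auto simp: M_def intro: less_le_trans[OF mod_less_divisor])
    then have "(i * n) mod M = (j * n) mod M"
      using ij ys(1) by (auto simp: h_def nth_eq_iff_index_eq)
    moreover have "k = l" if "k \<le> l" "l < M" "(k * n) mod M = (l * n) mod M" for k l
    proof -
      have "M dvd l * n - k * n"
        using that by (subst mod_eq_dvd_iff_nat[symmetric]) auto
      then have "M dvd l - k"
        using cop by (simp add: coprime_dvd_mult_left_iff coprime_commute flip: diff_mult_distrib)
      then show ?thesis
        using that by (auto dest!: dvd_imp_le)
    qed
    ultimately show "i = j"
      using ij by (metis lessThan_iff nle_le)
  qed
  define xs where "xs = map h [0..<M]"
  have "h 0 = h M"
    by (simp add: h_def)
  moreover have "M = Suc (2 * n)"
    by (simp add: M_def)
  moreover have "hd xs = h 0" "last xs = h (2 * n)"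
    by (simp_all add: xs_def hd_conv_nth last_conv_nth M_def del: upt_Suc)
  ultimately have "E (last xs) (hd xs)"
    using step[of "2 * n"] by simp
  moreover have "is_path E xs"
    using inj step by (auto simp: is_path_def xs_def M_def distinct_map successively_conv_nth atLeast0LessThan
      simp del: upt_Suc)
  moreover have "set xs \<subseteq> U"
    using ys by (auto simp: xs_def h_def M_def intro!: nth_mem less_le_trans[OF mod_less_divisor])
  ultimately show ?thesis
    by (intro has_cycleI[of E xs]) (auto simp: is_cycle_def xs_def M_def)
qed

section \<open>Long cycles\<close>

lemma is_cycle_rotate:
  assumes "is_cycle E (xs @ ys)"
  shows "is_cycle E (ys @ xs)"
proof (cases "xs = [] \<or> ys = []")
  case False
  then show ?thesis
    using assms by (simp add: is_cycle_def is_path_def successively_append_iff Int_commute)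
qed (use assms in auto)

text \<open>\<open>H\<close> is a smallest nonempty set of average degree at least
  \<open>2 * n\<close>. Deleting a vertex of degree at most \<open>n\<close> lowers the degree sum
  by at most \<open>2 * n\<close>, so the average would survive. An average of \<open>2 * n\<close>
  also forces more than \<open>2 * n\<close> vertices.\<close>

lemma min_degree_subgraph:
  assumes "finite V" "V \<noteq> {}" "symp E" "\<And>x. \<not> E x x" "n \<ge> 1"
    and dens: "(\<Sum>x\<in>V. card {y \<in> V. E x y}) \<ge> 2 * n * card V"
  obtains H where "H \<subseteq> V" "card H \<ge> 2 * n + 1" "\<And>x. x \<in> H \<Longrightarrow> card {y \<in> H. E x y} \<ge> n + 1"
proof -
  define P where "P H \<longleftrightarrow> H \<subseteq> V \<and> H \<noteq> {} \<and> 2 * n * card H \<le> (\<Sum>x\<in>H. card {y \<in> H. E x y})" for H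
  have "P V"
    using assms by (auto simp: P_def)
  then obtain H where "P H" and min: "\<And>H'. P H' \<Longrightarrow> card H \<le> card H'"
    using ex_has_least_nat[of P V card] by blast
  have H: "H \<subseteq> V" "H \<noteq> {}" "finite H" and sum_H: "2 * n * card H \<le> (\<Sum>x\<in>H. card {y \<in> H. E x y})"
    using \<open>P H\<close> finite_subset[OF _ \<open>finite V\<close>] by (auto simp: P_def)
  have deg_le: "card {y \<in> H. E x y} \<le> card H - 1" if "x \<in> H" for x
  proof -
    have "{y \<in> H. E x y} \<subseteq> H - {x}"
      using assms(4) by auto
    then have "card {y \<in> H. E x y} \<le> card (H - {x})"
      using \<open>finite H\<close> by (intro card_mono) auto
    then show ?thesis
      using that by simp
  qed
  have "(\<Sum>x\<in>H. card {y \<in> H. E x y}) \<le> card H * (card H - 1)"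
    using sum_bounded_above[of H "\<lambda>x. card {y \<in> H. E x y}" "card H - 1"] deg_le by simp
  then have "card H * (2 * n) \<le> card H * (card H - 1)"
    using order_trans[OF sum_H] by (subst mult.commute) blast
  moreover have "card H > 0"
    using H by (simp add: card_gt_0_iff)
  ultimately have "card H \<ge> 2 * n + 1"
    by auto
  moreover have "card {y \<in> H. E x y} \<ge> n + 1" if "x \<in> H" for x
  proof (rule ccontr)
    assume "\<not> card {y \<in> H. E x y} \<ge> n + 1"
    then have deg: "card {y \<in> H. E x y} \<le> n"
      by simp
    define H' where "H' = H - {x}"
    have H': "H = insert x H'" "x \<notin> H'" "finite H'"
      using that \<open>finite H\<close> by (auto simp: H'_def)
    have split: "card {y \<in> H. E z y} = card {y \<in> H'. E z y} + (if E z x then 1 else 0)" if "z \<in> H'" for z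
    proof -
      have "{y \<in> H. E z y} = (if E z x then insert x {y \<in> H'. E z y} else {y \<in> H'. E z y})"
        using H' by auto
      then show ?thesis
        using H' by simp
    qed
    have x: "{y \<in> H. E x y} = {z \<in> H'. E z x}"
      using H' assms(3,4) by (auto dest: sympD)
    have "(\<Sum>z\<in>H. card {y \<in> H. E z y}) = card {y \<in> H. E x y} + (\<Sum>z\<in>H'. card {y \<in> H. E z y})"
      using H' by simp
    also have "(\<Sum>z\<in>H'. card {y \<in> H. E z y}) = (\<Sum>z\<in>H'. card {y \<in> H'. E z y}) + card {z \<in> H'. E z x}"
    proof -
      have "(\<Sum>z\<in>H'. card {y \<in> H. E z y}) = (\<Sum>z\<in>H'. card {y \<in> H'. E z y} + (if E z x then 1 else 0))"
        using split by (rule sum.cong[OF refl])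
      then show ?thesis
        using H'(3) by (simp add: sum.distrib sum.If_cases Int_def)
    qed
    finally have "2 * n * card H' \<le> (\<Sum>z\<in>H'. card {y \<in> H'. E z y})"
      using sum_H deg H' unfolding x by simp
    moreover have "H' \<noteq> {}"
      using \<open>card H \<ge> 2 * n + 1\<close> H' \<open>n \<ge> 1\<close> by auto
    ultimately have "P H'"
      using H H' by (auto simp: P_def)
    then show False
      using min[of H'] H' by simp
  qed
  ultimately show ?thesis
    using that H by blast
qed

text \<open>Dirac's argument on a longest path; the joinedness hypothesis replaces 2-connectedness.\<close>

lemma long_cycle:
  assumes "finite V" "V \<noteq> {}" "symp E" "\<And>x. \<not> E x x" "n \<ge> 1"
    and dens: "(\<Sum>x\<in>V. card {y \<in> V. E x y}) \<ge> 2 * n * card V"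
    and joined: "\<And>A B. A \<subseteq> V \<Longrightarrow> B \<subseteq> V \<Longrightarrow> A \<inter> B = {} \<Longrightarrow> card A \<ge> n + 1 \<Longrightarrow> card B \<ge> n \<Longrightarrow>
        \<exists>a\<in>A. \<exists>b\<in>B. E a b"
  shows "\<exists>m \<ge> 2 * n + 1. has_cycle E V m"
proof -
  obtain H where H: "H \<subseteq> V" "card H \<ge> 2 * n + 1" "\<And>x. x \<in> H \<Longrightarrow> card {y \<in> H. E x y} \<ge> n + 1"
    using min_degree_subgraph[OF assms(1-5) dens] by blast
  have "finite H"
    using H(1) assms(1) finite_subset by blast
  note symE = sympD[OF assms(3)]
  define P where "P xs \<longleftrightarrow> is_path E xs \<and> set xs \<subseteq> H" for xs
  have P_len: "length xs \<le> card H" if "P xs" for xs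
    using that card_mono[OF \<open>finite H\<close>, of "set xs"] distinct_card[of xs] by (auto simp: P_def is_path_def)
  obtain h where "h \<in> H"
    using H(2) by fastforce
  then have "P [h]"
    by (simp add: P_def)
  then obtain xs where "P xs" and longest: "\<And>ys. P ys \<Longrightarrow> length ys \<le> length xs"
    using ex_has_greatest_nat[of P "[h]" length "Suc (card H)"] P_len le_imp_less_Suc by meson
  have xs: "is_path E xs" "set xs \<subseteq> H" "xs \<noteq> []" "distinct xs"
    using \<open>P xs\<close> by (auto simp: P_def is_path_def)
  define p where "p = length xs"
  have "p > 0"
    using xs by (simp add: p_def)
  have hd_xs: "hd xs = xs ! 0" and last_xs: "last xs = xs ! (p - 1)"
    using xs by (auto simp: p_def hd_conv_nth last_conv_nth)
  have last_take: "last (take (Suc i) xs) = xs ! i" if "i < p" for i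
    using that by (simp add: take_Suc_conv_app_nth p_def)
  have last_drop: "last (drop i xs) = xs ! (p - 1)" if "i < p" for i
    using that last_xs by (simp add: p_def)
  have hd_drop: "hd (drop i xs) = xs ! i" if "i < p" for i
    using that by (simp add: hd_drop_conv_nth p_def)
  have hd_take: "hd (take (Suc i) xs) = xs ! 0" for i
    using hd_xs by simp
  have ends_H: "xs ! 0 \<in> H" "xs ! (p - 1) \<in> H"
    using xs(2) hd_in_set[OF xs(3)] last_in_set[OF xs(3)] unfolding hd_xs last_xs by auto
  have nb_hd: "y \<in> set xs" if "y \<in> H" "E (xs ! 0) y" for y
  proof (rule ccontr)
    assume "y \<notin> set xs"
    then have "P ([y] @ xs)"
      using that xs symE hd_xs unfolding P_def by (intro conjI is_path_append) auto
    then show False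
      using longest by fastforce
  qed
  have nb_last: "y \<in> set xs" if "y \<in> H" "E y (xs ! (p - 1))" for y
  proof (rule ccontr)
    assume "y \<notin> set xs"
    then have "P (xs @ [y])"
      using that xs symE last_xs unfolding P_def by (intro conjI is_path_append) auto
    then show False
      using longest by fastforce
  qed
  define NA where "NA = {i. i < p \<and> E (xs ! 0) (xs ! i)}"
  define NZ where "NZ = {i. i < p \<and> E (xs ! i) (xs ! (p - 1))}"
  \<comment> \<open>The predecessors of the neighbours of the first vertex. An index in both
    \<open>A\<close> and \<open>NZ\<close> closes the path to a cycle on the same vertices.\<close>
  define A where "A = {a. Suc a \<in> NA}"
  have inj: "inj_on ((!) xs) {..<p}"
    using xs by (intro inj_on_nth) (auto simp: p_def)
  have NA_img: "(!) xs ` NA = {y \<in> H. E (xs ! 0) y}"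
  proof safe
    fix y assume "y \<in> H" "E (xs ! 0) y"
    then show "y \<in> (!) xs ` NA"
      using nb_hd[of y] by (auto simp: NA_def p_def in_set_conv_nth)
  qed (use xs in \<open>auto simp: NA_def p_def\<close>)
  have NZ_img: "(!) xs ` NZ = {y \<in> H. E (xs ! (p - 1)) y}"
  proof safe
    fix y assume "y \<in> H" "E (xs ! (p - 1)) y"
    then show "y \<in> (!) xs ` NZ"
      using nb_last[of y] symE by (auto simp: NZ_def p_def in_set_conv_nth)
  qed (use xs symE in \<open>auto simp: NZ_def p_def\<close>)
  have "card NA = card {y \<in> H. E (xs ! 0) y}"
    unfolding NA_img[symmetric] by (intro card_image[symmetric] inj_on_subset[OF inj]) (auto simp: NA_def)
  then have card_NA: "card NA \<ge> n + 1"
    using H(3)[OF ends_H(1)] by simp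
  have "card NZ = card {y \<in> H. E (xs ! (p - 1)) y}"
    unfolding NZ_img[symmetric] by (intro card_image[symmetric] inj_on_subset[OF inj]) (auto simp: NZ_def)
  then have card_NZ: "card NZ \<ge> n + 1"
    using H(3)[OF ends_H(2)] by simp
  have "0 \<notin> NA"
    using assms(4) by (auto simp: NA_def)
  have NZ_less: "i < p - 1" if "i \<in> NZ" for i
  proof -
    have "i \<noteq> p - 1" "i < p"
      using that assms(4)[of "xs ! i"] by (auto simp: NZ_def)
    then show ?thesis
      by linarith
  qed
  have fin: "finite NA" "finite NZ"
    by (auto simp: NA_def NZ_def)
  have "NA = Suc ` A"
  proof safe
    fix i assume "i \<in> NA"
    then show "i \<in> Suc ` A"
      using \<open>0 \<notin> NA\<close> by (cases i) (auto simp: A_def)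
  qed (auto simp: A_def)
  then have card_A: "card A \<ge> n + 1" and "finite A"
    using card_NA card_image[of Suc A] fin by (auto simp: finite_image_iff)
  show ?thesis
  proof (cases "A \<inter> NZ = {}")
    case False
    then obtain i where i: "Suc i < p" "E (xs ! 0) (xs ! Suc i)" "E (xs ! i) (xs ! (p - 1))"
      by (auto simp: A_def NA_def NZ_def)
    define ys where "ys = take (Suc i) xs @ rev (drop (Suc i) xs)"
    have set_ys: "set ys = set xs"
      unfolding ys_def set_append set_rev by (metis append_take_drop_id set_append)
    have "is_path E (take (Suc i) xs)" "is_path E (rev (drop (Suc i) xs))"
      using xs i is_path_appendD[of E "take (Suc i) xs" "drop (Suc i) xs"] is_path_rev[OF assms(3)]
      by (auto simp: p_def)
    moreover have "set (take (Suc i) xs) \<inter> set (rev (drop (Suc i) xs)) = {}"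
      using xs by (simp add: set_take_disj_set_drop_if_distinct)
    moreover have "last (take (Suc i) xs) = xs ! i" "hd (take (Suc i) xs) = xs ! 0"
      "hd (rev (drop (Suc i) xs)) = xs ! (p - 1)" "last (rev (drop (Suc i) xs)) = xs ! Suc i"
      using i last_take last_drop hd_drop hd_take by (simp_all add: hd_rev last_rev)
    moreover have "E (xs ! Suc i) (xs ! 0)"
      using i(2) by (rule symE)
    ultimately have cyc: "is_cycle E ys"
      using i(3) unfolding ys_def by (intro is_cycle_append) simp_all
    have len: "length ys = p"
      using i by (simp add: ys_def p_def)
    \<comment> \<open>Opening the cycle at \<open>x\<close> and prepending \<open>y\<close> would
      give a path longer than \<open>xs\<close>. Joinedness then forces the cycle to cover all of
      \<open>H\<close>.\<close>
    have no_edge: "\<not> E y x" if "x \<in> set xs" "y \<in> H - set xs" for x y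
    proof
      assume "E y x"
      obtain us vs where ys_eq: "ys = us @ x # vs"
        using \<open>x \<in> set xs\<close> set_ys split_list by metis
      define zs where "zs = (x # vs) @ us"
      have "is_path E zs"
        unfolding zs_def using is_cycle_rotate[of E us "x # vs"] cyc ys_eq by (auto simp: is_cycle_def)
      moreover have "set zs = set xs" "length zs = p" "hd zs = x"
        using set_ys ys_eq len by (auto simp: zs_def)
      ultimately have "P ([y] @ zs)"
        using that \<open>E y x\<close> xs(2) unfolding P_def by (intro conjI is_path_append) auto
      then show False
        using longest[of "[y] @ zs"] \<open>length zs = p\<close> by (simp add: p_def)
    qed
    have "set xs = H"
    proof (rule ccontr)
      assume "set xs \<noteq> H"
      then obtain y where y: "y \<in> H - set xs"
        using xs(2) by blast
      have "{z \<in> H. E y z} \<subseteq> H - set xs"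
        using no_edge y by blast
      then have "card (H - set xs) \<ge> n + 1"
        using H(3)[of y] y \<open>finite H\<close> by (meson DiffD1 card_mono finite_Diff le_trans)
      moreover have "card (set xs) \<ge> n + 1"
      proof -
        have "card NA \<le> card {..<p}"
          by (intro card_mono) (auto simp: NA_def)
        then show ?thesis
          using card_NA distinct_card[OF xs(4)] by (simp add: p_def)
      qed
      ultimately have "\<exists>a\<in>H - set xs. \<exists>b\<in>set xs. E a b"
        using H(1) xs(2) by (intro joined[of "H - set xs" "set xs"]) auto
      then show False
        using no_edge by blast
    qed
    then have "p \<ge> 2 * n + 1"
      using H(2) distinct_card[OF xs(4)] by (simp add: p_def)
    then show ?thesis
      using cyc len set_ys xs(2) H(1) by (intro exI[of _ p]) (auto intro!: has_cycleI[of E ys])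
  next
    case disj: True
    show ?thesis
    proof (cases "\<exists>i\<in>NA. \<exists>j\<in>NZ. j < i")
      case True
      then obtain i0 j0 where ij0: "i0 \<in> NA" "j0 \<in> NZ" "j0 < i0"
        by blast
      \<comment> \<open>A crossing pair of smallest gap is chosen. The cycle goes from the start to
        \<open>j\<close>, jumps to the end, returns to \<open>i\<close> and jumps back to the start,
        so it misses only the gap.\<close>
      define Q where "Q q \<longleftrightarrow> fst q \<in> NA \<and> snd q \<in> NZ \<and> snd q < fst q" for q
      have "Q (i0, j0)"
        using ij0 by (simp add: Q_def)
      then obtain q where q: "Q q" "\<And>q'. Q q' \<Longrightarrow> fst q - snd q \<le> fst q' - snd q'"
        using ex_has_least_nat[of Q "(i0, j0)" "\<lambda>q. fst q - snd q"] by blast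
      obtain i j where "q = (i, j)"
        by (cases q)
      then have ij: "i \<in> NA" "j \<in> NZ" "j < i"
        and min: "\<And>i' j'. i' \<in> NA \<Longrightarrow> j' \<in> NZ \<Longrightarrow> j' < i' \<Longrightarrow> i - j \<le> i' - j'"
        using q(1) q(2)[of "(i', j')" for i' j'] by (auto simp: Q_def)
      have "i < p" "j < p"
        using ij by (auto simp: NA_def NZ_def)
      define ys where "ys = take (Suc j) xs @ rev (drop i xs)"
      have "is_path E (take (Suc j) xs)" "is_path E (rev (drop i xs))"
        using xs ij \<open>i < p\<close> is_path_appendD[of E "take (Suc j) xs" "drop (Suc j) xs"]
          is_path_appendD[of E "take i xs" "drop i xs"] is_path_rev[OF assms(3)]
        by (auto simp: p_def)
      moreover have "set (take (Suc j) xs) \<inter> set (rev (drop i xs)) = {}"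
        using xs ij by (simp add: set_take_disj_set_drop_if_distinct)
      moreover have "last (take (Suc j) xs) = xs ! j" "hd (take (Suc j) xs) = xs ! 0"
        "hd (rev (drop i xs)) = xs ! (p - 1)" "last (rev (drop i xs)) = xs ! i"
        using \<open>i < p\<close> \<open>j < p\<close> last_take last_drop hd_drop hd_take by (simp_all add: hd_rev last_rev)
      moreover have "E (xs ! j) (xs ! (p - 1))" "E (xs ! i) (xs ! 0)"
        using ij by (auto simp: NA_def NZ_def intro: symE)
      ultimately have cyc: "is_cycle E ys"
        unfolding ys_def by (intro is_cycle_append) simp_all
      have len: "length ys = card ({..j} \<union> {i..<p})"
        using ij \<open>i < p\<close> by (subst card_Un_disjoint) (auto simp: ys_def p_def)
      \<comment> \<open>By minimality no index strictly between \<open>j\<close> and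
        \<open>i\<close> lies in \<open>NA\<close> or \<open>NZ\<close>, so \<open>i - 1\<close> is
        the only index of \<open>A\<close> that the cycle can miss. This gives at least
        \<open>n + (n + 1) + 1\<close> vertices.\<close>
      have "(A - {i - 1}) \<union> NZ \<union> {p - 1} \<subseteq> {..j} \<union> {i..<p}"
      proof
        fix k assume "k \<in> (A - {i - 1}) \<union> NZ \<union> {p - 1}"
        then consider "k \<in> A" "k \<noteq> i - 1" | "k \<in> NZ" | "k = p - 1"
          by blast
        then show "k \<in> {..j} \<union> {i..<p}"
        proof cases
          case 1
          then have "Suc k \<in> NA" "Suc k \<noteq> i" "Suc k < p"
            using ij by (auto simp: A_def NA_def)
          moreover have "k \<le> j \<or> i \<le> k"
          proof (rule ccontr)
            assume "\<not> (k \<le> j \<or> i \<le> k)"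
            then show False
              using min[OF \<open>Suc k \<in> NA\<close> ij(2)] ij(3) \<open>Suc k \<noteq> i\<close> by linarith
          qed
          ultimately show ?thesis
            by auto
        next
          case 2
          moreover have "k \<le> j \<or> i \<le> k"
          proof (rule ccontr)
            assume "\<not> (k \<le> j \<or> i \<le> k)"
            then show False
              using min[OF ij(1) 2] ij(3) by linarith
          qed
          ultimately show ?thesis
            using NZ_less[of k] by auto
        next
          case 3
          then show ?thesis
            using \<open>i < p\<close> by auto
        qed
      qed
      then have "card ((A - {i - 1}) \<union> NZ \<union> {p - 1}) \<le> length ys"
        unfolding len by (intro card_mono) auto
      moreover have "p - 1 \<notin> A" "p - 1 \<notin> NZ"
        using NZ_less by (auto simp: A_def NA_def)
      ultimately have "card (A - {i - 1}) + card NZ + 1 \<le> length ys"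
        using disj fin \<open>finite A\<close> by (subst (asm) card_Un_disjoint; (subst (asm) card_Un_disjoint)?) auto
      moreover have "card (A - {i - 1}) \<ge> n"
        using card_A diff_card_le_card_Diff[of "{i - 1}" A] by simp
      ultimately have "length ys \<ge> 2 * n + 1"
        using card_NZ by simp
      moreover have "set ys \<subseteq> V"
        using xs(2) H(1) by (auto simp: ys_def dest: in_set_takeD in_set_dropD)
      ultimately show ?thesis
        using cyc by (intro exI[of _ "length ys"]) (auto intro: has_cycleI)
    next
      case False
      \<comment> \<open>Now every neighbour of the first vertex comes no later than any neighbour of
        the last. Joinedness of the predecessors of the former and the successors of the latter
        provides the one edge that closes a cycle through the whole path.\<close>
      define A' B' where "A' = (!) xs ` A" and "B' = (!) xs ` (Suc ` NZ)"
      have A_lt: "A \<subseteq> {..<p}" and NZ_lt: "Suc ` NZ \<subseteq> {..<p}"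
        using NZ_less by (fastforce simp: A_def NA_def)+
      have AB_disj: "A \<inter> Suc ` NZ = {}"
        using False by (force simp: A_def)
      have card_A': "card A' = card A" and card_B': "card B' = card NZ"
        using A_lt NZ_lt inj by (simp_all add: A'_def B'_def card_image inj_on_subset)
      have "A' \<inter> B' = {}"
        unfolding A'_def B'_def using inj_on_image_Int[OF inj A_lt NZ_lt] AB_disj by auto
      moreover have "A' \<subseteq> V" "B' \<subseteq> V"
        using A_lt NZ_lt xs(2) H(1) by (fastforce simp: A'_def B'_def p_def)+
      ultimately obtain a j where aj: "a \<in> A" "j \<in> NZ" "E (xs ! a) (xs ! Suc j)"
        using joined[of A' B'] card_A card_NZ card_A' card_B' by (auto simp: A'_def B'_def)
      then have le: "Suc a \<le> j" "Suc a < p" "Suc j < p"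
        using False NZ_less[of j] by (force simp: A_def NA_def)+
      \<comment> \<open>The cycle runs through \<open>X\<close> backwards, \<open>Y\<close> forwards
        and \<open>Z\<close> backwards. Its connecting edges come from
        \<open>Suc a \<in> NA\<close>, \<open>j \<in> NZ\<close> and joinedness, in this
        order.\<close>
      define X Y Z where "X = take (Suc a) xs" and "Y = take (Suc j - Suc a) (drop (Suc a) xs)"
        and "Z = drop (Suc j) xs"
      have XYZ: "xs = X @ Y @ Z"
        using le unfolding X_def Y_def Z_def
        by (metis Suc_le_mono append_take_drop_id drop_drop le_add_diff_inverse2 le_SucI)
      have ne: "X \<noteq> []" "Y \<noteq> []" "Z \<noteq> []"
        using le by (auto simp: X_def Y_def Z_def p_def)
      have ends: "hd X = xs ! 0" "last X = xs ! a" "hd Y = xs ! Suc a" "last Y = xs ! j" "hd Z = xs ! Suc j"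
        "last Z = xs ! (p - 1)"
        using le last_take[of a] last_drop[of "Suc j"] hd_drop[of "Suc a"] hd_drop[of "Suc j"] hd_take[of a]
        by (auto simp: X_def Y_def Z_def p_def last_conv_nth)
      have paths: "is_path E X" "is_path E Y" "is_path E Z"
        using xs(1) ne unfolding XYZ by (auto dest: is_path_appendD)
      have disj': "set X \<inter> set Y = {}" "set X \<inter> set Z = {}" "set Y \<inter> set Z = {}"
        using xs(4) unfolding XYZ by auto
      have "is_path E (rev X @ Y)"
        using paths ne ends disj' aj is_path_rev[OF assms(3)]
        by (intro is_path_append) (auto simp: last_rev A_def NA_def)
      moreover have "E (xs ! j) (xs ! (p - 1))" "E (xs ! Suc j) (xs ! a)"
        using aj by (auto simp: NZ_def intro: symE)
      ultimately have "is_cycle E ((rev X @ Y) @ rev Z)"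
        using paths ne ends disj' is_path_rev[OF assms(3)]
        by (intro is_cycle_append) (auto simp: last_rev hd_rev)
      moreover have "card (A \<union> Suc ` NZ) \<le> p"
        using A_lt NZ_lt card_mono[of "{..<p}" "A \<union> Suc ` NZ"] by auto
      then have "p \<ge> 2 * n + 1"
        using AB_disj card_A card_NZ fin \<open>finite A\<close> by (simp add: card_Un_disjoint card_image)
      moreover have "length ((rev X @ Y) @ rev Z) = p" "set ((rev X @ Y) @ rev Z) = set xs"
        using XYZ by (auto simp: p_def)
      ultimately show ?thesis
        using xs(2) H(1) by (intro exI[of _ p]) (auto intro!: has_cycleI)
    qed
  qed
qed

section \<open>Shortening cycles in two-coloured multipartite graphs\<close>

text \<open>A cycle as a periodic function on all natural numbers: rotations become index shifts and
  edges across the end of a vertex list need no special case.\<close>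

definition cyclic_enum :: "('a \<Rightarrow> 'a \<Rightarrow> bool) \<Rightarrow> nat \<Rightarrow> (nat \<Rightarrow> 'a) \<Rightarrow> bool" where
  "cyclic_enum E l v \<longleftrightarrow> l > 0 \<and> (\<forall>i j. v i = v j \<longleftrightarrow> i mod l = j mod l) \<and> (\<forall>i. E (v i) (v (Suc i)))"

lemma cyclic_enum_eq_iff: "cyclic_enum E l v \<Longrightarrow> v i = v j \<longleftrightarrow> i mod l = j mod l"
  and cyclic_enum_step: "cyclic_enum E l v \<Longrightarrow> E (v i) (v (Suc i))"
  and cyclic_enum_period: "cyclic_enum E l v \<Longrightarrow> v (i + l) = v i"
  by (auto simp: cyclic_enum_def)

lemma cyclic_enum_shift:
  assumes "cyclic_enum E l v"
  shows "cyclic_enum E l (\<lambda>i. v (i + s))"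
proof -
  have "(i + s) mod l = (j + s) mod l \<longleftrightarrow> i mod l = j mod l" for i j
  proof -
    have "int (i + s) mod int l = int (j + s) mod int l \<longleftrightarrow> int i mod int l = int j mod int l"
      by (simp add: mod_eq_dvd_iff)
    then show ?thesis
      by (metis of_nat_eq_iff of_nat_mod)
  qed
  then show ?thesis
    using assms by (auto simp: cyclic_enum_def)
qed

lemma cyclic_enum_img:
  assumes "cyclic_enum E l v"
  shows "range v = v ` {..<l}" "card (range v) = l"
proof -
  have "v i = v (i mod l)" for i
    using assms by (simp add: cyclic_enum_eq_iff)
  moreover have "i mod l < l" for i
    using assms by (simp add: cyclic_enum_def)
  ultimately show *: "range v = v ` {..<l}"
    by blast
  have "inj_on v {..<l}"
    using assms by (auto simp: cyclic_enum_eq_iff inj_on_def)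
  then show "card (range v) = l"
    by (simp add: * card_image)
qed

lemma has_cycle_imp_cyclic_enum:
  assumes "has_cycle E V l"
  obtains v where "cyclic_enum E l v" "range v \<subseteq> V"
proof -
  obtain xs where xs: "is_cycle E xs" "set xs \<subseteq> V" "length xs = l"
    using assms by (auto simp: has_cycle_def)
  then have ne: "xs \<noteq> []" "l > 0" "distinct xs"
    by (auto simp: is_cycle_def is_path_def)
  define v where "v i = xs ! (i mod l)" for i
  have less: "i mod l < length xs" for i
    using xs ne by simp
  have "E (v i) (v (Suc i))" for i
  proof (cases "Suc (i mod l) = l")
    case True
    then have "i mod l = l - 1" "Suc i mod l = 0"
      by (auto simp: mod_Suc)
    then have "v i = last xs" "v (Suc i) = hd xs"
      using xs(3) ne by (simp_all add: v_def last_conv_nth hd_conv_nth)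
    then show ?thesis
      using xs by (simp add: is_cycle_def)
  next
    case False
    then have "Suc i mod l = Suc (i mod l)"
      by (simp add: mod_Suc)
    then show ?thesis
      using xs less[of "Suc i"] by (simp add: v_def is_cycle_def is_path_def successively_nth)
  qed
  moreover have "v i = v j \<longleftrightarrow> i mod l = j mod l" for i j
    using less ne by (simp add: v_def nth_eq_iff_index_eq)
  moreover have "range v \<subseteq> V"
    using xs less by (auto simp: v_def)
  ultimately show ?thesis
    using that[of v] ne by (simp add: cyclic_enum_def)
qed

lemma is_path_map_cyclic_enum:
  assumes "cyclic_enum E l v" "js \<noteq> []" "distinct (map (\<lambda>i. i mod l) js)"
    "successively (\<lambda>i j. F (v i) (v j)) js"
  shows "is_path F (map v js)"
proof -
  have "distinct js" "inj_on (\<lambda>i. i mod l) (set js)"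
    using assms(3) by (simp_all add: distinct_map)
  then have "distinct (map v js)"
    using cyclic_enum_eq_iff[OF assms(1)] by (auto simp: distinct_map inj_on_def)
  then show ?thesis
    using assms by (simp add: is_path_def successively_map)
qed

lemma has_cycle_map_cyclic_enum:
  assumes "cyclic_enum E l v" "range v \<subseteq> V" "js \<noteq> []" "distinct (map (\<lambda>i. i mod l) js)"
    "successively (\<lambda>i j. F (v i) (v j)) js" "F (v (last js)) (v (hd js))" "length js = m"
  shows "has_cycle F V m"
  using is_path_map_cyclic_enum[OF assms(1,3,4,5)] assms
  by (intro has_cycleI[of F "map v js"]) (auto simp: is_cycle_def last_map hd_map)

lemma distinct_mod_less:
  fixes l :: nat
  assumes "distinct js" "\<And>i. i \<in> set js \<Longrightarrow> i < l"
  shows "distinct (map (\<lambda>i. i mod l) js)"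
proof -
  have "map (\<lambda>i. i mod l) js = js"
    by (intro map_idI mod_less assms(2))
  then show ?thesis
    using assms(1) by simp
qed

lemma successively_map_upt:
  "successively P (map f [a..<b]) \<longleftrightarrow> (\<forall>i. a \<le> i \<and> Suc i < b \<longrightarrow> P (f i) (f (Suc i)))"
proof
  assume L: "successively P (map f [a..<b])"
  show "\<forall>i. a \<le> i \<and> Suc i < b \<longrightarrow> P (f i) (f (Suc i))"
  proof safe
    fix i assume i: "a \<le> i" "Suc i < b"
    then show "P (f i) (f (Suc i))"
      using successively_nth[OF L, of "i - a"] by simp
  qed
next
  assume "\<forall>i. a \<le> i \<and> Suc i < b \<longrightarrow> P (f i) (f (Suc i))"
  then show "successively P (map f [a..<b])"
    by (auto simp: successively_conv_nth)
qed

lemma successively_upt: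
  "successively P [a..<b] \<longleftrightarrow> (\<forall>i. a \<le> i \<and> Suc i < b \<longrightarrow> P i (Suc i))"
  using successively_map_upt[of P id a b] by simp

text \<open>The chord replaces an arc of \<open>d\<close> edges. In an even cycle, a chord with
  \<open>d\<close> even thus closes an odd cycle on either side.\<close>

lemma cyclic_enum_chord:
  assumes "cyclic_enum E l v" "range v \<subseteq> V" "E (v i) (v (i + d))" "d > 0" "d < l"
  shows "has_cycle E V (l + 1 - d)"
proof -
  define w where "w j = v (j + i)" for j
  have w: "cyclic_enum E l w"
    unfolding w_def using assms(1) by (rule cyclic_enum_shift)
  have "distinct (map (\<lambda>j. j mod l) [d..<l + 1])"
  proof -
    have "inj_on (\<lambda>j. j mod l) {d..<l + 1}"
    proof (rule inj_onI)
      fix x y assume "x \<in> {d..<l + 1}" "y \<in> {d..<l + 1}" "x mod l = y mod l"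
      then show "x = y"
        using assms(4,5) by (cases "x = l"; cases "y = l") auto
    qed
    then show ?thesis
      by (simp only: distinct_map set_upt distinct_upt simp_thms)
  qed
  moreover have "E (w l) (w d)"
    using assms(3) cyclic_enum_period[OF assms(1), of i] by (simp add: w_def add.commute)
  moreover have "successively (\<lambda>i j. E (w i) (w j)) [d..<l + 1]"
    unfolding successively_upt using cyclic_enum_step[OF w] by blast
  moreover have "range w \<subseteq> V"
    using assms(2) by (auto simp: w_def)
  ultimately show ?thesis
    using assms(5) w by (intro has_cycle_map_cyclic_enum[of E l w V "[d..<l + 1]" E]) auto
qed

section \<open>Two-coloured multipartite graphs with homogeneous parts\<close>

locale bicoloring =
  fixes V :: "'a set" and p :: "'a \<Rightarrow> nat" and Er Eb :: "'a \<Rightarrow> 'a \<Rightarrow> bool"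
  assumes finite_V: "finite V" and sym_r: "symp Er" and sym_b: "symp Eb"
    and part_r: "Er x y \<Longrightarrow> p x \<noteq> p y" and part_b: "Eb x y \<Longrightarrow> p x \<noteq> p y"
    and total: "x \<in> V \<Longrightarrow> y \<in> V \<Longrightarrow> p x \<noteq> p y \<Longrightarrow> Er x y \<or> Eb x y"
    and module_r: "x \<in> V \<Longrightarrow> x' \<in> V \<Longrightarrow> y \<in> V \<Longrightarrow> p x = p x' \<Longrightarrow> Er x y \<Longrightarrow> Er x' y"
    and module_b: "x \<in> V \<Longrightarrow> x' \<in> V \<Longrightarrow> y \<in> V \<Longrightarrow> p x = p x' \<Longrightarrow> Eb x y \<Longrightarrow> Eb x' y"
begin

lemma swap: "bicoloring V p Eb Er"
  using finite_V sym_r sym_b part_r part_b total module_r module_b by unfold_locales blast+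

text \<open>Each chord skips one vertex. The bounds on \<open>j\<close> make the two skipped arcs
  share at most end vertices, so both shortcuts can be taken in the same cycle.\<close>

lemma two_chords:
  assumes v: "cyclic_enum Er l v" "range v \<subseteq> V" and "l \<ge> 5"
    and "Er (v s) (v (s + 2))" "2 \<le> j" "j \<le> l - 2" "Er (v (s + j)) (v (s + j + 2))"
  shows "has_cycle Er V (l - 2)"
proof -
  define w where "w j = v (j + s)" for j
  have w: "cyclic_enum Er l w"
    unfolding w_def using v(1) by (rule cyclic_enum_shift)
  have chords: "Er (w 0) (w 2)" "Er (w j) (w (j + 2))"
    using assms by (simp_all add: w_def add_ac)
  have "w l = w 0"
    using cyclic_enum_period[OF w, of 0] by simp
  define js where "js = 0 # [2..<j + 1] @ [j + 2..<l]"
  have "distinct (map (\<lambda>i. i mod l) js)"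
    using assms(3,5,6) unfolding js_def by (intro distinct_mod_less) auto
  moreover have "successively (\<lambda>i j. Er (w i) (w j)) js"
  proof -
    have "successively (\<lambda>i j. Er (w i) (w j)) [2..<j + 1]" "successively (\<lambda>i j. Er (w i) (w j)) [j + 2..<l]"
      using cyclic_enum_step[OF w] by (simp_all only: successively_upt) blast+
    moreover have "hd [2..<j + 1] = 2" "last [2..<j + 1] = j" "[2..<j + 1] \<noteq> []"
      using assms(5) by (simp_all del: upt_Suc)
    moreover have "hd [j + 2..<l] = j + 2 \<or> [j + 2..<l] = []"
      using hd_upt[of "j + 2" l] by fastforce
    ultimately show ?thesis
      using chords unfolding js_def by (auto simp only: successively_Cons successively_append_iff hd_append if_False)
  qed
  moreover have "Er (w (last js)) (w (hd js))"
  \<comment> \<open>For \<open>j = l - 2\<close> the second interval is empty and the closing edge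
    is the second chord itself, since \<open>j + 2 = l\<close> is the position \<open>0\<close>
    again.\<close>
  proof (cases "j = l - 2")
    case True
    then have "j + 2 = l" "last js = j"
      using assms(3,5) by (simp_all add: js_def del: upt_Suc)
    then show ?thesis
      using chords \<open>w l = w 0\<close> by (simp add: js_def)
  next
    case False
    then have "last js = l - 1"
      using assms(3,5,6) by (auto simp: js_def)
    then show ?thesis
      using cyclic_enum_step[OF w, of "l - 1"] \<open>w l = w 0\<close> assms(3) by (simp add: js_def)
  qed
  ultimately show ?thesis
    using w v(2) assms(3,5,6) by (intro has_cycle_map_cyclic_enum[of Er l w V "js" Er]) (auto simp: js_def w_def)
qed

text \<open>If no two far apart chords of length 2 and no chord of length 3 are red, then almost all of these
  chords are blue and \<open>0, 2, 4, \<dots>, l - 1, l - 4, l - 6, \<dots>, 3\<close> is a blue cycle.\<close>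

lemma shorten_odd_cycle:
  assumes "has_cycle Er V l" "odd l" "l \<ge> 9"
  shows "has_cycle Er V (l - 2) \<or> has_cycle Eb V (l - 2)"
proof (rule disjCI)
  assume no_b: "\<not> has_cycle Eb V (l - 2)"
  show "has_cycle Er V (l - 2)"
  proof (rule ccontr)
    assume no_r: "\<not> has_cycle Er V (l - 2)"
    obtain v where v: "cyclic_enum Er l v" "range v \<subseteq> V"
      using has_cycle_imp_cyclic_enum[OF assms(1)] by blast
    have far: "\<not> Er (v (s + j)) (v (s + j + 2))" if "Er (v s) (v (s + 2))" "2 \<le> j" "j \<le> l - 2" for s j
      using two_chords[OF v _ that] no_r assms(3) by auto
    \<comment> \<open>Red chords of length 2 can only start at cyclically neighbouring positions, so
      there are at most two of them, and \<open>l - 2\<close> consecutive starting positions after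
      them are free of red.\<close>
    have "\<exists>s. \<forall>i < l - 2. \<not> Er (v (s + i)) (v (s + i + 2))"
    proof (cases "\<exists>s. Er (v s) (v (s + 2))")
      case True
      then obtain s where s: "Er (v s) (v (s + 2))"
        by blast
      show ?thesis
      proof (cases "Er (v (s + 1)) (v (s + 1 + 2))")
        case True
        have "\<not> Er (v (s + 2 + i)) (v (s + 2 + i + 2))" if "i < l - 2" for i
        proof (cases "i = l - 3")
          case True
          then have "s + 2 + i = s + 1 + (l - 2)"
            using assms(3) by simp
          then show ?thesis
            using far[OF \<open>Er (v (s + 1)) (v (s + 1 + 2))\<close>, of "l - 2"] assms(3) by auto
        next
          case False
          then show ?thesis
            using far[OF s, of "2 + i"] that by (simp add: add_ac)
        qed
        then show ?thesis
          by blast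
      next
        case False
        have "\<not> Er (v (s + 1 + i)) (v (s + 1 + i + 2))" if "i < l - 2" for i
          using False far[OF s, of "1 + i"] that by (cases "i = 0") (auto simp: add_ac)
        then show ?thesis
          by blast
      qed
    qed blast
    then obtain s where s: "\<And>i. i < l - 2 \<Longrightarrow> \<not> Er (v (s + i)) (v (s + i + 2))"
      by blast
    define w where "w i = v (i + s)" for i
    have w: "cyclic_enum Er l w"
      unfolding w_def using v(1) by (rule cyclic_enum_shift)
    have wV: "range w \<subseteq> V" "w i \<in> V" for i
      using v(2) by (auto simp: w_def)
    have no3: "\<not> Er (w i) (w (i + 3))" for i
      using cyclic_enum_chord[OF w wV(1), of i 3] no_r assms(3) by (auto simp: numeral_eq_Suc)
    have no2: "\<not> Er (w i) (w (i + 2))" if "i < l - 2" for i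
      using s[OF that] by (simp add: w_def add_ac)
    have step: "Er (w i) (w (Suc i))" for i
      using cyclic_enum_step[OF w] .
    \<comment> \<open>A chord that is not red is blue only if its ends lie in different parts. They
      do: \<open>w (i + 2)\<close> has the red neighbour \<open>w (i + 3)\<close>, which
      \<open>w i\<close> has not, while parts are homogeneous.\<close>
    have b2: "Eb (w i) (w (i + 2))" if "i < l - 2" for i
    proof -
      have "p (w i) \<noteq> p (w (i + 2))"
        using module_r[of "w (i + 2)" "w i" "w (i + 3)"] no3[of i] step[of "i + 2"] wV by (auto simp: numeral_eq_Suc)
      then show ?thesis
        using total no2[OF that] wV by blast
    qed
    have b3: "Eb (w i) (w (i + 3))" if "i < l - 2" for i
    proof -
      have "Er (w (i + 3)) (w (i + 2))"
        using step[of "i + 2"] sym_r by (auto simp: numeral_eq_Suc dest: sympD)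
      then have "p (w i) \<noteq> p (w (i + 3))"
        using module_r[of "w (i + 3)" "w i" "w (i + 2)"] no2[OF that] wV by auto
      then show ?thesis
        using total no3 wV by blast
    qed
    obtain m where m: "l = 2 * m + 1" "m \<ge> 4"
      using assms(2,3) by (auto elim!: oddE)
    define f g :: "nat \<Rightarrow> nat" where "f i = 2 * i" and "g i = 2 * i + 1" for i
    \<comment> \<open>Of the positions below \<open>l = 2 * m + 1\<close>, exactly \<open>1\<close>
      and \<open>2 * m - 1\<close> are left out. The two chords of length 3 link the even to the odd
      positions at \<open>2 * m\<close> and at \<open>0\<close>.\<close>
    define js where "js = map f [0..<m + 1] @ rev (map g [1..<m - 1])"
    have "distinct (map (\<lambda>i. i mod l) js)"
    proof (rule distinct_mod_less)
      show "distinct js"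
        by (auto simp: js_def distinct_map inj_on_def f_def g_def) presburger
      show "i < l" if "i \<in> set js" for i
        using that m by (auto simp: js_def f_def g_def)
    qed
    moreover have "successively (\<lambda>i j. Eb (w i) (w j)) js"
    proof -
      have "successively (\<lambda>i j. Eb (w i) (w j)) (map f [0..<m + 1])"
        unfolding successively_map_upt using b2 m by (auto simp: f_def)
      moreover have "successively (\<lambda>i j. Eb (w i) (w j)) (rev (map g [1..<m - 1]))"
      proof -
        have "Eb (w (g (Suc i))) (w (g i))" if "Suc i < m - 1" for i
          by (rule sympD[OF sym_b]) (use b2[of "2 * i + 1"] m that in \<open>simp add: g_def\<close>)
        then show ?thesis
          unfolding successively_rev successively_map_upt by blast
      qed
      moreover have "Eb (w (last (map f [0..<m + 1]))) (w (hd (rev (map g [1..<m - 1]))))"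
      proof -
        have "last (map f [0..<m + 1]) = (2 * m - 3) + 3" "hd (rev (map g [1..<m - 1])) = 2 * m - 3"
          using m by (auto simp: hd_rev last_map f_def g_def)
        then show ?thesis
          using b3[of "2 * m - 3", THEN sympD[OF sym_b]] m by simp
      qed
      ultimately show ?thesis
        unfolding js_def successively_append_iff by blast
    qed
    moreover have "Eb (w (last js)) (w (hd js))"
    proof -
      have "last js = 3" "hd js = 0"
        using m by (auto simp: js_def last_rev hd_map f_def g_def upt_conv_Cons hd_append)
      then show ?thesis
        using b3[of 0, THEN sympD[OF sym_b]] m by simp
    qed
    ultimately have "has_cycle Eb V (l - 2)"
      using w wV m by (intro has_cycle_map_cyclic_enum[of Er l w V "js" Eb]) (auto simp: js_def)
    then show False
      using no_b by blast
  qed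
qed

lemma odd_cycle_length:
  assumes "odd l" "l \<ge> 2 * n + 1" "n \<ge> 3" "has_cycle Er V l \<or> has_cycle Eb V l"
  shows "has_cycle Er V (2 * n + 1) \<or> has_cycle Eb V (2 * n + 1)"
  using assms(1,2,4)
proof (induction l rule: less_induct)
  case (less l)
  show ?case
  proof (cases "l = 2 * n + 1")
    case False
    then have l: "l \<ge> 2 * n + 3"
      using less.prems by (auto elim!: oddE)
    then have "has_cycle Er V (l - 2) \<or> has_cycle Eb V (l - 2)"
      using less.prems shorten_odd_cycle[of l] bicoloring.shorten_odd_cycle[OF swap, of l] assms(3) by auto
    then show ?thesis
      using less.IH[of "l - 2"] less.prems l by auto
  qed (use less.prems in auto)
qed

end

section \<open>Two-coloured graphs in which all large sets are joined in both colours\<close>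

text \<open>The two sizes add up to \<open>2 * n + 1\<close>: when parts are small, two sets
  violating this in one colour span enough vertices for \<open>multipartite_cycle\<close> in the
  other colour.\<close>

definition joined :: "('a \<Rightarrow> 'a \<Rightarrow> bool) \<Rightarrow> 'a set \<Rightarrow> nat \<Rightarrow> bool" where
  "joined E V n \<longleftrightarrow> (\<forall>A B. A \<subseteq> V \<and> B \<subseteq> V \<and> A \<inter> B = {} \<and> card A \<ge> n + 1 \<and> card B \<ge> n \<longrightarrow> (\<exists>a\<in>A. \<exists>b\<in>B. E a b))"

lemma joinedD:
  assumes "joined E V n" "A \<subseteq> V" "B \<subseteq> V" "A \<inter> B = {}" "card A \<ge> n + 1" "card B \<ge> n"
  obtains a b where "a \<in> A" "b \<in> B" "E a b"
proof -
  have "\<exists>a\<in>A. \<exists>b\<in>B. E a b"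
    by (rule assms(1)[unfolded joined_def, rule_format]) (use assms in simp)
  then show ?thesis
    using that by blast
qed

locale joined_bicoloring = bicoloring +
  fixes n :: nat
  assumes n_ge: "n \<ge> 3" and joined_r: "joined Er V n" and joined_b: "joined Eb V n"
    and no_cycle_r: "\<not> has_cycle Er V (2 * n + 1)" and no_cycle_b: "\<not> has_cycle Eb V (2 * n + 1)"
begin

lemma joined_swap: "joined_bicoloring V p Eb Er n"
  using n_ge joined_r joined_b no_cycle_r no_cycle_b swap
  by (intro joined_bicoloring.intro joined_bicoloring_axioms.intro)

lemma irrefl: "\<not> Er x x" "\<not> Eb x x"
  using part_r part_b by blast+

lemma no_odd_cycle:
  assumes "odd l" "l \<ge> 2 * n + 1"
  shows "\<not> has_cycle Er V l" "\<not> has_cycle Eb V l"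
  using odd_cycle_length[OF assms n_ge] no_cycle_r no_cycle_b by blast+

text \<open>Red and blue degrees add up to at least \<open>4 * n\<close> at every vertex, so one
  colour has average degree at least \<open>2 * n\<close>, as \<open>long_cycle\<close> requires.
  The parity of the length remains open.\<close>

lemma ex_long_cycle:
  assumes "V \<noteq> {}" and deg: "\<And>x. x \<in> V \<Longrightarrow> card {y \<in> V. p y \<noteq> p x} \<ge> 4 * n"
  shows "(\<exists>l \<ge> 2 * n + 1. has_cycle Er V l) \<or> (\<exists>l \<ge> 2 * n + 1. has_cycle Eb V l)"
proof -
  have J: "\<exists>a\<in>A. \<exists>b\<in>B. E a b"
    if "joined E V n" "A \<subseteq> V" "B \<subseteq> V" "A \<inter> B = {}" "card A \<ge> n + 1" "card B \<ge> n" for A B E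
    using that unfolding joined_def by blast
  have "card {y \<in> V. Er x y} + card {y \<in> V. Eb x y} \<ge> 4 * n" if "x \<in> V" for x
  proof -
    have "{y \<in> V. p y \<noteq> p x} \<subseteq> {y \<in> V. Er x y} \<union> {y \<in> V. Eb x y}"
    proof
      fix y assume "y \<in> {y \<in> V. p y \<noteq> p x}"
      then show "y \<in> {y \<in> V. Er x y} \<union> {y \<in> V. Eb x y}"
        using total[OF that, of y] by simp
    qed
    then have "card {y \<in> V. p y \<noteq> p x} \<le> card ({y \<in> V. Er x y} \<union> {y \<in> V. Eb x y})"
      using finite_V by (intro card_mono) auto
    also have "\<dots> \<le> card {y \<in> V. Er x y} + card {y \<in> V. Eb x y}"
      by (rule card_Un_le)
    finally show ?thesis
      using deg[OF that] by linarith
  qed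
  then have "(\<Sum>x\<in>V. 4 * n) \<le> (\<Sum>x\<in>V. card {y \<in> V. Er x y} + card {y \<in> V. Eb x y})"
    by (intro sum_mono) auto
  then have "(\<Sum>x\<in>V. card {y \<in> V. Er x y}) + (\<Sum>x\<in>V. card {y \<in> V. Eb x y}) \<ge> 4 * n * card V"
    by (simp add: sum.distrib mult.commute)
  then consider "(\<Sum>x\<in>V. card {y \<in> V. Er x y}) \<ge> 2 * n * card V" | "(\<Sum>x\<in>V. card {y \<in> V. Eb x y}) \<ge> 2 * n * card V"
    by linarith
  then show ?thesis
  proof cases
    case 1
    have "\<exists>l \<ge> 2 * n + 1. has_cycle Er V l"
      using finite_V assms(1) sym_r irrefl(1) _ 1 J[OF joined_r] by (rule long_cycle) (use n_ge in auto)
    then show ?thesis ..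
  next
    case 2
    have "\<exists>l \<ge> 2 * n + 1. has_cycle Eb V l"
      using finite_V assms(1) sym_b irrefl(2) _ 2 J[OF joined_b] by (rule long_cycle) (use n_ge in auto)
    then show ?thesis ..
  qed
qed

text \<open>In a longest cycle, no two consecutive vertices have neighbours in the same component of the
  complement. Hence these components are small, and the complement as a whole is not too large.\<close>

lemma ex_very_long_cycle:
  assumes "has_cycle Er V l0" "l0 \<ge> 2 * n + 1" "card V \<ge> 7 * n - 4"
  shows "\<exists>l \<ge> 4 * n - 2. has_cycle Er V l"
proof -
  have "l \<le> card V" if "has_cycle Er V l" for l
  proof -
    obtain xs where "distinct xs" "set xs \<subseteq> V" "length xs = l"
      using \<open>has_cycle Er V l\<close> by (auto simp: has_cycle_def is_cycle_def is_path_def)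
    then show ?thesis
      using card_mono[OF finite_V, of "set xs"] by (simp add: distinct_card)
  qed
  then obtain l where l: "has_cycle Er V l" and max: "\<And>l'. has_cycle Er V l' \<Longrightarrow> l' \<le> l"
    using ex_has_greatest_nat[of "has_cycle Er V" l0 id "Suc (card V)"] assms(1) by (auto simp: less_Suc_eq_le)
  have "l \<ge> 2 * n + 1"
    using max[OF assms(1)] assms(2) by linarith
  obtain v where v: "cyclic_enum Er l v" "range v \<subseteq> V"
    using has_cycle_imp_cyclic_enum[OF l] by blast
  define C where "C = range v"
  define Z where "Z = V - C"
  have C: "C \<subseteq> V" "card C = l" "finite C" and "finite Z"
    using v finite_V cyclic_enum_img[OF v(1)] finite_subset[of C V] by (auto simp: C_def Z_def)
  define R where "R = {(x, y). x \<in> Z \<and> y \<in> Z \<and> Er x y}"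
  have path: "\<exists>xs. is_path Er xs \<and> set xs \<subseteq> Z \<and> hd xs = x \<and> last xs = y" if "(x, y) \<in> R\<^sup>*" "x \<in> Z" for x y
    using that(1)
  proof (induction rule: rtrancl_induct)
    case base
    then show ?case
      using that(2) by (intro exI[of _ "[x]"]) auto
  next
    case (step y z)
    then obtain xs where xs: "is_path Er xs" "set xs \<subseteq> Z" "hd xs = x" "last xs = y"
      by blast
    have "xs \<noteq> []"
      using xs(1) by (simp add: is_path_def)
    show ?case
    proof (cases "z \<in> set xs")
      case True
      then obtain us ws where uws: "xs = (us @ [z]) @ ws"
        by (auto dest: split_list)
      then have "is_path Er (us @ [z])" "set (us @ [z]) \<subseteq> Z" "hd (us @ [z]) = x" "last (us @ [z]) = z"
        using xs is_path_appendD(1)[of Er "us @ [z]" ws] by (auto simp: hd_append split: if_splits)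
      then show ?thesis
        by blast
    next
      case False
      then have "is_path Er (xs @ [z])"
        using xs step(2) by (intro is_path_append) (auto simp: R_def)
      then show ?thesis
        using xs step(2) \<open>xs \<noteq> []\<close> by (intro exI[of _ "xs @ [z]"]) (auto simp: R_def)
    qed
  qed
  have "sym R"
    using sym_r by (auto simp: R_def sym_def dest: sympD)
  define comp where "comp q = {y. (q, y) \<in> R\<^sup>*}" for q
  have comp_Z: "comp q \<subseteq> Z" if "q \<in> Z" for q
  proof
    fix y assume "y \<in> comp q"
    then have "(q, y) \<in> R\<^sup>*"
      by (simp add: comp_def)
    then show "y \<in> Z"
      using that by (induction rule: rtrancl_induct) (auto simp: R_def)
  qed
  have comp_small: "card (comp q) < n" if "q \<in> Z" for q
  proof (rule ccontr)
    assume "\<not> card (comp q) < n"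
    \<comment> \<open>Of two consecutive cycle vertices one lies in \<open>D\<close>, since
      otherwise a path through the component could be inserted between them. So \<open>D\<close>
      contains at least half of the cycle, and joinedness with a component of \<open>n\<close>
      vertices is contradicted.\<close>
    define D where "D = {x \<in> C. \<forall>y\<in>comp q. \<not> Er x y}"
    have next_D: "v (Suc i) \<in> D" if "v i \<notin> D" for i
    proof (rule ccontr)
      assume "v (Suc i) \<notin> D"
      with that obtain y z where yz: "y \<in> comp q" "Er (v i) y" "z \<in> comp q" "Er (v (Suc i)) z"
        by (auto simp: D_def C_def)
      have "(y, q) \<in> R\<^sup>*"
        using yz(1) sym_rtrancl[OF \<open>sym R\<close>] by (auto simp: comp_def dest: symD)
      then have "(y, z) \<in> R\<^sup>*"
        using yz(3) by (auto simp: comp_def)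
      then obtain xs where xs: "is_path Er xs" "set xs \<subseteq> Z" "hd xs = y" "last xs = z"
        using path yz(1) comp_Z[OF \<open>q \<in> Z\<close>] by blast
      define w where "w j = v (j + Suc i)" for j
      have w: "cyclic_enum Er l w"
        unfolding w_def using v(1) by (rule cyclic_enum_shift)
      have "l > 0"
        using \<open>l \<ge> 2 * n + 1\<close> by simp
      have "is_path Er (map w [0..<l])"
        using cyclic_enum_step[OF w] \<open>l > 0\<close>
        by (intro is_path_map_cyclic_enum[OF w] distinct_mod_less) (auto simp: successively_upt)
      moreover have "set (map w [0..<l]) \<subseteq> C"
        by (auto simp: w_def C_def)
      moreover have "hd (map w [0..<l]) = v (Suc i)"
        using \<open>l > 0\<close> by (simp add: hd_map w_def)
      moreover have "last (map w [0..<l]) = v i"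
        using \<open>l > 0\<close> cyclic_enum_period[OF v(1), of i] by (simp add: last_map w_def add.commute)
      ultimately have "is_cycle Er (map w [0..<l] @ xs)"
        using xs yz sym_r by (intro is_cycle_append) (auto simp: Z_def dest: sympD)
      moreover have "set (map w [0..<l] @ xs) \<subseteq> V"
        using xs(2) C(1) \<open>set (map w [0..<l]) \<subseteq> C\<close> by (auto simp: Z_def)
      ultimately have "has_cycle Er V (length (map w [0..<l] @ xs))"
        by (rule has_cycleI[OF _ _ refl])
      then show False
        using max[of "length (map w [0..<l] @ xs)"] xs(1) by (simp add: is_path_def)
    qed
    define I where "I = {i. i < l \<and> v i \<notin> D}"
    have inj: "inj_on v {..<l}" "inj_on (v \<circ> Suc) {..<l}"
      using cyclic_enum_eq_iff[OF v(1)] cyclic_enum_eq_iff[OF cyclic_enum_shift[OF v(1), of 1]]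
      by (auto simp: inj_on_def)
    have "I \<subseteq> {..<l}"
      by (auto simp: I_def)
    have "v ` I = C - D"
      using cyclic_enum_img(1)[OF v(1)] by (auto simp: I_def C_def)
    then have "card (C - D) = card I"
      using card_image[OF inj_on_subset[OF inj(1) \<open>I \<subseteq> {..<l}\<close>]] by simp
    moreover have "card I \<le> card D"
      using next_D C(3) inj_on_subset[OF inj(2) \<open>I \<subseteq> {..<l}\<close>]
      by (intro card_inj_on_le[of "v \<circ> Suc"]) (auto simp: I_def D_def)
    moreover have "card C = card (C - D) + card D"
      using C(3) card_Un_disjoint[of "C - D" D] by (auto simp: D_def Un_absorb2 intro: finite_subset)
    ultimately have "card D \<ge> n + 1"
      using C(2) \<open>l \<ge> 2 * n + 1\<close> by linarith
    moreover have "D \<inter> comp q = {}" "D \<subseteq> V" "comp q \<subseteq> V"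
      using comp_Z[OF that] C(1) by (auto simp: D_def Z_def)
    ultimately obtain a b where "a \<in> D" "b \<in> comp q" "Er a b"
      using joinedD[OF joined_r, of D "comp q"] \<open>\<not> card (comp q) < n\<close> by (metis not_less)
    then show False
      by (auto simp: D_def)
  qed
  \<comment> \<open>This bound leaves \<open>7 * n - 4 - (3 * n - 2) = 4 * n - 2\<close> vertices
    for the cycle.\<close>
  have "card Z \<le> 3 * n - 2"
  proof (rule ccontr)
    assume "\<not> card Z \<le> 3 * n - 2"
    \<comment> \<open>Closed sets, that is unions of components, with more than \<open>n\<close>
      vertices. For a smallest one, \<open>A\<close>, joinedness leaves fewer than \<open>n\<close>
      vertices outside, hence at least \<open>2 * n\<close> inside; removing one component, which
      has fewer than \<open>n\<close>, keeps \<open>n + 1\<close>.\<close>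
    define P where "P A \<longleftrightarrow> A \<subseteq> Z \<and> card A \<ge> n + 1 \<and> (\<forall>a\<in>A. \<forall>b\<in>Z - A. \<not> Er a b)" for A
    have "P Z"
      using \<open>\<not> card Z \<le> 3 * n - 2\<close> n_ge by (auto simp: P_def)
    then obtain A where "P A" and min: "\<And>A'. P A' \<Longrightarrow> card A \<le> card A'"
      using ex_has_least_nat[of P Z card] by blast
    then have A: "A \<subseteq> Z" "card A \<ge> n + 1" "\<And>a b. a \<in> A \<Longrightarrow> b \<in> Z - A \<Longrightarrow> \<not> Er a b" "finite A"
      using \<open>finite Z\<close> finite_subset by (auto simp: P_def)
    have "card (Z - A) < n"
    proof (rule ccontr)
      assume "\<not> card (Z - A) < n"
      moreover have "A \<subseteq> V" "Z - A \<subseteq> V"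
        using A(1) by (auto simp: Z_def)
      ultimately obtain a b where "a \<in> A" "b \<in> Z - A" "Er a b"
        using joinedD[OF joined_r, of A "Z - A"] A(2) by (metis Diff_disjoint not_less)
      then show False
        using A(3) by blast
    qed
    moreover have "card (Z - A) = card Z - card A"
      using A by (simp add: card_Diff_subset)
    ultimately have "card A \<ge> 2 * n"
      using \<open>\<not> card Z \<le> 3 * n - 2\<close> by linarith
    obtain q where "q \<in> A"
      using A(2) by fastforce
    then have "q \<in> Z"
      using A by blast
    have "comp q \<subseteq> A"
    proof
      fix y assume "y \<in> comp q"
      then have "(q, y) \<in> R\<^sup>*"
        by (simp add: comp_def)
      then show "y \<in> A"
        using \<open>q \<in> A\<close> A(3) by (induction rule: rtrancl_induct) (auto simp: R_def)
    qed
    have "q \<in> comp q"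
      by (simp add: comp_def)
    have card_diff: "card (A - comp q) = card A - card (comp q)"
      using \<open>comp q \<subseteq> A\<close> A(4) by (simp add: card_Diff_subset finite_subset)
    have "\<not> Er a b" if "a \<in> A - comp q" "b \<in> Z - (A - comp q)" for a b
    proof
      assume "Er a b"
      then have "b \<in> comp q"
        using that A(3) by blast
      then have "(q, b) \<in> R\<^sup>*" "(b, a) \<in> R"
        using that A(1) \<open>Er a b\<close> sym_r by (auto simp: comp_def R_def dest: sympD)
      then show False
        using that by (auto simp: comp_def intro: rtrancl_into_rtrancl)
    qed
    then have "P (A - comp q)"
      using A(1) card_diff comp_small[OF \<open>q \<in> Z\<close>] \<open>card A \<ge> 2 * n\<close> by (auto simp: P_def)
    then have "card A \<le> card A - card (comp q)"
      using min card_diff by metis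
    moreover have "card (comp q) > 0"
      using \<open>q \<in> comp q\<close> \<open>comp q \<subseteq> A\<close> A(4) by (auto simp: card_gt_0_iff intro: finite_subset)
    ultimately show False
      using A(2) by linarith
  qed
  moreover have "card Z = card V - l"
    using C by (simp add: Z_def card_Diff_subset)
  ultimately show ?thesis
    using assms(3) l n_ge by (intro exI[of _ l]) auto
qed

text \<open>Half of the cycle has at least \<open>n + 1\<close> vertices. Choosing
  \<open>n + 1\<close> of them and removing them from a set of \<open>2 * n + 1\<close> vertices
  that see none of them leaves \<open>n\<close> vertices, against joinedness.\<close>

lemma cyclic_enum_class_bound:
  assumes v: "cyclic_enum Er l v" "range v \<subseteq> V" "even l" "l \<ge> 4 * n - 2"
  shows "card {x \<in> V. \<forall>k. \<not> Er (v (2 * k)) x} \<le> 2 * n"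
proof (rule ccontr)
  define W where "W = {x \<in> V. \<forall>k. \<not> Er (v (2 * k)) x}"
  assume "\<not> card {x \<in> V. \<forall>k. \<not> Er (v (2 * k)) x} \<le> 2 * n"
  then have "card W \<ge> 2 * n + 1" "finite W"
    using finite_V by (auto simp: W_def)
  define Ev where "Ev = (\<lambda>k. v (2 * k)) ` {..<l div 2}"
  have "inj_on (\<lambda>k. v (2 * k)) {..<l div 2}"
    using cyclic_enum_eq_iff[OF v(1)] by (auto simp: inj_on_def)
  then have "card Ev = l div 2"
    by (simp add: Ev_def card_image)
  then have "card Ev \<ge> n + 1"
    using v(4) n_ge by linarith
  then obtain A where A: "A \<subseteq> Ev" "card A = n + 1" "finite A"
    by (meson obtain_subset_with_card_n)
  have "card (W - A) \<ge> n"
    using diff_card_le_card_Diff[OF A(3), of W] \<open>card W \<ge> 2 * n + 1\<close> A(2) by linarith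
  moreover have "A \<subseteq> V" "W - A \<subseteq> V"
    using A(1) v(2) by (auto simp: Ev_def W_def)
  ultimately obtain a b where "a \<in> A" "b \<in> W - A" "Er a b"
    using joinedD[OF joined_r, of A "W - A"] A(2) by (metis Diff_disjoint order_refl)
  then show False
    using A(1) by (auto simp: Ev_def W_def)
qed

text \<open>The cycle is even, and every vertex, on it or not, has no red neighbour in one of its
  two parity classes, as otherwise a long odd cycle arises. The vertices missing a given class
  number at most \<open>2 * n\<close>, so \<open>4 * n + 1\<close> vertices are too many.\<close>

lemma no_very_long_cycle:
  assumes "l \<ge> 4 * n - 2" "card V \<ge> 4 * n + 1"
  shows "\<not> has_cycle Er V l"
proof
  assume cyc: "has_cycle Er V l"
  have "l \<ge> 2 * n + 1"
    using assms(1) n_ge by linarith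
  then have "even l"
    using no_odd_cycle(1)[of l] cyc by blast
  obtain v where v: "cyclic_enum Er l v" "range v \<subseteq> V"
    using has_cycle_imp_cyclic_enum[OF cyc] by blast
  have no_chord: "\<not> Er (v i) (v (i + 2 * d))" for i d
  proof
    assume chord: "Er (v i) (v (i + 2 * d))"
    define e where "e = 2 * d mod l"
    have "v (i + 2 * d) = v (i + e)"
      using cyclic_enum_eq_iff[OF v(1)] by (simp add: e_def mod_add_right_eq)
    with chord have chord': "Er (v i) (v (i + e))"
      by simp
    have "e > 0" "e < l" "even e"
      using chord' irrefl(1)[of "v i"] \<open>even l\<close> \<open>l \<ge> 2 * n + 1\<close> by (auto simp: e_def dvd_mod intro: gr0I)
    have "has_cycle Er V (l + 1 - e)"
      using cyclic_enum_chord[OF v chord' \<open>e > 0\<close> \<open>e < l\<close>] .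
    moreover have "Er (v (i + e)) (v (i + e + (l - e)))"
      using chord' sym_r cyclic_enum_period[OF v(1), of i] \<open>e < l\<close> by (auto dest: sympD)
    then have "has_cycle Er V (l + 1 - (l - e))"
      by (rule cyclic_enum_chord[OF v]) (use \<open>e > 0\<close> \<open>e < l\<close> in auto)
    moreover have "odd (l + 1 - e)" "odd (l + 1 - (l - e))"
      using \<open>even l\<close> \<open>even e\<close> \<open>e < l\<close> by auto
    \<comment> \<open>The two odd lengths add up to \<open>l + 2 \<ge> 4 * n\<close>, so they cannot
      both be at most \<open>2 * n - 1\<close>.\<close>
    moreover have "l + 1 - e \<ge> 2 * n + 1 \<or> l + 1 - (l - e) \<ge> 2 * n + 1"
    proof (rule ccontr)
      assume *: "\<not> ?thesis"
      obtain a b where "l = 2 * a" "e = 2 * b"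
        using \<open>even l\<close> \<open>even e\<close> by (auto elim!: evenE)
      then show False
        using * assms(1) \<open>e < l\<close> by arith
    qed
    ultimately show False
      using no_odd_cycle(1) by blast
  qed
  have no_apex: "\<not> (Er z (v i) \<and> Er z (v (i + (2 * d + 1))))" if "z \<in> V - range v" for z i d
  proof
    assume edges: "Er z (v i) \<and> Er z (v (i + (2 * d + 1)))"
    define e where "e = (2 * d + 1) mod l"
    have e: "e < l" "odd e"
      using \<open>even l\<close> \<open>l \<ge> 2 * n + 1\<close> by (auto simp: e_def dvd_mod_iff)
    have "v (i + (2 * d + 1)) = v (i + e)"
      using cyclic_enum_eq_iff[OF v(1)] unfolding e_def by (simp only: mod_add_right_eq)
    then have edges: "Er z (v i)" "Er z (v (i + e))"
      using edges by auto
    have cycles: "has_cycle Er V (k + 2)" if "k < l" "Er z (v j)" "Er z (v (j + k))" for j k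
    proof -
      define w where "w i = v (i + j)" for i
      have w: "cyclic_enum Er l w"
        unfolding w_def using v(1) by (rule cyclic_enum_shift)
      have "is_path Er (map w [0..<k + 1])"
        using cyclic_enum_step[OF w] \<open>k < l\<close>
        by (intro is_path_map_cyclic_enum[OF w] distinct_mod_less) (auto simp: successively_upt simp del: upt_Suc)
      moreover have "hd (map w [0..<k + 1]) = v j" "last (map w [0..<k + 1]) = v (j + k)"
        by (simp_all add: hd_map w_def last_map add.commute del: upt_Suc)
      moreover have "set (map w [0..<k + 1]) \<subseteq> range v"
        by (auto simp: w_def)
      ultimately have "is_cycle Er ([z] @ map w [0..<k + 1])"
        using that \<open>z \<in> V - range v\<close> sympD[OF sym_r that(3)]
        by (intro is_cycle_append) (auto simp del: upt_Suc)
      then show ?thesis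
        using \<open>z \<in> V - range v\<close> v(2) by (intro has_cycleI[of Er "[z] @ map w [0..<k + 1]"]) (auto simp: w_def)
    qed
    have "has_cycle Er V (e + 2)"
      using cycles[OF e(1) edges] .
    moreover have "has_cycle Er V (l - e + 2)"
      using cycles[of "l - e" "i + e"] edges e cyclic_enum_period[OF v(1), of i] odd_pos[OF e(2)] by auto
    moreover have "odd (e + 2)" "odd (l - e + 2)"
      using e \<open>even l\<close> by auto
    moreover have "e + 2 \<ge> 2 * n + 1 \<or> l - e + 2 \<ge> 2 * n + 1"
      using assms(1) e n_ge by linarith
    ultimately show False
      using no_odd_cycle(1) by blast
  qed
  define X Y where "X = {x \<in> V. \<forall>k. \<not> Er (v (2 * k)) x}" and "Y = {x \<in> V. \<forall>k. \<not> Er (v (2 * k + 1)) x}"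
  have "V \<subseteq> X \<union> Y"
  proof
    fix x assume "x \<in> V"
    show "x \<in> X \<union> Y"
    proof (cases "x \<in> range v")
      case True
      then obtain j where j: "x = v j"
        by blast
      \<comment> \<open>Chords are stated as forward shifts by natural numbers, so \<open>j\<close>
        is first moved ahead of \<open>i\<close> by \<open>i\<close> full turns. As \<open>l\<close>
        is even, this keeps its parity.\<close>
      have no_chord': "\<not> Er (v i) (v j)" if "even (i + j)" for i
      proof -
        have "odd (l - 1)"
          using \<open>even l\<close> \<open>l \<ge> 2 * n + 1\<close> by auto
        then have "even (j + i * (l - 1))"
          using that by simp
        then obtain d where "j + i * (l - 1) = 2 * d"
          by (elim evenE)
        moreover have "i + (j + i * (l - 1)) = j + i * l"
          using \<open>l \<ge> 2 * n + 1\<close> by (cases l) auto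
        ultimately have "v j = v (i + 2 * d)"
          using cyclic_enum_eq_iff[OF v(1)] by simp
        then show ?thesis
          using no_chord by simp
      qed
      show ?thesis
      proof (cases "even j")
        case True
        then show ?thesis
          using no_chord'[of "2 * k" for k] \<open>x \<in> V\<close> j by (auto simp: X_def)
      next
        case False
        then show ?thesis
          using no_chord'[of "2 * k + 1" for k] \<open>x \<in> V\<close> j by (auto simp: Y_def)
      qed
    next
      case False
      show ?thesis
      proof (rule ccontr)
        assume "x \<notin> X \<union> Y"
        then obtain k m where km: "Er x (v (2 * k))" "Er x (v (2 * m + 1))"
          using \<open>x \<in> V\<close> sym_r by (auto simp: X_def Y_def dest: sympD)
        have "v (2 * m + 1) = v (2 * m + 1 + 2 * k * l)"
          using cyclic_enum_eq_iff[OF v(1)] by simp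
        also have "2 * m + 1 + 2 * k * l = 2 * k + (2 * (m + k * (l - 1)) + 1)"
          using \<open>l \<ge> 2 * n + 1\<close> by (cases l) (auto simp: algebra_simps)
        finally show False
          using no_apex[of x "2 * k" "m + k * (l - 1)"] km False \<open>x \<in> V\<close> by auto
      qed
    qed
  qed
  then have "card V \<le> card (X \<union> Y)"
    using finite_V by (intro card_mono) (auto simp: X_def Y_def)
  also have "\<dots> \<le> card X + card Y"
    by (rule card_Un_le)
  also have "card X \<le> 2 * n"
    unfolding X_def using cyclic_enum_class_bound[OF v \<open>even l\<close> assms(1)] .
  also have "card Y \<le> 2 * n"
    using cyclic_enum_class_bound[OF cyclic_enum_shift[OF v(1), of 1] _ \<open>even l\<close> assms(1)] v(2)
    by (auto simp: Y_def)
  finally show False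
    using assms(2) by simp
qed

lemma large_joined_bicoloring_False:
  assumes "card V \<ge> 7 * n - 4" and "\<And>x. x \<in> V \<Longrightarrow> card {y \<in> V. p y \<noteq> p x} \<ge> 4 * n"
  shows False
proof -
  interpret sw: joined_bicoloring V p Eb Er n
    by (rule joined_swap)
  have "card V \<ge> 4 * n + 1"
    using assms(1) n_ge by linarith
  moreover from this have "V \<noteq> {}"
    by auto
  ultimately consider l where "l \<ge> 2 * n + 1" "has_cycle Er V l" | l where "l \<ge> 2 * n + 1" "has_cycle Eb V l"
    using ex_long_cycle[OF _ assms(2)] by blast
  then show False
  proof cases
    case 1
    then show ?thesis
      using ex_very_long_cycle[OF 1(2,1) assms(1)] no_very_long_cycle \<open>card V \<ge> 4 * n + 1\<close> by blast
  next
    case 2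
    then show ?thesis
      using sw.ex_very_long_cycle[OF 2(2,1) assms(1)] sw.no_very_long_cycle \<open>card V \<ge> 4 * n + 1\<close> by blast
  qed
qed

end

section \<open>Joinedness\<close>

definition no_biclique :: "('a \<Rightarrow> 'a \<Rightarrow> bool) \<Rightarrow> 'a set \<Rightarrow> nat \<Rightarrow> bool" where
  "no_biclique E V n \<longleftrightarrow> \<not> (\<exists>S T. S \<subseteq> V \<and> T \<subseteq> V \<and> S \<inter> T = {} \<and> card S \<ge> n \<and> card T \<ge> n \<and> (\<forall>s\<in>S. \<forall>t\<in>T. E s t))"

locale cycle_free_bicoloring = bicoloring +
  fixes n :: nat
  assumes n_ge: "n \<ge> 3"
    and no_cycle_r: "\<not> has_cycle Er V (2 * n + 1)" and no_cycle_b: "\<not> has_cycle Eb V (2 * n + 1)"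
begin

lemma cycle_free_swap: "cycle_free_bicoloring V p Eb Er n"
  using n_ge no_cycle_r no_cycle_b swap
  by (intro cycle_free_bicoloring.intro cycle_free_bicoloring_axioms.intro)

lemma joined_bicoloringI:
  assumes "joined Er V n" "joined Eb V n"
  shows "joined_bicoloring V p Er Eb n"
  using n_ge no_cycle_r no_cycle_b bicoloring_axioms assms
  by (intro joined_bicoloring.intro joined_bicoloring_axioms.intro)

lemma complete_bipartite_r:
  assumes "S \<subseteq> V" "T \<subseteq> V" "\<And>s t. s \<in> S \<Longrightarrow> t \<in> T \<Longrightarrow> Er s t"
  shows "complete_bipartite Er S T"
proof
  show "S \<inter> T = {}"
    using assms(3) part_r by blast
qed (use assms finite_subset[OF _ finite_V] sym_r in auto)

lemma no_inner_edge:
  assumes "S \<subseteq> V" "T \<subseteq> V" "\<And>s t. s \<in> S \<Longrightarrow> t \<in> T \<Longrightarrow> Er s t" "card S \<ge> n + 1" "card T \<ge> n" "s \<in> S" "s' \<in> S"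
  shows "\<not> Er s s'"
proof
  assume "Er s s'"
  have "has_cycle Er (S \<union> T) (2 * n + 1)"
    using complete_bipartite.cycle_inner_edge[OF complete_bipartite_r[OF assms(1-3)], of s s' n]
      \<open>Er s s'\<close> part_r[of s s'] assms n_ge by auto
  then show False
    using no_cycle_r has_cycle_mono assms(1,2) by (metis Un_least)
qed

lemma no_outer_vertex:
  assumes "S \<subseteq> V" "T \<subseteq> V" "\<And>s t. s \<in> S \<Longrightarrow> t \<in> T \<Longrightarrow> Er s t" "card S \<ge> n" "card T \<ge> n"
    and "s \<in> S" "t \<in> T" "v \<in> V" "v \<notin> S \<union> T"
  shows "\<not> (Er v s \<and> Er v t)"
proof
  assume "Er v s \<and> Er v t"
  then have "has_cycle Er (insert v (S \<union> T)) (2 * n + 1)"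
    using complete_bipartite.cycle_outer_vertex[OF complete_bipartite_r[OF assms(1-3)], of s t v n] assms n_ge by auto
  then show False
    using no_cycle_r has_cycle_mono assms(1,2,8) by (metis Un_least insert_subset)
qed

text \<open>Let no blue edge join \<open>A\<close> and \<open>B\<close>, and let \<open>X\<close>,
  \<open>Y\<close>, \<open>D\<close> consist of the parts meeting only \<open>A\<close>, only
  \<open>B\<close>, or both. By homogeneity, \<open>X\<close> is completely red to
  \<open>Y \<union> D\<close> and \<open>Y\<close> to \<open>X \<union> D\<close>; as
  \<open>A \<subseteq> X \<union> D\<close> and \<open>B \<subseteq> Y \<union> D\<close>, bicliques
  being excluded forces \<open>X\<close> and \<open>Y\<close> below \<open>n\<close>. With
  \<open>X\<close>, \<open>Y\<close> and the parts in \<open>D\<close> as classes, the red graph is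
  complete multipartite on at least \<open>2 * n + 1\<close> vertices.\<close>

lemma joined_multipartite:
  assumes small: "\<And>i. card {x \<in> V. p x = i} < n" and biclique: "no_biclique Er V n"
  shows "joined Eb V n"
  unfolding joined_def
proof (intro allI impI)
  fix A B
  assume AB: "A \<subseteq> V \<and> B \<subseteq> V \<and> A \<inter> B = {} \<and> card A \<ge> n + 1 \<and> card B \<ge> n"
  show "\<exists>a\<in>A. \<exists>b\<in>B. Eb a b"
  proof (rule ccontr)
    assume contra: "\<not> (\<exists>a\<in>A. \<exists>b\<in>B. Eb a b)"
    have fin: "finite A" "finite B"
      using AB finite_V finite_subset by blast+
    define X where "X = {x \<in> V. p x \<in> p ` A - p ` B}"
    define Y where "Y = {x \<in> V. p x \<in> p ` B - p ` A}"
    define D where "D = {x \<in> V. p x \<in> p ` A \<inter> p ` B}"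
    have red: "Er x y" if "x \<in> V" "y \<in> V" "p x \<in> p ` A" "p y \<in> p ` B" "p x \<noteq> p y" for x y
    proof -
      obtain a b where ab: "a \<in> A" "b \<in> B" "p x = p a" "p y = p b"
        using \<open>p x \<in> p ` A\<close> \<open>p y \<in> p ` B\<close> by auto
      then have V: "a \<in> V" "b \<in> V"
        using AB by auto
      then have "Er a b"
        using total[of a b] contra ab that(5) by auto
      then have "Er x b"
        using module_r[of a x b] V ab that(1) by auto
      then have "Er y x"
        using module_r[of b y x] V ab that sym_r by (auto dest: sympD)
      then show ?thesis
        using sym_r by (auto dest: sympD)
    qed
    have AX: "A \<subseteq> X \<union> D" and BY: "B \<subseteq> Y \<union> D"
      using AB by (auto simp: X_def Y_def D_def)
    have finXYD: "finite X" "finite Y" "finite D"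
      using finite_V by (simp_all add: X_def Y_def D_def)
    have "card (X \<union> D) \<ge> n" "card (Y \<union> D) \<ge> n"
      using card_mono[OF _ AX] card_mono[OF _ BY] finXYD AB by auto
    moreover have "Er x y" if "x \<in> X" "y \<in> Y \<union> D" for x y
    proof -
      have "x \<in> V" "y \<in> V" "p x \<in> p ` A" "p y \<in> p ` B" "p x \<notin> p ` B"
        using that unfolding X_def Y_def D_def by blast+
      then show ?thesis
        using red[of x y] by metis
    qed
    moreover have "Er y x" if "x \<in> X \<union> D" "y \<in> Y" for x y
    proof -
      have "x \<in> V" "y \<in> V" "p x \<in> p ` A" "p y \<in> p ` B" "p y \<notin> p ` A"
        using that unfolding X_def Y_def D_def by blast+
      then have "Er x y"
        using red[of x y] by metis
      then show ?thesis
        by (rule sympD[OF sym_r])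
    qed
    moreover have disj: "X \<inter> (Y \<union> D) = {}" "Y \<inter> (X \<union> D) = {}" "X \<subseteq> V" "Y \<subseteq> V" "D \<subseteq> V"
      by (auto simp: X_def Y_def D_def)
    ultimately have XY: "card X < n" "card Y < n"
      using biclique unfolding no_biclique_def by (meson Un_least not_less)+
    define q where "q x = (if x \<in> X then 0 else if x \<in> Y then 1 else p x + 2)" for x
    have "has_cycle Er (X \<union> Y \<union> D) (2 * n + 1)"
    proof (rule multipartite_cycle)
      show "finite (X \<union> Y \<union> D)" "n \<ge> 1"
        using finXYD n_ge by auto
      have "card (A \<union> B) \<le> card (X \<union> Y \<union> D)"
        using AX BY finXYD by (intro card_mono) auto
      then show "2 * n + 1 \<le> card (X \<union> Y \<union> D)"
        using AB fin by (simp add: card_Un_disjoint)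
      show "card {x \<in> X \<union> Y \<union> D. q x = i} \<le> n" for i
      proof -
        consider "i = 0" | "i = 1" | j where "i = j + 2"
          by (metis One_nat_def add_2_eq_Suc' not0_implies_Suc)
        then show ?thesis
        proof cases
          case 1
          then have "{x \<in> X \<union> Y \<union> D. q x = i} \<subseteq> X"
            by (auto simp: q_def split: if_splits)
          then show ?thesis
            using XY card_mono[OF finXYD(1)] by (meson le_trans less_imp_le_nat)
        next
          case 2
          then have "{x \<in> X \<union> Y \<union> D. q x = i} \<subseteq> Y"
            by (auto simp: q_def split: if_splits)
          then show ?thesis
            using XY card_mono[OF finXYD(2)] by (meson le_trans less_imp_le_nat)
        next
          case 3
          then have "{x \<in> X \<union> Y \<union> D. q x = i} \<subseteq> {x \<in> V. p x = j}"
            by (auto simp: q_def X_def Y_def D_def split: if_splits)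
          then have "card {x \<in> X \<union> Y \<union> D. q x = i} \<le> card {x \<in> V. p x = j}"
            using finite_V by (intro card_mono) auto
          then show ?thesis
            using small[of j] by linarith
        qed
      qed
      show "Er x y" if "x \<in> X \<union> Y \<union> D" "y \<in> X \<union> Y \<union> D" "q x \<noteq> q y" for x y
      proof -
        have V: "x \<in> V" "y \<in> V"
          using that(1,2) unfolding X_def Y_def D_def by blast+
        have "p x \<noteq> p y"
        proof
          assume "p x = p y"
          then have "x \<in> X \<longleftrightarrow> y \<in> X" "x \<in> Y \<longleftrightarrow> y \<in> Y"
            using V by (simp_all add: X_def Y_def)
          then show False
            using that(3) \<open>p x = p y\<close> by (auto simp: q_def)
        qed
        moreover have "z \<notin> X" if "z \<in> Y" for z
          using that disj(1) by blast
        then have "\<not> (x \<in> X \<and> y \<in> X)" "\<not> (x \<in> Y \<and> y \<in> Y)"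
          using that(3) by (auto simp: q_def)
        moreover have "p z \<in> p ` A" if "z \<in> X \<union> D" for z
          using that unfolding X_def D_def by blast
        moreover have "p z \<in> p ` B" if "z \<in> Y \<union> D" for z
          using that unfolding Y_def D_def by blast
        ultimately have "p x \<noteq> p y" "p x \<in> p ` A \<and> p y \<in> p ` B \<or> p y \<in> p ` A \<and> p x \<in> p ` B"
          using that(1,2) by blast+
        then show ?thesis
          using red[of x y] red[of y x] V sym_r by (auto dest: sympD)
      qed
    qed
    moreover have "X \<union> Y \<union> D \<subseteq> V"
      by (auto simp: X_def Y_def D_def)
    ultimately show False
      using no_cycle_r has_cycle_mono by blast
  qed
qed

text \<open>If \<open>W\<close> has more than \<open>2 * n\<close> vertices, it has no blue edge
  inside, so its parts form a red multipartite graph with a long odd cycle. Otherwise a violation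
  makes \<open>S\<close> exceed \<open>n\<close>, so all edges between parts in \<open>S\<close> are
  blue. Then \<open>W\<close> of size at least \<open>n\<close> excludes these blue edges, although
  \<open>S\<close> is larger than a part, and a smaller \<open>W\<close> serves as one more class of
  a blue multipartite graph.\<close>

lemma biclique_side_bound:
  assumes ST: "S \<subseteq> V" "T \<subseteq> V" "\<And>s t. s \<in> S \<Longrightarrow> t \<in> T \<Longrightarrow> Er s t" "card S \<ge> n" "card T \<ge> n"
    and W: "W \<subseteq> V - S" "\<And>w s. w \<in> W \<Longrightarrow> s \<in> S \<Longrightarrow> Eb w s" and small: "\<And>i. card {x \<in> V. p x = i} < n"
  shows "card S + card W \<le> 3 * n"
proof (rule ccontr)
  assume contra: "\<not> card S + card W \<le> 3 * n"
  interpret sw: cycle_free_bicoloring V p Eb Er n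
    by (rule cycle_free_swap)
  have fin: "finite S" "finite W"
    using ST W finite_V finite_subset by blast+
  have "W \<subseteq> V"
    using W by blast
  have WS: "\<And>s w. s \<in> S \<Longrightarrow> w \<in> W \<Longrightarrow> Eb s w"
    using W(2) sym_b by (blast dest: sympD)
  show False
  proof (cases "card W \<ge> 2 * n + 1")
    case True
    have no_b: "\<not> Eb u u'" if "u \<in> W" "u' \<in> W" for u u'
      using sw.no_inner_edge[OF \<open>W \<subseteq> V\<close> ST(1) W(2) _ ST(4) that] True by auto
    have "has_cycle Er W (2 * n + 1)"
    proof (intro multipartite_cycle[of _ _ p])
      show "card {x \<in> W. p x = i} \<le> n" for i
      proof -
        have "card {x \<in> W. p x = i} \<le> card {x \<in> V. p x = i}"
          using \<open>W \<subseteq> V\<close> finite_V by (intro card_mono) auto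
        then show ?thesis
          using small[of i] by linarith
      qed
      show "Er x y" if "x \<in> W" "y \<in> W" "p x \<noteq> p y" for x y
        using no_b total[of x y] that \<open>W \<subseteq> V\<close> by blast
    qed (use True fin n_ge in auto)
    then show False
      using no_cycle_r has_cycle_mono \<open>W \<subseteq> V\<close> by blast
  next
    case False
    then have S: "card S \<ge> n + 1"
      using contra by linarith
    have S_blue: "Eb s s'" if "s \<in> S" "s' \<in> S" "p s \<noteq> p s'" for s s'
      using no_inner_edge[OF ST(1-3) S ST(5) that(1,2)] total[of s s'] that ST(1) by blast
    show False
    proof (cases "card W \<ge> n")
      case True
      obtain s where "s \<in> S"
        using S by fastforce
      have "\<not> S \<subseteq> {x \<in> V. p x = p s}"
        using card_mono[of "{x \<in> V. p x = p s}" S] small[of "p s"] S finite_V by fastforce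
      then obtain s' where "s' \<in> S" "s' \<notin> {x \<in> V. p x = p s}"
        by blast
      then have "s' \<in> S" "p s \<noteq> p s'"
        using ST(1) by auto
      then show False
        using sw.no_inner_edge[OF ST(1) \<open>W \<subseteq> V\<close> WS S True \<open>s \<in> S\<close>] S_blue \<open>s \<in> S\<close> by blast
    next
      case W_small: False
      define q where "q x = (if x \<in> S then Suc (p x) else 0)" for x
      have "has_cycle Eb (S \<union> W) (2 * n + 1)"
      proof (rule multipartite_cycle)
        show "finite (S \<union> W)" "n \<ge> 1"
          using fin n_ge by auto
        have "card (S \<union> W) = card S + card W"
          using fin W(1) by (intro card_Un_disjoint) auto
        then show "card (S \<union> W) \<ge> 2 * n + 1"
          using contra by linarith
        show "card {x \<in> S \<union> W. q x = i} \<le> n" for i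
        proof (cases i)
          case 0
          then have "card {x \<in> S \<union> W. q x = i} \<le> card W"
            using fin by (intro card_mono) (auto simp: q_def)
          then show ?thesis
            using W_small by linarith
        next
          case (Suc j)
          then have "card {x \<in> S \<union> W. q x = i} \<le> card {x \<in> V. p x = j}"
            using finite_V ST(1) by (intro card_mono) (auto simp: q_def split: if_splits)
          then show ?thesis
            using small[of j] by linarith
        qed
        show "Eb x y" if "x \<in> S \<union> W" "y \<in> S \<union> W" "q x \<noteq> q y" for x y
          using that W WS S_blue[of x y] by (auto simp: q_def split: if_splits)
      qed
      then show False
        using no_cycle_b has_cycle_mono ST(1) \<open>W \<subseteq> V\<close> by (metis Un_least)
    qed
  qed
qed

text \<open>A vertex outside a red biclique cannot be red to both sides, so it is completely blue to
  one of them. Each side together with the vertices blue to it is bounded by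
  \<open>3 * n\<close>.\<close>

lemma no_biclique_multipartite:
  assumes small: "\<And>i. card {x \<in> V. p x = i} < n" and "card V \<ge> 6 * n + 1"
  shows "no_biclique Er V n"
  unfolding no_biclique_def
proof
  assume "\<exists>S T. S \<subseteq> V \<and> T \<subseteq> V \<and> S \<inter> T = {} \<and> card S \<ge> n \<and> card T \<ge> n \<and> (\<forall>s\<in>S. \<forall>t\<in>T. Er s t)"
  then obtain S0 T0 where ST0: "S0 \<subseteq> V" "T0 \<subseteq> V" "card S0 \<ge> n" "card T0 \<ge> n"
    "\<And>s t. s \<in> S0 \<Longrightarrow> t \<in> T0 \<Longrightarrow> Er s t"
    by blast
  \<comment> \<open>The sides are enlarged to unions of parts, so that an outside vertex never
    shares a part with a vertex of \<open>S\<close> or \<open>T\<close> and its edges to them are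
    red or blue.\<close>
  define S T where "S = {x \<in> V. p x \<in> p ` S0}" and "T = {x \<in> V. p x \<in> p ` T0}"
  have ST: "S \<subseteq> V" "T \<subseteq> V" "finite S" "finite T" "S0 \<subseteq> S" "T0 \<subseteq> T"
    using ST0 finite_V by (auto simp: S_def T_def)
  have card_ST: "card S \<ge> n" "card T \<ge> n"
    using ST0(3,4) card_mono[OF ST(3,5)] card_mono[OF ST(4,6)] by linarith+
  have red: "Er s t" if "s \<in> S" "t \<in> T" for s t
  proof -
    obtain s0 t0 where s0t0: "s0 \<in> S0" "t0 \<in> T0" "p s = p s0" "p t = p t0"
      using \<open>s \<in> S\<close> \<open>t \<in> T\<close> by (auto simp: S_def T_def)
    then have V: "s0 \<in> V" "t0 \<in> V" "s \<in> V" "t \<in> V"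
      using ST0 ST that by blast+
    then have "Er s t0"
      using module_r[of s0 s t0] ST0(5) s0t0 by simp
    then have "Er t s"
      using module_r[of t0 t s] V s0t0 sympD[OF sym_r, of s t0] by simp
    then show ?thesis
      by (rule sympD[OF sym_r])
  qed
  then have red': "Er t s" if "s \<in> S" "t \<in> T" for s t
    using that sym_r by (auto dest: sympD)
  have disj: "S \<inter> T = {}"
    using red part_r by blast
  define W where "W = {v \<in> V - S - T. \<forall>s\<in>S. Eb v s}"
  define X where "X = V - S - T - W"
  have "Eb v t" if "v \<in> X" "t \<in> T" for v t
  proof -
    have v: "v \<in> V" "v \<notin> S \<union> T" "p v \<notin> p ` S0" "p v \<notin> p ` T0"
      using that(1) by (auto simp: X_def S_def T_def)
    obtain s where s: "s \<in> S" "\<not> Eb v s"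
      using \<open>v \<in> X\<close> by (auto simp: X_def W_def)
    have "p v \<noteq> p s" "p v \<noteq> p t"
      using v s that by (auto simp: S_def T_def)
    then have "Er v s"
      using total[of v s] s v ST by auto
    then have "\<not> Er v t"
      using no_outer_vertex[OF ST(1,2) red card_ST s(1) \<open>t \<in> T\<close> v(1,2)] by blast
    then show ?thesis
      using total[of v t] \<open>p v \<noteq> p t\<close> v(1) that(2) ST by auto
  qed
  then have "card T + card X \<le> 3 * n"
    using ST card_ST red' small by (intro biclique_side_bound[of T S X]) (auto simp: X_def)
  moreover have "card S + card W \<le> 3 * n"
    using ST card_ST red small disj by (intro biclique_side_bound[of S T W]) (auto simp: W_def)
  moreover have "card V \<le> card S + card T + card W + card X"
  proof -
    have "V = (S \<union> T) \<union> (W \<union> X)"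
      using ST by (auto simp: W_def X_def)
    then show ?thesis
      using card_Un_le[of S T] card_Un_le[of W X] card_Un_le[of "S \<union> T" "W \<union> X"] by simp
  qed
  ultimately show False
    using assms(2) by linarith
qed

text \<open>With singleton parts, \<open>S\<close> is a blue clique, and at most \<open>n\<close>
  vertices of \<open>W\<close> can be added to it as one class of a blue multipartite graph. Since
  \<open>S\<close> has at least \<open>n + 1\<close> vertices, this truncation of \<open>W\<close>
  still leaves \<open>2 * n + 1\<close> in total.\<close>

lemma clique_side_bound:
  assumes inj: "inj_on p V"
    and ST: "S \<subseteq> V" "T \<subseteq> V" "\<And>s t. s \<in> S \<Longrightarrow> t \<in> T \<Longrightarrow> Er s t" "card S \<ge> n + 1" "card T \<ge> n"
    and W: "W \<subseteq> V - S" "\<And>w s. w \<in> W \<Longrightarrow> s \<in> S \<Longrightarrow> Eb w s"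
  shows "card S + card W \<le> 2 * n"
proof (rule ccontr)
  assume contra: "\<not> card S + card W \<le> 2 * n"
  have fin: "finite S" "finite W"
    using ST W finite_V finite_subset by blast+
  have WS: "\<And>s w. s \<in> S \<Longrightarrow> w \<in> W \<Longrightarrow> Eb s w"
    using W(2) sym_b by (blast dest: sympD)
  have S_blue: "Eb s s'" if "s \<in> S" "s' \<in> S" "p s \<noteq> p s'" for s s'
    using no_inner_edge[OF ST(1-5) that(1,2)] total[of s s'] that ST(1) by blast
  obtain U where U: "U \<subseteq> W" "card U = min n (card W)"
    by (meson min.cobounded2 obtain_subset_with_card_n)
  then have "finite U"
    using fin finite_subset by blast
  define q where "q x = (if x \<in> S then Suc (p x) else 0)" for x
  have "has_cycle Eb (S \<union> U) (2 * n + 1)"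
  proof (rule multipartite_cycle)
    show "finite (S \<union> U)" "n \<ge> 1"
      using fin \<open>finite U\<close> n_ge by auto
    have "card (S \<union> U) = card S + card U"
      using fin W(1) U \<open>finite U\<close> by (intro card_Un_disjoint) auto
    then show "card (S \<union> U) \<ge> 2 * n + 1"
      using contra U(2) ST(4) by linarith
    show "card {x \<in> S \<union> U. q x = i} \<le> n" for i
    proof (cases i)
      case 0
      then have "card {x \<in> S \<union> U. q x = i} \<le> card U"
        using \<open>finite U\<close> by (intro card_mono) (auto simp: q_def)
      then show ?thesis
        using U(2) by linarith
    next
      case (Suc j)
      then have "x = y" if "x \<in> {x \<in> S \<union> U. q x = i}" "y \<in> {x \<in> S \<union> U. q x = i}" for x y
        using that ST(1) inj by (auto simp: q_def inj_on_def split: if_splits)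
      then have "card {x \<in> S \<union> U. q x = i} \<le> 1"
        using fin \<open>finite U\<close> by (auto simp: card_le_Suc0_iff_eq)
      then show ?thesis
        using n_ge by linarith
    qed
    show "Eb x y" if "x \<in> S \<union> U" "y \<in> S \<union> U" "q x \<noteq> q y" for x y
      using that W WS U S_blue[of x y] by (auto simp: q_def split: if_splits)
  qed
  moreover have "S \<union> U \<subseteq> V"
    using ST(1) U W by auto
  ultimately show False
    using no_cycle_b has_cycle_mono by blast
qed

text \<open>Splitting the vertices outside a red biclique as in the multipartite case would
  contradict \<open>4 * n + 1\<close> at once if both sides had \<open>n + 1\<close> vertices. The
  work lies in the side \<open>T\<close> with exactly \<open>n\<close> vertices, where
  \<open>clique_side_bound\<close> does not apply.\<close>

lemma joined_complete:
  assumes inj: "inj_on p V" and V: "card V \<ge> 4 * n + 1"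
  shows "joined Eb V n"
  unfolding joined_def
proof (intro allI impI)
  fix S T
  assume ST': "S \<subseteq> V \<and> T \<subseteq> V \<and> S \<inter> T = {} \<and> card S \<ge> n + 1 \<and> card T \<ge> n"
  then have ST: "S \<subseteq> V" "T \<subseteq> V" "S \<inter> T = {}" "card S \<ge> n + 1" "card T \<ge> n" "finite S" "finite T"
    using finite_V finite_subset by blast+
  have tot: "Er x y \<or> Eb x y" if "x \<in> V" "y \<in> V" "x \<noteq> y" for x y
    using total[of x y] inj that by (auto simp: inj_on_def)
  interpret sw: cycle_free_bicoloring V p Eb Er n
    by (rule cycle_free_swap)
  show "\<exists>a\<in>S. \<exists>b\<in>T. Eb a b"
  proof (rule ccontr)
    assume "\<not> (\<exists>a\<in>S. \<exists>b\<in>T. Eb a b)"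
    then have red: "Er s t" if "s \<in> S" "t \<in> T" for s t
      using tot[of s t] that ST by blast
    then have red': "Er t s" if "s \<in> S" "t \<in> T" for s t
      using that sym_r by (auto dest: sympD)
    have S_blue: "Eb s s'" if "s \<in> S" "s' \<in> S" "s \<noteq> s'" for s s'
      using no_inner_edge[OF ST(1,2) red ST(4,5) that(1,2)] tot[of s s'] that ST(1) by blast
    define W where "W = {v \<in> V - S - T. \<forall>s\<in>S. Eb v s}"
    define X where "X = V - S - T - W"
    have X_red: "\<exists>s\<in>S. Er v s" if v: "v \<in> X" for v
    proof -
      obtain s where "s \<in> S" "\<not> Eb v s"
        using v by (auto simp: X_def W_def)
      then show ?thesis
        using tot[of v s] v ST by (auto simp: X_def)
    qed
    have X_blue: "Eb v t" if "v \<in> X" "t \<in> T" for v t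
    proof -
      have v: "v \<in> V" "v \<notin> S \<union> T"
        using that(1) by (auto simp: X_def)
      obtain s where s: "s \<in> S" "Er v s"
        using X_red[OF \<open>v \<in> X\<close>] by blast
      have "card S \<ge> n"
        using ST(4) by linarith
      then have "\<not> Er v t"
        using no_outer_vertex[OF ST(1,2) red _ ST(5) s(1) \<open>t \<in> T\<close> v] s(2) by blast
      then show ?thesis
        using tot[of v t] v that(2) ST by auto
    qed
    have "card S + card W \<le> 2 * n"
      using ST red by (intro clique_side_bound[OF inj, of S T W]) (auto simp: W_def)
    moreover have "card V \<le> card S + card T + card W + card X"
    proof -
      have "V = (S \<union> T) \<union> (W \<union> X)"
        using ST by (auto simp: W_def X_def)
      then show ?thesis
        using card_Un_le[of S T] card_Un_le[of W X] card_Un_le[of "S \<union> T" "W \<union> X"] by simp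
    qed
    ultimately have TX: "card T + card X \<ge> 2 * n + 1"
      using V by linarith
    have "card T = n"
    proof (rule ccontr)
      assume "card T \<noteq> n"
      then have "card T + card X \<le> 2 * n"
        using ST red' X_blue by (intro clique_side_bound[OF inj, of T S X]) (auto simp: X_def)
      then show False
        using TX by linarith
    qed
    then have X: "card X \<ge> n + 1" "X \<subseteq> V" "X \<inter> S = {}" "X \<inter> T = {}"
      using TX by (auto simp: X_def)
    have X_red': "Er u u'" if "u \<in> X" "u' \<in> X" "u \<noteq> u'" for u u'
      using sw.no_inner_edge[OF X(2) ST(2) X_blue X(1) ST(5) that(1,2)] tot[of u u'] that X(2) by blast
    \<comment> \<open>\<open>X\<close> is a red clique because it is blue to \<open>T\<close>.
      Distinct red neighbours in \<open>S\<close> of two vertices of \<open>X\<close> would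
      therefore attach an outer red edge to the biclique.\<close>
    have same: "s = s'" if "u \<in> X" "u' \<in> X" "u \<noteq> u'" "s \<in> S" "s' \<in> S" "Er u s" "Er u' s'" for u u' s s'
    proof (rule ccontr)
      assume "s \<noteq> s'"
      then have "has_cycle Er ({u, u'} \<union> S \<union> T) (2 * n + 1)"
        using that X_red'[OF that(1-3)] X(3,4) ST(4,5) n_ge
        by (intro complete_bipartite.cycle_outer_edge[OF complete_bipartite_r[OF ST(1,2) red], of s s' u u']) auto
      moreover have "{u, u'} \<union> S \<union> T \<subseteq> V"
        using that X(2) ST by auto
      ultimately show False
        using no_cycle_r has_cycle_mono by blast
    qed
    have "card X > 1"
      using X(1) n_ge by linarith
    then obtain u1 u2 where u: "u1 \<in> X" "u2 \<in> X" "u1 \<noteq> u2"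
      by (metis card_le_Suc0_iff_eq One_nat_def card.infinite not_less zero_less_one le_numeral_extra(3) nat_le_linear)
    obtain s0 where s0: "s0 \<in> S" "Er u1 s0"
      using X_red[OF u(1)] by blast
    obtain s2 where s2: "s2 \<in> S" "Er u2 s2"
      using X_red[OF u(2)] by blast
    \<comment> \<open>All red edges between \<open>X\<close> and \<open>S\<close> end in
      \<open>s0\<close>. Without \<open>s0\<close>, the union of \<open>S\<close> and
      \<open>T\<close> is completely blue to \<open>X\<close> and can have no blue edge inside, yet
      \<open>S\<close> is a blue clique.\<close>
    have only: "s = s0" if "v \<in> X" "s \<in> S" "Er v s" for v s
      using same[of v u1 s s0] same[of u1 u2 s s2] same[of u1 u2 s0 s2] u s0 s2 that by metis
    have blue: "Eb w v" if "w \<in> T \<union> (S - {s0})" "v \<in> X" for w v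
    proof -
      have "Eb v w"
      proof (cases "w \<in> T")
        case False
        then have "w \<in> S" "w \<noteq> s0"
          using that by auto
        then show ?thesis
          using only[OF \<open>v \<in> X\<close>, of w] tot[of v w] \<open>v \<in> X\<close> X(2,3) ST(1) by blast
      qed (use X_blue that in blast)
      then show ?thesis
        by (rule sympD[OF sym_b])
    qed
    have big: "card (T \<union> (S - {s0})) \<ge> n + 1"
    proof -
      have "card (T \<union> (S - {s0})) = card T + (card S - 1)"
        using ST s0 by (subst card_Un_disjoint) auto
      then show ?thesis
        using ST(4,5) n_ge by linarith
    qed
    have "card (S - {s0}) > 1"
      using ST(4,6) n_ge s0 by simp
    then obtain s1 s2 where s12: "s1 \<in> S - {s0}" "s2 \<in> S - {s0}" "s1 \<noteq> s2"
      by (metis card_le_Suc0_iff_eq One_nat_def card.infinite not_less zero_less_one le_numeral_extra(3) nat_le_linear)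
    have "\<not> Eb s1 s2"
      using s12 ST(1,2) X(1) blue big by (intro sw.no_inner_edge[of "T \<union> (S - {s0})" X]) (auto simp: X(2))
    then show False
      using S_blue s12 by blast
  qed
qed

end

section \<open>Complete two-coloured graphs\<close>

lemma clique_path:
  assumes "finite S" "\<And>x y. x \<in> S \<Longrightarrow> y \<in> S \<Longrightarrow> x \<noteq> y \<Longrightarrow> E x y" "x \<in> S" "y \<in> S" "x \<noteq> y" "2 \<le> m" "m \<le> card S"
  shows "\<exists>xs. is_path E xs \<and> set xs \<subseteq> S \<and> length xs = m \<and> hd xs = x \<and> last xs = y"
proof -
  have "card (S - {x, y}) = card S - 2"
    using assms by (simp add: card_Diff_subset)
  then obtain U where U: "U \<subseteq> S - {x, y}" "card U = m - 2"
    using assms(7) by (metis diff_le_mono obtain_subset_with_card_n)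
  then have "finite U"
    using assms(1) finite_subset by blast
  then obtain us where us: "set us = U" "distinct us"
    using finite_distinct_list by blast
  have "successively E zs" if "distinct zs" "set zs \<subseteq> S" for zs
    using that assms(2) by (induction zs rule: induct_list012) auto
  from this[of "x # us @ [y]"] have "is_path E (x # us @ [y])"
    using us U assms(3-5) by (auto simp: is_path_def)
  then show ?thesis
    using us U assms distinct_card[OF us(2)] by (intro exI[of _ "x # us @ [y]"]) auto
qed

context joined_bicoloring
begin

text \<open>All chords of even length of a red even cycle are blue, so the two classes of the cycle
  are blue cliques. By joinedness they are connected by two disjoint blue edges.\<close>

lemma complete_no_even_cycle:
  assumes inj: "inj_on p V" and l: "even l" "l \<ge> 2 * n + 2"
  shows "\<not> has_cycle Er V l"
proof
  assume "has_cycle Er V l"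
  then obtain v where v: "cyclic_enum Er l v" "range v \<subseteq> V"
    using has_cycle_imp_cyclic_enum by blast
  have tot: "Er x y \<or> Eb x y" if "x \<in> V" "y \<in> V" "x \<noteq> y" for x y
    using total[of x y] inj that by (auto simp: inj_on_def)
  have "odd (l - 1)" "l - 1 \<ge> 2 * n + 1"
    using l by auto
  note no_cycle = no_odd_cycle[OF this]
  have no2: "\<not> Er (v i) (v (i + 2))" for i
    using cyclic_enum_chord[OF v, of i 2] no_cycle(1) l n_ge by (auto simp: numeral_eq_Suc)
  have no_chord: "\<not> Er (v s) (v (s + d))" if d: "even d" "4 \<le> d" "d + 4 \<le> l" for s d
  proof
    assume chord: "Er (v s) (v (s + d))"
    define w where "w i = v (i + s)" for i
    have w: "cyclic_enum Er l w"
      unfolding w_def using v(1) by (rule cyclic_enum_shift)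
    have wV: "range w \<subseteq> V" "w i \<in> V" for i
      using v(2) by (auto simp: w_def)
    have w_neq: "w i \<noteq> w j" if "i < l" "j < l" "i \<noteq> j" for i j
      using cyclic_enum_eq_iff[OF w] that by simp
    have step: "Er (w i) (w (Suc i))" "Er (w (Suc i)) (w i)" for i
      using cyclic_enum_step[OF w] sym_r by (auto dest: sympD)
    have chord: "Er (w 0) (w d)"
      using chord by (simp add: w_def add.commute)
    have "Er (w (l - 1)) (w 0)"
      using step(1)[of "l - 1"] cyclic_enum_period[OF w, of 0] d by simp
    have up: "successively (\<lambda>i j. Er (w i) (w j)) [a..<b]" and down: "successively (\<lambda>i j. Er (w i) (w j)) (rev [a..<b])" for a b
      using step by (simp_all only: successively_rev successively_upt) blast+
    \<comment> \<open>Together with the chord from \<open>0\<close> to \<open>d\<close>, this edge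
      would give the red cycle \<open>0, d, d - 1, \<dots>, 2, d + 1, \<dots>, l - 1\<close>, which
      misses only \<open>1\<close> and has odd length. The next claim is the mirror image and misses
      only \<open>l - 1\<close>.\<close>
    have "\<not> Er (w 2) (w (d + 1))"
    proof
      assume red: "Er (w 2) (w (d + 1))"
      define js where "js = [0] @ rev [2..<d + 1] @ [d + 1..<l]"
      have ends: "hd (rev [2..<d + 1]) = d" "last (rev [2..<d + 1]) = 2" "[2..<d + 1] \<noteq> []"
        "hd [d + 1..<l] = d + 1" "last [d + 1..<l] = l - 1" "[d + 1..<l] \<noteq> []"
        using d by (auto simp: hd_rev last_rev simp del: upt_Suc)
      have "distinct (map (\<lambda>i. i mod l) js)"
        using d unfolding js_def by (intro distinct_mod_less) auto
      moreover have "successively (\<lambda>i j. Er (w i) (w j)) js"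
        unfolding js_def successively_append_iff using up down ends red chord by (simp del: upt_Suc)
      moreover have "Er (w (last js)) (w (hd js))"
        using ends \<open>Er (w (l - 1)) (w 0)\<close> by (simp add: js_def del: upt_Suc)
      moreover have "js \<noteq> []" "length js = l - 1"
        using d by (auto simp: js_def)
      ultimately have "has_cycle Er V (l - 1)"
        using has_cycle_map_cyclic_enum[OF w wV(1)] by blast
      then show False
        using no_cycle by blast
    qed
    moreover have "\<not> Er (w (l - 2)) (w (d - 1))"
    proof
      assume red: "Er (w (l - 2)) (w (d - 1))"
      define js where "js = [0] @ [d..<l - 1] @ rev [1..<d]"
      have ends: "hd [d..<l - 1] = d" "last [d..<l - 1] = l - 2" "[d..<l - 1] \<noteq> []"
        "hd (rev [1..<d]) = d - 1" "last (rev [1..<d]) = 1" "[1..<d] \<noteq> []"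
        using d by (auto simp: hd_rev last_rev)
      have "distinct (map (\<lambda>i. i mod l) js)"
        using d unfolding js_def by (intro distinct_mod_less) auto
      moreover have "successively (\<lambda>i j. Er (w i) (w j)) js"
        unfolding js_def successively_append_iff using up down ends red chord by (simp del: upt_Suc)
      moreover have "Er (w (last js)) (w (hd js))"
        using ends step(2)[of 0] by (simp add: js_def)
      moreover have "js \<noteq> []" "length js = l - 1"
        using d by (auto simp: js_def)
      ultimately have "has_cycle Er V (l - 1)"
        using has_cycle_map_cyclic_enum[OF w wV(1)] by blast
      then show False
        using no_cycle by blast
    qed
    moreover have "w 2 \<noteq> w (d + 1)" "w (l - 2) \<noteq> w (d - 1)"
      using w_neq[of 2 "d + 1"] w_neq[of "l - 2" "d - 1"] d by auto
    ultimately have blue: "Eb (w (d + 1)) (w 2)" "Eb (w (l - 2)) (w (d - 1))"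
      using tot[OF wV(2) wV(2)] sym_b by (blast dest: sympD)+
    have blue2: "Eb (w i) (w (i + 2))" "Eb (w (i + 2)) (w i)" for i
    proof -
      have "w i \<noteq> w (i + 2)"
      proof
        assume "w i = w (i + 2)"
        then have "Er (w (Suc i)) (w (i + 2))" "Er (w (i + 2)) (w (Suc i))"
          using step[of i] by auto
        have "(i + 2) mod l = i mod l"
          using \<open>w i = w (i + 2)\<close> cyclic_enum_eq_iff[OF w] by simp
        then have "l dvd (i + 2) - i"
          by (subst mod_eq_dvd_iff_nat[symmetric]) auto
        then show False
          using d by (auto dest: dvd_imp_le)
      qed
      moreover have "\<not> Er (w i) (w (i + 2))"
        using no2[of "i + s"] by (simp add: w_def add_ac)
      ultimately show "Eb (w i) (w (i + 2))"
        using tot wV(2) by blast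
      then show "Eb (w (i + 2)) (w i)"
        by (rule sympD[OF sym_b])
    qed
    obtain r e where re: "l = 2 * r" "d = 2 * e"
      using l(1) d(1) by (auto elim!: evenE)
    then have re_le: "2 \<le> e" "e + 2 \<le> r"
      using d by auto
    define f g :: "nat \<Rightarrow> nat" where "f i = 2 * i" and "g i = 2 * i + 1" for i
    \<comment> \<open>A blue cycle missing only \<open>0\<close>: the even positions upwards from
      \<open>2\<close> to \<open>l - 2\<close>, then the odd ones downwards from
      \<open>d - 1\<close>, cyclically round to \<open>d + 1\<close>. The two edges just shown to be
      blue connect the even and the odd run.\<close>
    define js where "js = map f [1..<r] @ rev (map g [0..<e]) @ rev (map g [e..<r])"
    have ends: "hd (map f [1..<r]) = 2" "last (map f [1..<r]) = l - 2" "map f [1..<r] \<noteq> []"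
      "hd (rev (map g [0..<e])) = d - 1" "last (rev (map g [0..<e])) = 1" "map g [0..<e] \<noteq> []"
      "hd (rev (map g [e..<r])) = l - 1" "last (rev (map g [e..<r])) = d + 1" "map g [e..<r] \<noteq> []"
      using re re_le by (auto simp: f_def g_def hd_map last_map hd_rev last_rev)
    have "distinct (map (\<lambda>i. i mod l) js)"
    proof (rule distinct_mod_less)
      have "inj f" "inj g" "f i \<noteq> g j" for i j
        by (auto simp: inj_on_def f_def g_def) presburger
      then show "distinct js"
        unfolding js_def by (auto simp: distinct_map intro: inj_on_subset dest: injD)
      show "i < l" if "i \<in> set js" for i
        using that re re_le by (auto simp: js_def f_def g_def)
    qed
    moreover have "successively (\<lambda>i j. Eb (w i) (w j)) js"
    proof -
      have "successively (\<lambda>i j. Eb (w i) (w j)) (map f [1..<r])"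
        unfolding successively_map_upt using blue2(1)[of "2 * i" for i] by (auto simp: f_def)
      moreover have "successively (\<lambda>i j. Eb (w i) (w j)) (rev (map g [a..<b]))" for a b
        unfolding successively_rev successively_map_upt using blue2(2)[of "2 * i + 1" for i] by (auto simp: g_def)
      moreover have "Eb (w 1) (w (l - 1))"
        using blue2(2)[of "l - 1"] cyclic_enum_period[OF w, of 1] l by simp
      ultimately show ?thesis
        unfolding js_def successively_append_iff using ends blue(2) by (simp add: hd_append)
    qed
    moreover have "Eb (w (last js)) (w (hd js))"
      using ends blue(1) by (simp add: js_def hd_append)
    moreover have "js \<noteq> []" "length js = l - 1"
      using re re_le by (auto simp: js_def)
    ultimately have "has_cycle Eb V (l - 1)"
      using has_cycle_map_cyclic_enum[OF w wV(1)] by blast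
    then show False
      using no_cycle by blast
  qed
  obtain r where r: "l = 2 * r"
    using l(1) by (elim evenE)
  define X where "X s = (\<lambda>k. v (2 * k + s)) ` {..<r}" for s
  have inj_X: "inj_on (\<lambda>k. v (2 * k + s)) {..<r}" if "s < 2" for s
    using cyclic_enum_eq_iff[OF v(1)] r that by (auto simp: inj_on_def)
  then have card_X: "card (X s) \<ge> n + 1" if "s < 2" for s
    using card_image[OF inj_X[OF that]] l r by (simp add: X_def)
  have X_V: "X s \<subseteq> V" "finite (X s)" for s
    using v(2) by (auto simp: X_def)
  have clique: "Eb x y" if xy: "x \<in> X s" "y \<in> X s" "x \<noteq> y" for s x y
  proof -
    have less: "Eb (v (2 * j + s)) (v (2 * k + s))" if jk: "j < k" "k < r" "v (2 * j + s) \<noteq> v (2 * k + s)" for j k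
    proof -
      have eq: "2 * k + s = 2 * j + s + 2 * (k - j)"
        using jk by simp
      have "\<not> Er (v (2 * j + s)) (v (2 * j + s + 2 * (k - j)))"
      proof -
        consider "k - j = 1" | "k - j = r - 1" | "4 \<le> 2 * (k - j)" "2 * (k - j) + 4 \<le> l"
          using jk r by linarith
        then show ?thesis
        proof cases
          case 1
          then show ?thesis
            using no2[of "2 * j + s"] by simp
        next
          case 2
          then have "2 * j + s + 2 * (k - j) + 2 = 2 * j + s + l"
            using r jk by simp
          then have "v (2 * j + s + 2 * (k - j) + 2) = v (2 * j + s)"
            using cyclic_enum_period[OF v(1)] by metis
          then show ?thesis
            using no2[of "2 * j + s + 2 * (k - j)"] sym_r by (auto dest: sympD)
        next
          case 3
          then show ?thesis
            by (intro no_chord) auto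
        qed
      qed
      then show ?thesis
        using tot jk(3) v(2) unfolding eq by blast
    qed
    obtain j k where jk: "x = v (2 * j + s)" "y = v (2 * k + s)" "j < r" "k < r"
      using xy by (auto simp: X_def)
    show ?thesis
    proof (cases j k rule: linorder_cases)
      case greater
      then have "Eb y x"
        using less[of k j] jk xy(3) by auto
      then show ?thesis
        by (rule sympD[OF sym_b])
    qed (use less[of j k] jk xy(3) in auto)
  qed
  have disj: "X 0 \<inter> X 1 = {}"
    using cyclic_enum_eq_iff[OF v(1)] r by (auto simp: X_def) presburger
  have J: "\<exists>a\<in>A. \<exists>b\<in>B. Eb a b" if "A \<subseteq> X i" "B \<subseteq> X j" "i < 2" "j < 2" "i \<noteq> j" "card A \<ge> n + 1" "card B \<ge> n" for A B i j
  proof -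
    have "A \<inter> B = {}"
      using that(1-5) disj by (auto simp: less_2_cases_iff)
    moreover have "A \<subseteq> V" "B \<subseteq> V"
      using that X_V(1) by blast+
    ultimately show ?thesis
      using joined_b[unfolded joined_def, rule_format, of A B] that(6,7) by simp
  qed
  have card_diff: "card (X s - {x}) \<ge> n" if "s < 2" for s x
    using card_X[OF that] diff_card_le_card_Diff[of "{x}" "X s"] by simp
  \<comment> \<open>One blue edge between the classes, one avoiding its end \<open>a\<close> and one
    avoiding its end \<open>b\<close>: two of these three are disjoint. Deleting an end still leaves
    \<open>n\<close> vertices, enough for the smaller set in joinedness.\<close>
  obtain a b where ab: "a \<in> X 0" "b \<in> X 1" "Eb a b"
    using J[of "X 0" 0 "X 1" 1] card_X[of 0] card_X[of 1] by auto
  obtain c b' where cb: "c \<in> X 1" "b' \<in> X 0 - {a}" "Eb c b'"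
    using J[of "X 1" 1 "X 0 - {a}" 0] card_X[of 1] card_diff[of 0 a] by auto
  obtain a' d where ad: "a' \<in> X 0" "d \<in> X 1 - {b}" "Eb a' d"
    using J[of "X 0" 0 "X 1 - {b}" 1] card_X[of 0] card_diff[of 1 b] by auto
  have "\<exists>x y x' y'. x \<in> X 0 \<and> x' \<in> X 0 \<and> x \<noteq> x' \<and> y \<in> X 1 \<and> y' \<in> X 1 \<and> y \<noteq> y' \<and> Eb x y \<and> Eb x' y'"
  proof (cases "c = b")
    case False
    then show ?thesis
      using ab cb sympD[OF sym_b cb(3)] by (intro exI[of _ a] exI[of _ b] exI[of _ b'] exI[of _ c]) auto
  next
    case c: True
    show ?thesis
    proof (cases "a' = a")
      case False
      then show ?thesis
        using ab ad by (intro exI[of _ a] exI[of _ b] exI[of _ a'] exI[of _ d]) auto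
    next
      case True
      then show ?thesis
        using c cb ad sympD[OF sym_b cb(3)] by (intro exI[of _ a] exI[of _ d] exI[of _ b'] exI[of _ b]) auto
    qed
  qed
  then obtain x y x' y' where xy: "x \<in> X 0" "x' \<in> X 0" "x \<noteq> x'" "y \<in> X 1" "y' \<in> X 1" "y \<noteq> y'" "Eb x y" "Eb x' y'"
    by blast
  obtain xs where xs: "is_path Eb xs" "set xs \<subseteq> X 0" "length xs = n + 1" "hd xs = x" "last xs = x'"
    using clique_path[of "X 0" Eb x x' "n + 1"] X_V(2) clique xy card_X[of 0] n_ge by auto
  obtain ys where ys: "is_path Eb ys" "set ys \<subseteq> X 1" "length ys = n" "hd ys = y'" "last ys = y"
    using clique_path[of "X 1" Eb y' y n] X_V(2) clique xy card_X[of 1] n_ge by auto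
  have "is_cycle Eb (xs @ ys)"
    using xs ys disj xy sympD[OF sym_b xy(7)] by (intro is_cycle_append) auto
  then have "has_cycle Eb V (2 * n + 1)"
    using xs ys X_V(1)[of 0] X_V(1)[of 1] by (intro has_cycleI[of Eb "xs @ ys"]) auto
  then show False
    using no_cycle_b by blast
qed

lemma complete_joined_bicoloring_False:
  assumes inj: "inj_on p V" and V: "card V \<ge> 4 * n + 1"
  shows False
proof -
  interpret sw: joined_bicoloring V p Eb Er n
    by (rule joined_swap)
  have "card {y \<in> V. p y \<noteq> p x} \<ge> 4 * n" if "x \<in> V" for x
  proof -
    have "{y \<in> V. p y \<noteq> p x} = V - {x}"
      using inj that by (auto simp: inj_on_def)
    then show ?thesis
      using that V finite_V by simp
  qed
  moreover have "V \<noteq> {}"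
    using V by auto
  ultimately consider l where "l \<ge> 2 * n + 1" "has_cycle Er V l" | l where "l \<ge> 2 * n + 1" "has_cycle Eb V l"
    using ex_long_cycle by blast
  then show False
  proof cases
    case 1
    then have "even l \<Longrightarrow> l \<ge> 2 * n + 2"
      by presburger
    then show ?thesis
      using 1 no_odd_cycle(1)[of l] complete_no_even_cycle[OF inj, of l] by blast
  next
    case 2
    then have "even l \<Longrightarrow> l \<ge> 2 * n + 2"
      by presburger
    then show ?thesis
      using 2 no_odd_cycle(2)[of l] sw.complete_no_even_cycle[OF inj, of l] by blast
  qed
qed

end

section \<open>Edge colourings\<close>

definition coloured :: "('a \<Rightarrow> 'a \<Rightarrow> nat) \<Rightarrow> nat \<Rightarrow> 'a \<Rightarrow> 'a \<Rightarrow> bool" where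
  "coloured c i x y \<longleftrightarrow> x \<noteq> y \<and> c x y = i"

text \<open>The locale \<open>bicoloring\<close> wants relations that never hold inside a part, even
  outside \<open>V\<close>, so the colour class is cut down to edges of \<open>V\<close> between
  different parts. Its cycles are still monochromatic cycles of \<open>c\<close>.\<close>

definition cross :: "'a set \<Rightarrow> ('a \<Rightarrow> nat) \<Rightarrow> ('a \<Rightarrow> 'a \<Rightarrow> nat) \<Rightarrow> nat \<Rightarrow> 'a \<Rightarrow> 'a \<Rightarrow> bool" where
  "cross V p c i x y \<longleftrightarrow> x \<in> V \<and> y \<in> V \<and> p x \<noteq> p y \<and> c x y = i"

lemma has_cycle_cross: "has_cycle (cross V p c i) U m \<Longrightarrow> has_cycle (coloured c i) U m"
  by (erule has_cycle_rel_mono) (auto simp: cross_def coloured_def)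

lemma cycle_free_bicoloringI:
  assumes "finite V" "\<And>x y. c x y = c y x" "n \<ge> 3"
    and two: "\<And>x y. x \<in> V \<Longrightarrow> y \<in> V \<Longrightarrow> p x \<noteq> p y \<Longrightarrow> c x y \<in> {r, b}"
    and module: "\<And>x x' y. x \<in> V \<Longrightarrow> x' \<in> V \<Longrightarrow> y \<in> V \<Longrightarrow> p x = p x' \<Longrightarrow> p x \<noteq> p y \<Longrightarrow> c x y = c x' y"
    and no_cycle: "\<not> has_cycle (coloured c r) V (2 * n + 1)" "\<not> has_cycle (coloured c b) V (2 * n + 1)"
  shows "cycle_free_bicoloring V p (cross V p c r) (cross V p c b) n"
proof unfold_locales
  show "\<not> has_cycle (cross V p c r) V (2 * n + 1)" "\<not> has_cycle (cross V p c b) V (2 * n + 1)"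
    using no_cycle has_cycle_cross by blast+
  show "symp (cross V p c r)" "symp (cross V p c b)"
    using assms(2) by (auto simp: symp_def cross_def)
  have "cross V p c i x' y" if "x \<in> V" "x' \<in> V" "y \<in> V" "p x = p x'" "cross V p c i x y" for x x' y i
    using that module[of x x' y] by (auto simp: cross_def)
  then show "x \<in> V \<Longrightarrow> x' \<in> V \<Longrightarrow> y \<in> V \<Longrightarrow> p x = p x' \<Longrightarrow> cross V p c r x y \<Longrightarrow> cross V p c r x' y"
    "x \<in> V \<Longrightarrow> x' \<in> V \<Longrightarrow> y \<in> V \<Longrightarrow> p x = p x' \<Longrightarrow> cross V p c b x y \<Longrightarrow> cross V p c b x' y" for x x' y
    by blast+
qed (use assms(1,3) two in \<open>auto simp: cross_def\<close>)

lemma multipartite_degree: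
  assumes "finite V" "\<And>i. card {x \<in> V. p x = i} < n" "card V \<ge> 5 * n - 1"
  shows "card {y \<in> V. p y \<noteq> p x} \<ge> 4 * n"
proof -
  have "{y \<in> V. p y \<noteq> p x} = V - {y \<in> V. p y = p x}"
    by auto
  then have "card {y \<in> V. p y \<noteq> p x} = card V - card {y \<in> V. p y = p x}"
    using assms(1) by (simp add: card_Diff_subset)
  then show ?thesis
    using assms(2)[of "p x"] assms(3) by linarith
qed

text \<open>The size covers \<open>6 * n + 1\<close> for excluding bicliques,
  \<open>5 * n - 1\<close> for the degrees and \<open>7 * n - 4\<close> for extending a long
  cycle.\<close>

lemma two_coloured_multipartite:
  fixes p :: "'a \<Rightarrow> nat"
  assumes "finite V" "\<And>x y. c x y = c y x" "n \<ge> 3"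
    and two: "\<And>x y. x \<in> V \<Longrightarrow> y \<in> V \<Longrightarrow> p x \<noteq> p y \<Longrightarrow> c x y \<in> {r, b}"
    and module: "\<And>x x' y. x \<in> V \<Longrightarrow> x' \<in> V \<Longrightarrow> y \<in> V \<Longrightarrow> p x = p x' \<Longrightarrow> p x \<noteq> p y \<Longrightarrow> c x y = c x' y"
    and small: "\<And>i. card {x \<in> V. p x = i} < n" and card_V: "card V \<ge> 7 * n + 2"
  shows "has_cycle (coloured c r) V (2 * n + 1) \<or> has_cycle (coloured c b) V (2 * n + 1)"
proof (rule ccontr)
  assume no_cycle: "\<not> ?thesis"
  interpret cycle_free_bicoloring V p "cross V p c r" "cross V p c b" n
    using no_cycle by (intro cycle_free_bicoloringI assms) auto
  interpret sw: cycle_free_bicoloring V p "cross V p c b" "cross V p c r" n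
    by (rule cycle_free_swap)
  have "card V \<ge> 6 * n + 1" "card V \<ge> 5 * n - 1" "card V \<ge> 7 * n - 4"
    using card_V by linarith+
  then interpret joined_bicoloring V p "cross V p c r" "cross V p c b" n
    by (intro joined_bicoloringI joined_multipartite sw.joined_multipartite no_biclique_multipartite
        sw.no_biclique_multipartite small)
  show False
    using large_joined_bicoloring_False multipartite_degree[OF assms(1) small] \<open>card V \<ge> 5 * n - 1\<close>
      \<open>card V \<ge> 7 * n - 4\<close> by blast
qed

text \<open>A variant for graphs that have apex vertices in both colours. These rule out bicliques
  and turn a cycle of any large length into one of length \<open>2 * n + 1\<close>, so parity is
  irrelevant and only the degree condition needs a bound on the size.\<close>

lemma two_coloured_multipartite_long_cycle:
  fixes p :: "'a \<Rightarrow> nat"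
  assumes "finite V" "\<And>x y. c x y = c y x" "n \<ge> 3"
    and two: "\<And>x y. x \<in> V \<Longrightarrow> y \<in> V \<Longrightarrow> p x \<noteq> p y \<Longrightarrow> c x y \<in> {r, b}"
    and module: "\<And>x x' y. x \<in> V \<Longrightarrow> x' \<in> V \<Longrightarrow> y \<in> V \<Longrightarrow> p x = p x' \<Longrightarrow> p x \<noteq> p y \<Longrightarrow> c x y = c x' y"
    and small: "\<And>i. card {x \<in> V. p x = i} < n" and card_V: "card V \<ge> 5 * n - 1"
    and biclique: "no_biclique (coloured c r) V n" "no_biclique (coloured c b) V n"
  shows "\<exists>l \<ge> 2 * n + 1. has_cycle (coloured c r) V l \<or> has_cycle (coloured c b) V l"
proof (rule ccontr)
  assume no_cycle: "\<not> ?thesis"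
  interpret cycle_free_bicoloring V p "cross V p c r" "cross V p c b" n
    using no_cycle by (intro cycle_free_bicoloringI assms) auto
  interpret sw: cycle_free_bicoloring V p "cross V p c b" "cross V p c r" n
    by (rule cycle_free_swap)
  have "cross V p c i x y \<Longrightarrow> coloured c i x y" for i x y
    by (auto simp: cross_def coloured_def)
  then have "no_biclique (cross V p c r) V n" "no_biclique (cross V p c b) V n"
    using biclique unfolding no_biclique_def by meson+
  then interpret joined_bicoloring V p "cross V p c r" "cross V p c b" n
    by (intro joined_bicoloringI joined_multipartite sw.joined_multipartite small)
  have "V \<noteq> {}"
    using card_V n_ge by auto
  then show False
    using ex_long_cycle multipartite_degree[OF assms(1) small card_V] no_cycle has_cycle_cross by metis
qed

text \<open>The upper bound of the classical two-colour Ramsey number of an odd cycle. Each vertex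
  is its own part.\<close>

lemma two_coloured_complete:
  assumes "finite V" "\<And>x y. c x y = c y x" "n \<ge> 3"
    and two: "\<And>x y. x \<in> V \<Longrightarrow> y \<in> V \<Longrightarrow> x \<noteq> y \<Longrightarrow> c x y \<in> {r, b}" and card_V: "card V \<ge> 4 * n + 1"
  shows "has_cycle (coloured c r) V (2 * n + 1) \<or> has_cycle (coloured c b) V (2 * n + 1)"
proof (rule ccontr)
  assume no_cycle: "\<not> ?thesis"
  obtain p :: "'a \<Rightarrow> nat" where inj: "inj_on p V"
    using finite_imp_inj_to_nat_seg[OF assms(1)] by blast
  interpret cycle_free_bicoloring V p "cross V p c r" "cross V p c b" n
  proof (intro cycle_free_bicoloringI assms(1-3))
    show "c x y \<in> {r, b}" if "x \<in> V" "y \<in> V" "p x \<noteq> p y" for x y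
      using that by (intro two) auto
    show "c x y = c x' y" if "x \<in> V" "x' \<in> V" "y \<in> V" "p x = p x'" "p x \<noteq> p y" for x x' y
      using that inj by (auto simp: inj_on_def)
  qed (use no_cycle in auto)
  interpret sw: cycle_free_bicoloring V p "cross V p c b" "cross V p c r" n
    by (rule cycle_free_swap)
  interpret joined_bicoloring V p "cross V p c r" "cross V p c b" n
    by (intro joined_bicoloringI joined_complete sw.joined_complete inj card_V)
  show False
    using complete_joined_bicoloring_False inj card_V by blast
qed

section \<open>Edges between apex vertices\<close>

text \<open>The measure that the exchange argument decreases. Applied to \<open>- X\<close>, it also
  locates the edge outside \<open>X\<close> used in the exchange.\<close>

fun adjacent_pairs :: "'a set \<Rightarrow> 'a list \<Rightarrow> nat" where
  "adjacent_pairs X (x # y # zs) = (if x \<in> X \<and> y \<in> X then 1 else 0) + adjacent_pairs X (y # zs)"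
| "adjacent_pairs X _ = 0"

lemma adjacent_pairs_append:
  "adjacent_pairs X (xs @ ys) = adjacent_pairs X xs + adjacent_pairs X ys +
     (if xs \<noteq> [] \<and> ys \<noteq> [] \<and> last xs \<in> X \<and> hd ys \<in> X then 1 else 0)"
  by (induction X xs rule: adjacent_pairs.induct) (cases ys; auto)+

lemma adjacent_pairs_rev: "adjacent_pairs X (rev xs) = adjacent_pairs X xs"
  by (induction X xs rule: adjacent_pairs.induct) (auto simp: adjacent_pairs_append)

lemma adjacent_pairs_split:
  assumes "adjacent_pairs X xs > 0"
  obtains ys zs where "xs = ys @ zs" "ys \<noteq> []" "zs \<noteq> []" "last ys \<in> X" "hd zs \<in> X"
proof -
  have "\<exists>ys zs. xs = ys @ zs \<and> ys \<noteq> [] \<and> zs \<noteq> [] \<and> last ys \<in> X \<and> hd zs \<in> X"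
    using assms
  proof (induction X xs rule: adjacent_pairs.induct)
    case (1 X x y zs)
    show ?case
    proof (cases "x \<in> X \<and> y \<in> X")
      case True
      then show ?thesis
        by (intro exI[of _ "[x]"] exI[of _ "y # zs"]) auto
    next
      case False
      then obtain us vs where "y # zs = us @ vs" "us \<noteq> []" "vs \<noteq> []" "last us \<in> X" "hd vs \<in> X"
        using 1 by auto
      then show ?thesis
        by (intro exI[of _ "x # us"] exI[of _ vs]) auto
    qed
  qed auto
  then show ?thesis
    using that by blast
qed

text \<open>Every vertex outside \<open>X\<close> is followed by one in \<open>X\<close>, and these
  followers are distinct. A first vertex in \<open>X\<close> follows nothing, which accounts for the
  extra summand.\<close>

lemma non_adjacent_length:
  assumes "adjacent_pairs (- X) xs = 0" "xs \<noteq> []" "last xs \<in> X"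
  shows "length xs + (if hd xs \<in> X then 1 else 0) \<le> 2 * length (filter (\<lambda>x. x \<in> X) xs)"
  using assms by (induction X xs rule: adjacent_pairs.induct) (auto split: if_splits)

text \<open>A cycle edge inside \<open>X\<close> is removed by a 2-opt exchange with a cycle edge outside \<open>X\<close>.\<close>

lemma apex_uncross:
  assumes "symp E" "finite X" "2 * card X < m"
    and apex: "\<And>x w. x \<in> X \<Longrightarrow> w \<in> V - X \<Longrightarrow> E x w"
    and cyc: "has_cycle (\<lambda>x y. E x y \<or> x \<in> X \<and> y \<in> X) V m"
  shows "has_cycle E V m"
proof -
  define F where "F x y \<longleftrightarrow> E x y \<or> x \<in> X \<and> y \<in> X" for x y
  have "symp F"
    using assms(1) by (auto simp: F_def symp_def)
  have apex_F: "F x w" "F w x" if "x \<in> X" "w \<in> V - X" for x w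
    using apex[OF that] assms(1) by (auto simp: F_def dest: sympD)
  define P where "P xs \<longleftrightarrow> is_cycle F xs \<and> set xs \<subseteq> V \<and> length xs = m" for xs
  define f where "f xs = adjacent_pairs X xs + (if last xs \<in> X \<and> hd xs \<in> X then 1 else 0)" for xs
  obtain xs0 where "P xs0"
    using cyc unfolding has_cycle_def P_def F_def by blast
  then obtain xs where "P xs" and min: "\<And>ys. P ys \<Longrightarrow> f xs \<le> f ys"
    using ex_has_least_nat[of P xs0 f] by blast
  have "f xs = 0"
  proof (rule ccontr)
    assume "f xs \<noteq> 0"
    \<comment> \<open>Rotation turns some cycle edge inside \<open>X\<close> into the closing edge
      of the list.\<close>
    have "\<exists>ys. P ys \<and> f ys = f xs \<and> last ys \<in> X \<and> hd ys \<in> X"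
    proof (cases "last xs \<in> X \<and> hd xs \<in> X")
      case True
      then show ?thesis
        using \<open>P xs\<close> by blast
    next
      case False
      then have "adjacent_pairs X xs > 0"
        using \<open>f xs \<noteq> 0\<close> by (auto simp: f_def)
      then obtain ys zs where yz: "xs = ys @ zs" "ys \<noteq> []" "zs \<noteq> []" "last ys \<in> X" "hd zs \<in> X"
        using adjacent_pairs_split by blast
      have "P (zs @ ys)"
        using \<open>P xs\<close> yz(1) is_cycle_rotate[of F ys zs] by (auto simp: P_def)
      moreover have "f (zs @ ys) = f xs"
        using yz False by (auto simp: f_def adjacent_pairs_append)
      ultimately show ?thesis
        using yz by (intro exI[of _ "zs @ ys"]) auto
    qed
    then obtain ys where ys: "P ys" "f ys = f xs" "last ys \<in> X" "hd ys \<in> X"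
      by blast
    have "ys \<noteq> []" "distinct ys" "set ys \<subseteq> V"
      using ys(1) by (auto simp: P_def is_cycle_def is_path_def)
    have "adjacent_pairs (- X) ys > 0"
    proof (rule ccontr)
      assume "\<not> adjacent_pairs (- X) ys > 0"
      then have "length ys \<le> 2 * length (filter (\<lambda>x. x \<in> X) ys)"
        using non_adjacent_length[of X ys] \<open>ys \<noteq> []\<close> ys(3,4) by simp
      also have "length (filter (\<lambda>x. x \<in> X) ys) = card (set ys \<inter> X)"
        using distinct_card[of "filter (\<lambda>x. x \<in> X) ys"] \<open>distinct ys\<close> by (simp add: Int_def)
      also have "\<dots> \<le> card X"
        using assms(2) by (intro card_mono) auto
      finally show False
        using ys(1) assms(3) by (simp add: P_def)
    qed
    then obtain A B where AB: "ys = A @ B" "A \<noteq> []" "B \<noteq> []" "last A \<notin> X" "hd B \<notin> X"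
      by (rule adjacent_pairs_split) auto
    have ends: "hd A \<in> X" "last B \<in> X" "last A \<in> V - X" "hd B \<in> V - X"
      using AB ys(3,4) \<open>set ys \<subseteq> V\<close> last_in_set[of A] hd_in_set[of B] by auto
    have "is_path F A" "is_path F B"
      using ys(1) AB by (auto simp: P_def is_cycle_def dest: is_path_appendD)
    \<comment> \<open>Reversing \<open>A\<close> removes the closing edge inside \<open>X\<close>
      and the edge from \<open>last A\<close> to \<open>hd B\<close> outside \<open>X\<close>. Both
      new edges run between \<open>X\<close> and its complement, so they are apex edges and belong
      to \<open>E\<close>.\<close>
    then have "is_cycle F (rev A @ B)"
      using AB ends apex_F \<open>distinct ys\<close> is_path_rev[OF \<open>symp F\<close>]
      by (intro is_cycle_append) (auto simp: last_rev hd_rev)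
    then have "P (rev A @ B)"
      using ys(1) AB by (auto simp: P_def)
    moreover have "f (rev A @ B) < f ys"
      using AB ends by (auto simp: f_def adjacent_pairs_append adjacent_pairs_rev last_rev hd_rev)
    ultimately show False
      using min ys(2) by fastforce
  qed
  have "E (xs ! i) (xs ! Suc i)" if "Suc i < length xs" for i
  proof -
    have "last (take (Suc i) xs) = xs ! i" "hd (drop (Suc i) xs) = xs ! Suc i" "xs \<noteq> []"
      using that by (auto simp: take_Suc_conv_app_nth hd_drop_conv_nth)
    then have "\<not> (xs ! i \<in> X \<and> xs ! Suc i \<in> X)"
      using \<open>f xs = 0\<close> adjacent_pairs_append[of X "take (Suc i) xs" "drop (Suc i) xs"] that by (auto simp: f_def)
    moreover have "F (xs ! i) (xs ! Suc i)"
      using \<open>P xs\<close> that by (auto simp: P_def is_cycle_def is_path_def successively_conv_nth)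
    ultimately show ?thesis
      by (auto simp: F_def)
  qed
  moreover have "E (last xs) (hd xs)"
    using \<open>P xs\<close> \<open>f xs = 0\<close> by (auto simp: P_def f_def is_cycle_def F_def split: if_splits)
  ultimately have "is_cycle E xs"
    using \<open>P xs\<close> by (auto simp: P_def is_cycle_def is_path_def successively_conv_nth)
  then show ?thesis
    using \<open>P xs\<close> by (auto simp: P_def has_cycle_def)
qed

lemma cyclic_enum_imp_has_cycle:
  assumes "cyclic_enum E l v" "range v \<subseteq> V"
  shows "has_cycle E V l"
proof -
  have "l > 0"
    using assms(1) by (simp add: cyclic_enum_def)
  then have "E (v (l - 1)) (v 0)"
    using cyclic_enum_step[OF assms(1), of "l - 1"] cyclic_enum_period[OF assms(1), of 0] by simp
  then show ?thesis
    using \<open>l > 0\<close> cyclic_enum_step[OF assms(1)]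
    by (intro has_cycle_map_cyclic_enum[OF assms, of "[0..<l]"] distinct_mod_less) (auto simp: successively_upt)
qed

lemma two_colours_apex_bound:
  assumes "\<And>x y. c x y = c y x" "n \<ge> 3" "r \<noteq> b" "finite W" "finite X" "finite Y"
    and disj: "X \<inter> W = {}" "Y \<inter> W = {}" "X \<inter> Y = {}" and small: "card X < n" "card Y < n"
    and apex: "\<And>x w. x \<in> X \<Longrightarrow> w \<in> W \<Longrightarrow> c x w = r" "\<And>x w. x \<in> Y \<Longrightarrow> w \<in> W \<Longrightarrow> c x w = b"
    and two: "\<And>x y. x \<in> W \<Longrightarrow> y \<in> W \<Longrightarrow> x \<noteq> y \<Longrightarrow> c x y \<in> {r, b}"
    and no_cycle: "\<not> has_cycle (coloured c r) (W \<union> X \<union> Y) (2 * n + 1)"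
      "\<not> has_cycle (coloured c b) (W \<union> X \<union> Y) (2 * n + 1)"
  shows "card W + card X + card Y \<le> 4 * n"
proof (rule ccontr)
  assume large: "\<not> ?thesis"
  define c' where "c' x y = (if x \<in> X \<or> y \<in> X then r else if x \<in> Y \<or> y \<in> Y then b else c x y)" for x y
  have sym: "symp (coloured c i)" for i
    using assms(1) by (auto simp: coloured_def symp_def)
  have "card (W \<union> X \<union> Y) = card W + card X + card Y"
  proof -
    have "(W \<union> X) \<inter> Y = {}" "W \<inter> X = {}"
      using disj by blast+
    then show ?thesis
      using assms(4-6) by (simp add: card_Un_disjoint)
  qed
  then have "has_cycle (coloured c' r) (W \<union> X \<union> Y) (2 * n + 1) \<or> has_cycle (coloured c' b) (W \<union> X \<union> Y) (2 * n + 1)"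
    using large assms(1-6) two by (intro two_coloured_complete) (auto simp: c'_def)
  then show False
  proof
    assume "has_cycle (coloured c' b) (W \<union> X \<union> Y) (2 * n + 1)"
    then obtain v where v: "cyclic_enum (coloured c' b) (2 * n + 1) v" "range v \<subseteq> W \<union> X \<union> Y"
      using has_cycle_imp_cyclic_enum by blast
    have "v i \<notin> X" for i
      using cyclic_enum_step[OF v(1), of i] assms(3) by (auto simp: coloured_def c'_def)
    then have "has_cycle (coloured c' b) (W \<union> Y) (2 * n + 1)"
      using cyclic_enum_imp_has_cycle[OF v(1), of "W \<union> Y"] v(2) by blast
    then have "has_cycle (\<lambda>x y. coloured c b x y \<or> x \<in> Y \<and> y \<in> Y) (W \<union> Y) (2 * n + 1)"
    proof (rule has_cycle_rel_mono)
      fix x y assume "x \<in> W \<union> Y" "y \<in> W \<union> Y" "coloured c' b x y"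
      then show "coloured c b x y \<or> x \<in> Y \<and> y \<in> Y"
        using disj apex(2)[of x y] apex(2)[of y x] assms(1)[of x y] by (auto simp: coloured_def c'_def split: if_splits)
    qed
    then have "has_cycle (coloured c b) (W \<union> Y) (2 * n + 1)"
      using apex(2) disj small assms(6) by (intro apex_uncross[OF sym]) (auto simp: coloured_def)
    then show False
      using no_cycle(2) has_cycle_mono[of "coloured c b" "W \<union> Y" "2 * n + 1" "W \<union> X \<union> Y"] by auto
  next
    assume "has_cycle (coloured c' r) (W \<union> X \<union> Y) (2 * n + 1)"
    then obtain v where v: "cyclic_enum (coloured c' r) (2 * n + 1) v" "range v \<subseteq> W \<union> X \<union> Y"
      using has_cycle_imp_cyclic_enum by blast
    define C where "C = range v"
    have C: "card C = 2 * n + 1" "finite C" "C \<subseteq> W \<union> X \<union> Y"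
      using cyclic_enum_img[OF v(1)] v(2) by (auto simp: C_def)
    \<comment> \<open>\<open>W\<close> has at least
      \<open>4 * n + 1 - 2 * (n - 1) = 2 * n + 3\<close> vertices, while \<open>C\<close> has only
      \<open>2 * n + 1\<close>.\<close>
    have "card (C \<inter> Y) \<le> card (W - C)"
    proof -
      have "card (C \<inter> W) + card (C \<inter> Y) = card ((C \<inter> W) \<union> (C \<inter> Y))"
        using C(2) disj(2) by (intro card_Un_disjoint[symmetric]) auto
      also have "\<dots> \<le> card C"
        using C(2) by (intro card_mono) auto
      finally have "card (C \<inter> W) + card (C \<inter> Y) \<le> 2 * n + 1"
        using C(1) by simp
      moreover have "card W = card (C \<inter> W) + card (W - C)"
        using assms(4) by (metis Int_commute add.commute card_Diff_subset_Int card_Int_Diff)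
      ultimately show ?thesis
        using large small by linarith
    qed
    then obtain h0 where h0: "h0 ` (C \<inter> Y) \<subseteq> W - C" "inj_on h0 (C \<inter> Y)"
      using card_le_inj[of "C \<inter> Y" "W - C"] C(2) assms(4) by auto
    define h where "h x = (if x \<in> Y then h0 x else x)" for x
    have h_W: "h x \<in> W - C" if "x \<in> C \<inter> Y" for x
      using that h0(1) by (auto simp: h_def)
    have h_id: "h x = x" if "x \<notin> Y" for x
      using that by (simp add: h_def)
    have "inj_on h C"
    proof (rule inj_onI)
      fix x y assume xy: "x \<in> C" "y \<in> C" "h x = h y"
      consider "x \<in> Y" "y \<in> Y" | "x \<in> Y" "y \<notin> Y" | "x \<notin> Y" "y \<in> Y" | "x \<notin> Y" "y \<notin> Y"
        by blast
      then show "x = y"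
      proof cases
        case 1
        then show ?thesis
          using xy h0(2) by (auto simp: h_def inj_on_def)
      next
        case 2
        then show ?thesis
          using xy h_W[of x] h_id[of y] by auto
      next
        case 3
        then show ?thesis
          using xy h_W[of y] h_id[of x] by auto
      next
        case 4
        then show ?thesis
          using xy h_id by simp
      qed
    qed
    define E where "E x y \<longleftrightarrow> coloured c r x y \<or> x \<in> X \<and> y \<in> X" for x y
    have E_h: "E (h x) (h y)" if xy: "x \<in> C" "y \<in> C" "coloured c' r x y" for x y
    proof -
      have neq: "h x \<noteq> h y"
        using xy \<open>inj_on h C\<close> by (auto simp: coloured_def inj_on_def)
      have col: "c' x y = r"
        using xy by (simp add: coloured_def)
      consider "x \<in> Y" | "y \<in> Y" | "x \<notin> Y" "y \<notin> Y"
        by blast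
      then show ?thesis
      proof cases
        case 1
        then have "y \<in> X"
          using col assms(3) disj(3) by (auto simp: c'_def split: if_splits)
        then have "h y = y" "c (h x) y = r"
          using h_id[of y] disj(3) apex(1)[of y "h x"] h_W[of x] 1 xy(1) assms(1)[of "h x" y] by auto
        then show ?thesis
          using neq by (simp add: E_def coloured_def)
      next
        case 2
        then have "x \<in> X"
          using col assms(3) disj(3) by (auto simp: c'_def split: if_splits)
        then have "h x = x" "c x (h y) = r"
          using h_id[of x] disj(3) apex(1)[of x "h y"] h_W[of y] 2 xy(2) by auto
        then show ?thesis
          using neq by (simp add: E_def coloured_def)
      next
        case 3
        then have "x \<in> W \<union> X" "y \<in> W \<union> X" "h x = x" "h y = y"
          using xy C(3) h_id by auto
        then show ?thesis
          using col 3 neq apex(1)[of x y] apex(1)[of y x] assms(1)[of x y]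
          by (auto simp: E_def coloured_def c'_def split: if_splits)
      qed
    qed
    have "h (v i) = h (v j) \<longleftrightarrow> i mod (2 * n + 1) = j mod (2 * n + 1)" for i j
      using inj_on_eq_iff[OF \<open>inj_on h C\<close>, of "v i" "v j"] cyclic_enum_eq_iff[OF v(1)] by (simp add: C_def)
    moreover have "E (h (v i)) (h (v (Suc i)))" for i
      using E_h cyclic_enum_step[OF v(1)] by (simp add: C_def)
    ultimately have "cyclic_enum E (2 * n + 1) (\<lambda>i. h (v i))"
      by (simp add: cyclic_enum_def)
    moreover have "range (\<lambda>i. h (v i)) \<subseteq> W \<union> X"
    proof safe
      fix i assume "h (v i) \<notin> X"
      then show "h (v i) \<in> W"
        using h_W[of "v i"] h_id[of "v i"] v(2) by (cases "v i \<in> Y") (auto simp: C_def)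
    qed
    ultimately have "has_cycle E (W \<union> X) (2 * n + 1)"
      by (rule cyclic_enum_imp_has_cycle)
    then have "has_cycle (coloured c r) (W \<union> X) (2 * n + 1)"
      using apex(1) disj small assms(5) unfolding E_def
      by (intro apex_uncross[OF sym]) (auto simp: coloured_def)
    then show False
      using no_cycle(1) has_cycle_mono[of "coloured c r" "W \<union> X" "2 * n + 1" "W \<union> X \<union> Y"] by auto
  qed
qed

section \<open>Gallai partitions\<close>

definition gallai :: "('a \<Rightarrow> 'a \<Rightarrow> nat) \<Rightarrow> 'a set \<Rightarrow> bool" where
  "gallai c W \<longleftrightarrow> (\<forall>x\<in>W. \<forall>y\<in>W. \<forall>z\<in>W. x \<noteq> y \<longrightarrow> y \<noteq> z \<longrightarrow> x \<noteq> z \<longrightarrow>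
     c x y = c y z \<or> c y z = c x z \<or> c x y = c x z)"

definition colours :: "('a \<Rightarrow> 'a \<Rightarrow> nat) \<Rightarrow> 'a set \<Rightarrow> nat set" where
  "colours c W = {c x y | x y. x \<in> W \<and> y \<in> W \<and> x \<noteq> y}"

definition colour_graph :: "('a \<Rightarrow> 'a \<Rightarrow> nat) \<Rightarrow> nat \<Rightarrow> 'a set \<Rightarrow> ('a \<times> 'a) set" where
  "colour_graph c i W = {(x, y). x \<in> W \<and> y \<in> W \<and> x \<noteq> y \<and> c x y = i}"

lemma gallai_mono: "gallai c W \<Longrightarrow> U \<subseteq> W \<Longrightarrow> gallai c U"
  unfolding gallai_def by blast

lemma finite_colours: "finite W \<Longrightarrow> finite (colours c W)"
  by (rule finite_subset[of _ "(\<lambda>(x, y). c x y) ` (W \<times> W)"]) (auto simp: colours_def)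

lemma coloursI: "x \<in> W \<Longrightarrow> y \<in> W \<Longrightarrow> x \<noteq> y \<Longrightarrow> c x y \<in> colours c W"
  by (auto simp: colours_def)

lemma sym_colour_graph: "(\<And>x y. c x y = c y x) \<Longrightarrow> sym (colour_graph c i W)"
  by (auto simp: colour_graph_def sym_def)

lemma colour_graph_rtrancl_sym:
  assumes "\<And>x y. c x y = c y x" "(x, y) \<in> (colour_graph c i W)\<^sup>*"
  shows "(y, x) \<in> (colour_graph c i W)\<^sup>*"
  using assms sym_rtrancl[OF sym_colour_graph] by (metis symD)

lemma colour_graph_rtrancl_closed:
  assumes "(x, y) \<in> (colour_graph c i W)\<^sup>*" "x \<in> W"
  shows "y \<in> W"
  using assms by (induction rule: rtrancl_induct) (auto simp: colour_graph_def)

lemma colour_graph_first_step: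
  assumes "(x, y) \<in> (colour_graph c i W)\<^sup>*" "x \<noteq> y"
  obtains z where "(x, z) \<in> colour_graph c i W"
  using assms by (metis converse_rtranclE)

text \<open>For adjacent \<open>y\<close>, \<open>y'\<close> in the component of colour
  \<open>i\<close>, both edges to \<open>z\<close> differ from \<open>i\<close>, as \<open>z\<close>
  lies outside. The triangle is not rainbow, so these two edges agree; this propagates along the
  path.\<close>

lemma component_homogeneous:
  assumes "gallai c W" "\<And>x y. c x y = c y x" "(x, y) \<in> (colour_graph c i W)\<^sup>*"
    and "x \<in> W" "z \<in> W" "(x, z) \<notin> (colour_graph c i W)\<^sup>*"
  shows "c z x = c z y"
  using assms(3)
proof (induction rule: rtrancl_induct)
  case (step y y')
  have y: "y \<in> W" "y' \<in> W" "y \<noteq> y'" "c y y' = i"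
    using step(2) by (auto simp: colour_graph_def)
  have "(x, y') \<in> (colour_graph c i W)\<^sup>*"
    using step(1,2) by simp
  then have neq: "z \<noteq> y" "z \<noteq> y'"
    using step(1) assms(6) by auto
  have "c z y \<noteq> i"
  proof
    assume "c z y = i"
    then have "(y, z) \<in> colour_graph c i W"
      using y neq assms(2)[of z y] assms(5) by (auto simp: colour_graph_def)
    then show False
      using step(1) assms(6) by (meson rtrancl_into_rtrancl)
  qed
  moreover have "c z y' \<noteq> i"
  proof
    assume "c z y' = i"
    then have "(y', z) \<in> colour_graph c i W"
      using y neq assms(2)[of z y'] assms(5) by (auto simp: colour_graph_def)
    then show False
      using \<open>(x, y') \<in> (colour_graph c i W)\<^sup>*\<close> assms(6) by (meson rtrancl_into_rtrancl)
  qed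
  moreover have "c z y = c y y' \<or> c y y' = c z y' \<or> c z y = c z y'"
    using assms(1,5) y neq unfolding gallai_def by blast
  ultimately show ?case
    using step.IH y(4) by auto
qed simp

text \<open>Induction on the vertices. If adding \<open>v\<close> made every colour connected, all
  colours would occur at \<open>v\<close>. Either a colour new with \<open>v\<close> must then be
  the only one at \<open>v\<close>, or the disconnected colour of the smaller graph leads to edges
  of two further colours at \<open>v\<close> that contradict homogeneity of a component.\<close>

lemma gallai_disconnected:
  assumes "finite W" "gallai c W" "\<And>x y. c x y = c y x" "card (colours c W) \<ge> 3"
  shows "\<exists>i\<in>colours c W. \<exists>x\<in>W. \<exists>y\<in>W. (x, y) \<notin> (colour_graph c i W)\<^sup>*"
  using assms(1,2,4)
proof (induction W rule: finite_induct)
  case empty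
  then show ?case
    by (simp add: colours_def)
next
  case (insert v W)
  let ?W = "insert v W"
  show ?case
  proof (rule ccontr)
    assume contra: "\<not> ?case"
    then have conn: "(x, y) \<in> (colour_graph c i ?W)\<^sup>*" if "i \<in> colours c ?W" "x \<in> ?W" "y \<in> ?W" for i x y
      using that by blast
    have "W \<noteq> {}"
      using insert.prems(2) by (auto simp: colours_def)
    have v_edge: "\<exists>u\<in>W. c v u = i" if i: "i \<in> colours c ?W" for i
    proof -
      obtain u where "u \<in> W"
        using \<open>W \<noteq> {}\<close> by blast
      then have "(v, u) \<in> (colour_graph c i ?W)\<^sup>*" "v \<noteq> u"
        using conn[OF i] insert.hyps(2) by auto
      then obtain z where "(v, z) \<in> colour_graph c i ?W"
        by (rule colour_graph_first_step)
      then show ?thesis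
        by (auto simp: colour_graph_def)
    qed
    show False
    proof (cases "card (colours c W) \<ge> 3")
      case False
      then have "\<not> colours c ?W \<subseteq> colours c W"
        using insert.prems(2) card_mono[OF finite_colours[OF insert.hyps(1)]] by (meson le_trans)
      then obtain t where t: "t \<in> colours c ?W" "t \<notin> colours c W"
        by blast
      have all_t: "c v u = t" if u: "u \<in> W" for u
      proof -
        have "(u, v) \<in> (colour_graph c t ?W)\<^sup>*" "u \<noteq> v"
          using conn[OF t(1)] u insert.hyps(2) by auto
        then obtain z where z: "(u, z) \<in> colour_graph c t ?W"
          by (rule colour_graph_first_step)
        then have "z = v"
          using t(2) u coloursI[of u W z c] by (auto simp: colour_graph_def)
        then show ?thesis
          using z assms(3)[of u v] by (auto simp: colour_graph_def)
      qed
      have "\<not> colours c ?W \<subseteq> {t}"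
        using insert.prems(2) card_mono[of "{t}" "colours c ?W"] by auto
      then show False
        using v_edge all_t by blast
    next
      case True
      have gal: "gallai c W"
        using gallai_mono[OF insert.prems(1)] by blast
      obtain i x0 y0 where i: "i \<in> colours c W" "x0 \<in> W" "y0 \<in> W" "(x0, y0) \<notin> (colour_graph c i W)\<^sup>*"
        using insert.IH[OF gal True] by blast
      have i': "i \<in> colours c ?W"
        using i(1) by (auto simp: colours_def)
      have sym_R: "(x, y) \<in> (colour_graph c i W)\<^sup>* \<Longrightarrow> (y, x) \<in> (colour_graph c i W)\<^sup>*" for x y
        by (rule colour_graph_rtrancl_sym[of c, OF assms(3)])
      have reach: "\<exists>x'. (x, x') \<in> (colour_graph c i W)\<^sup>* \<and> c x' v = i" if x: "x \<in> W" for x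
      proof -
        have "(x, v) \<in> (colour_graph c i ?W)\<^sup>*"
          using conn[OF i'] x by blast
        then show ?thesis
          using x
        proof (induction rule: converse_rtrancl_induct)
          case base
          then show ?case
            using insert.hyps(2) by blast
        next
          case (step x y)
          show ?case
          proof (cases "y = v")
            case True
            then show ?thesis
              using step(1) by (auto simp: colour_graph_def)
          next
            case False
            then have "y \<in> W" "(x, y) \<in> colour_graph c i W"
              using step(1,4) by (auto simp: colour_graph_def)
            then show ?thesis
              using step.IH by (meson converse_rtrancl_into_rtrancl)
          qed
        qed
      qed
      \<comment> \<open>The component of \<open>z\<close> contains some \<open>z'\<close> with an
        edge of colour \<open>i\<close> to \<open>v\<close>. The triangle \<open>v, u, z'\<close>
        forces \<open>c u z' = c v u\<close>, and homogeneity carries this over to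
        \<open>z\<close>.\<close>
      have far: "c u z = c v u" if "u \<in> W" "c v u \<noteq> i" "z \<in> W" "(u, z) \<notin> (colour_graph c i W)\<^sup>*" for u z
      proof -
        obtain z' where z': "(z, z') \<in> (colour_graph c i W)\<^sup>*" "c z' v = i"
          using reach[OF \<open>z \<in> W\<close>] by blast
        have "z' \<in> W"
          using colour_graph_rtrancl_closed[OF z'(1)] that by blast
        have far': "(u, z') \<notin> (colour_graph c i W)\<^sup>*"
          using that(4) rtrancl_trans[OF _ sym_R[OF z'(1)]] by blast
        then have "u \<noteq> z'"
          by auto
        have "c u z' \<noteq> i"
          using far' \<open>u \<in> W\<close> \<open>z' \<in> W\<close> \<open>u \<noteq> z'\<close> by (auto simp: colour_graph_def)
        moreover have "c v u = c u z' \<or> c u z' = c v z' \<or> c v u = c v z'"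
          using insert.hyps(2) \<open>u \<in> W\<close> \<open>z' \<in> W\<close> \<open>u \<noteq> z'\<close>
          by (intro insert.prems(1)[unfolded gallai_def, rule_format, of v u z']) auto
        ultimately have "c u z' = c v u"
          using z'(2) assms(3)[of z' v] that(2) by auto
        moreover have "c u z = c u z'"
          using component_homogeneous[OF gal assms(3) z'(1) \<open>z \<in> W\<close> \<open>u \<in> W\<close>] that(4) sym_R by blast
        ultimately show ?thesis
          by simp
      qed
      have "\<not> colours c ?W \<subseteq> {i}"
        using insert.prems(2) card_mono[of "{i}" "colours c ?W"] by auto
      then obtain s where s: "s \<in> colours c ?W" "s \<noteq> i"
        by blast
      then have "\<not> colours c ?W \<subseteq> {i, s}"
        using insert.prems(2) card_mono[of "{i, s}" "colours c ?W"] by auto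
      then obtain t where t: "t \<in> colours c ?W" "t \<noteq> i" "t \<noteq> s"
        by blast
      obtain u1 u2 where u: "u1 \<in> W" "c v u1 = s" "u2 \<in> W" "c v u2 = t"
        using v_edge[OF s(1)] v_edge[OF t(1)] by blast
      \<comment> \<open>In different components, the edge between \<open>u1\<close> and
        \<open>u2\<close> would have to carry both \<open>s\<close> and \<open>t\<close>.\<close>
      have near: "(u1, u2) \<in> (colour_graph c i W)\<^sup>*"
      proof (rule ccontr)
        assume "(u1, u2) \<notin> (colour_graph c i W)\<^sup>*"
        then have "c u1 u2 = s" "c u2 u1 = t"
          using far[of u1 u2] far[of u2 u1] sym_R u s t by auto
        then show False
          using assms(3)[of u1 u2] t(3) by simp
      qed
      have "(u1, x0) \<notin> (colour_graph c i W)\<^sup>* \<or> (u1, y0) \<notin> (colour_graph c i W)\<^sup>*"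
        using i(4) rtrancl_trans[OF sym_R, of u1 x0 y0] by blast
      then obtain z where z: "z \<in> W" "(u1, z) \<notin> (colour_graph c i W)\<^sup>*"
        using i(2,3) by blast
      moreover have "(u2, z) \<notin> (colour_graph c i W)\<^sup>*"
        using near z(2) by (meson rtrancl_trans)
      ultimately have "c u1 z = s" "c u2 z = t"
        using far u s t by auto
      then show False
        using component_homogeneous[OF gal assms(3) near u(1) z(1,2)] assms(3)[of z u1] assms(3)[of z u2] t(3) by simp
    qed
  qed
qed

text \<open>Among the homogeneous partitions with at least two parts, starting from singletons, take
  one with the fewest parts. If its representatives used three colours, merging the components of a
  disconnected colour would give a coarser one.\<close>

lemma gallai_partition:
  assumes "finite W" "gallai c W" "\<And>x y. c x y = c y x" "card W \<ge> 2" "colours c W \<subseteq> K" "finite K" "card K \<ge> 2"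
  obtains p :: "'a \<Rightarrow> nat" and r b where "r \<in> K" "b \<in> K" "r \<noteq> b"
    "\<And>x y. x \<in> W \<Longrightarrow> y \<in> W \<Longrightarrow> p x \<noteq> p y \<Longrightarrow> c x y \<in> {r, b}"
    "\<And>x x' y. x \<in> W \<Longrightarrow> x' \<in> W \<Longrightarrow> y \<in> W \<Longrightarrow> p x = p x' \<Longrightarrow> p x \<noteq> p y \<Longrightarrow> c x y = c x' y"
    "card (p ` W) \<ge> 2"
proof -
  define P where "P p \<longleftrightarrow> (\<forall>x\<in>W. p x \<in> W \<and> p (p x) = p x) \<and> card (p ` W) \<ge> 2 \<and>
    (\<forall>x\<in>W. \<forall>x'\<in>W. \<forall>y\<in>W. p x = p x' \<longrightarrow> p x \<noteq> p y \<longrightarrow> c x y = c x' y)" for p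
  have "P id"
    using assms(4) by (auto simp: P_def)
  then obtain p where "P p" and min: "\<And>q. P q \<Longrightarrow> card (p ` W) \<le> card (q ` W)"
    using ex_has_least_nat[of P id "\<lambda>p. card (p ` W)"] by blast
  then have p: "\<And>x. x \<in> W \<Longrightarrow> p x \<in> W" "\<And>x. x \<in> W \<Longrightarrow> p (p x) = p x" "card (p ` W) \<ge> 2"
    "\<And>x x' y. x \<in> W \<Longrightarrow> x' \<in> W \<Longrightarrow> y \<in> W \<Longrightarrow> p x = p x' \<Longrightarrow> p x \<noteq> p y \<Longrightarrow> c x y = c x' y"
    unfolding P_def by blast+
  have rep: "c x y = c (p x) (p y)" if "x \<in> W" "y \<in> W" "p x \<noteq> p y" for x y
  proof -
    have "c x y = c (p x) y"
      using that p by (intro p(4)) auto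
    also have "\<dots> = c y (p x)"
      by (rule assms(3))
    also have "\<dots> = c (p y) (p x)"
      using that p by (intro p(4)) auto
    finally show ?thesis
      using assms(3) by simp
  qed
  define T where "T = p ` W"
  have T: "T \<subseteq> W" "finite T" "\<And>t. t \<in> T \<Longrightarrow> p t = t"
    using p assms(1) by (auto simp: T_def)
  have "card (colours c T) \<le> 2"
  proof (rule ccontr)
    assume "\<not> card (colours c T) \<le> 2"
    then obtain i x0 y0 where i: "i \<in> colours c T" "x0 \<in> T" "y0 \<in> T" "(x0, y0) \<notin> (colour_graph c i T)\<^sup>*"
      using gallai_disconnected[OF T(2) gallai_mono[OF assms(2) T(1)] assms(3)] by force
    define R where "R = (colour_graph c i T)\<^sup>*"
    have R_sym: "(x, y) \<in> R \<Longrightarrow> (y, x) \<in> R" for x y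
      unfolding R_def by (rule colour_graph_rtrancl_sym[of c, OF assms(3)])
    have R_trans: "(x, y) \<in> R \<Longrightarrow> (y, z) \<in> R \<Longrightarrow> (x, z) \<in> R" for x y z
      unfolding R_def by simp
    \<comment> \<open>The chosen element depends only on the component, because related arguments
      give the same predicate; so \<open>f\<close> selects one representative per component.\<close>
    define f where "f t = (SOME s. (t, s) \<in> R)" for t
    have f: "(t, f t) \<in> R" for t
      unfolding f_def by (rule someI[of _ t]) (simp add: R_def)
    have f_eq: "f s = f t \<longleftrightarrow> (s, t) \<in> R" for s t
    proof
      assume "f s = f t"
      then show "(s, t) \<in> R"
        using f[of s] f[of t] R_sym R_trans by metis
    next
      assume "(s, t) \<in> R"
      then have "(\<lambda>u. (s, u) \<in> R) = (\<lambda>u. (t, u) \<in> R)"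
        using R_sym R_trans by blast
      then show "f s = f t"
        by (simp add: f_def)
    qed
    have f_T: "f t \<in> T" if "t \<in> T" for t
      using colour_graph_rtrancl_closed[of t "f t" c i T] f[of t] that by (simp add: R_def)
    have img: "(f \<circ> p) ` W = f ` T"
      by (auto simp: T_def)
    have "card {f x0, f y0} \<le> card (f ` T)"
      using i(2,3) T(2) by (intro card_mono) auto
    moreover have "f x0 \<noteq> f y0"
      using i(4) f_eq by (simp add: R_def)
    ultimately have card_f: "card (f ` T) \<ge> 2"
      by simp
    have hom: "c x y = c x' y" if xy: "x \<in> W" "x' \<in> W" "y \<in> W" "f (p x) = f (p x')" "f (p x) \<noteq> f (p y)" for x x' y
    proof -
      have "p x \<noteq> p y" "p x' \<noteq> p y" "p x \<in> T" "p y \<in> T"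
        using xy by (auto simp: T_def)
      moreover have "c (p y) (p x) = c (p y) (p x')"
        using component_homogeneous[OF gallai_mono[OF assms(2) T(1)] assms(3), of "p x" "p x'" i "p y"]
          xy f_eq \<open>p x \<in> T\<close> \<open>p y \<in> T\<close> by (simp add: R_def)
      ultimately show ?thesis
        using rep[of x y] rep[of x' y] xy assms(3) by simp
    qed
    have "f (p x) \<in> W" "f (p (f (p x))) = f (p x)" if "x \<in> W" for x
    proof -
      have "f (p x) \<in> T"
        using that by (intro f_T) (simp add: T_def)
      moreover have "f (f (p x)) = f (p x)"
        unfolding f_eq by (rule R_sym[OF f])
      ultimately show "f (p x) \<in> W" "f (p (f (p x))) = f (p x)"
        using T by auto
    qed
    then have "\<forall>x\<in>W. (f \<circ> p) x \<in> W \<and> (f \<circ> p) ((f \<circ> p) x) = (f \<circ> p) x"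
      by simp
    moreover have "\<forall>x\<in>W. \<forall>x'\<in>W. \<forall>y\<in>W. (f \<circ> p) x = (f \<circ> p) x' \<longrightarrow> (f \<circ> p) x \<noteq> (f \<circ> p) y \<longrightarrow> c x y = c x' y"
      unfolding o_apply using hom by blast
    ultimately have "P (f \<circ> p)"
      unfolding P_def img using card_f by blast
    then have "card T \<le> card (f ` T)"
      using min[of "f \<circ> p"] unfolding img T_def by blast
    then have "inj_on f T"
      using T(2) by (metis card_image_le dual_order.antisym eq_card_imp_inj_on)
    obtain s t where st: "s \<in> T" "t \<in> T" "s \<noteq> t" "c s t = i"
      using i(1) by (auto simp: colours_def)
    then have "f s = f t"
      unfolding f_eq R_def by (auto simp: colour_graph_def)
    then show False
      using \<open>inj_on f T\<close> st by (auto simp: inj_on_def)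
  qed
  moreover have "colours c T \<subseteq> K"
    using assms(5) T(1) by (auto simp: colours_def)
  \<comment> \<open>The reduced graph may use fewer than two colours; it is padded to exactly two
    colours of \<open>K\<close>.\<close>
  moreover have "\<exists>L. colours c T \<subseteq> L \<and> L \<subseteq> K \<and> card L = 2"
    using calculation assms(6,7) by (metis exists_subset_between)
  then obtain L where L: "colours c T \<subseteq> L" "L \<subseteq> K" "card L = 2"
    by blast
  then obtain r b where rb: "L = {r, b}" "r \<noteq> b"
    by (meson card_2_iff)
  obtain e :: "'a \<Rightarrow> nat" where e: "inj_on e W"
    using finite_imp_inj_to_nat_seg[OF assms(1)] by blast
  have e_eq: "e (p x) = e (p y) \<longleftrightarrow> p x = p y" if "x \<in> W" "y \<in> W" for x y
    using inj_on_eq_iff[OF e] p(1) that by blast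
  show ?thesis
  proof (rule that[of r b "e \<circ> p"])
    show "c x y \<in> {r, b}" if xy: "x \<in> W" "y \<in> W" "(e \<circ> p) x \<noteq> (e \<circ> p) y" for x y
    proof -
      have "p x \<noteq> p y"
        using xy by auto
      then have "c (p x) (p y) \<in> colours c T"
        using xy by (intro coloursI) (auto simp: T_def)
      then show ?thesis
        using rep[of x y] xy \<open>p x \<noteq> p y\<close> L(1) rb(1) by auto
    qed
    show "c x y = c x' y" if "x \<in> W" "x' \<in> W" "y \<in> W" "(e \<circ> p) x = (e \<circ> p) x'" "(e \<circ> p) x \<noteq> (e \<circ> p) y" for x x' y
      using that e_eq by (intro p(4)) auto
    have "inj_on e (p ` W)"
      using inj_on_subset[OF e T(1)] by (simp add: T_def)
    then show "card ((e \<circ> p) ` W) \<ge> 2"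
      using p(3) card_image[of e "p ` W"] by (simp only: image_comp)
  qed (use L rb in auto)
qed

section \<open>The upper bound\<close>

lemma colours_mono: "U \<subseteq> W \<Longrightarrow> colours c U \<subseteq> colours c W"
  unfolding colours_def by blast

locale odd_cycle_colouring =
  fixes c :: "'a \<Rightarrow> 'a \<Rightarrow> nat" and n :: nat
  assumes sym: "c x y = c y x" and n_ge: "n \<ge> 3"
begin

text \<open>The sets \<open>X i\<close> collect vertices that have been split off and are joined to all of \<open>W\<close> in colour
  \<open>i\<close>. The colours of the edges between them do not matter.\<close>

definition config :: "nat set \<Rightarrow> 'a set \<Rightarrow> (nat \<Rightarrow> 'a set) \<Rightarrow> bool" where
  "config K W X \<longleftrightarrow> finite K \<and> finite W \<and> gallai c W \<and> colours c W \<subseteq> K \<and>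
     (\<forall>i\<in>K. finite (X i) \<and> card (X i) < n \<and> X i \<inter> W = {} \<and> (\<forall>x\<in>X i. \<forall>w\<in>W. c x w = i)) \<and>
     (\<forall>i\<in>K. \<forall>j\<in>K. i \<noteq> j \<longrightarrow> X i \<inter> X j = {}) \<and>
     (\<forall>i\<in>K. \<not> has_cycle (coloured c i) (W \<union> (\<Union>i\<in>K. X i)) (2 * n + 1))"

lemma configD:
  assumes "config K W X"
  shows "finite K" "finite W" "gallai c W" "colours c W \<subseteq> K" "\<And>i. i \<in> K \<Longrightarrow> finite (X i)" "\<And>i. i \<in> K \<Longrightarrow> card (X i) < n"
    "\<And>i. i \<in> K \<Longrightarrow> X i \<inter> W = {}" "\<And>i x w. i \<in> K \<Longrightarrow> x \<in> X i \<Longrightarrow> w \<in> W \<Longrightarrow> c x w = i"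
    "\<And>i j. i \<in> K \<Longrightarrow> j \<in> K \<Longrightarrow> i \<noteq> j \<Longrightarrow> X i \<inter> X j = {}"
    "\<And>i. i \<in> K \<Longrightarrow> \<not> has_cycle (coloured c i) (W \<union> (\<Union>i\<in>K. X i)) (2 * n + 1)"
  using assms unfolding config_def by blast+

text \<open>The descent step: vertices removed from \<open>W\<close> may join apex sets, and colours
  may be dropped together with their apex sets. The apex condition is asked only of vertices coming
  from \<open>W\<close>; the others inherit it.\<close>

lemma config_sub:
  assumes cfg: "config K W X" and "W' \<subseteq> W" "K' \<subseteq> K" "colours c W' \<subseteq> K'"
    and X': "\<And>i. i \<in> K' \<Longrightarrow> X' i \<subseteq> X i \<union> (W - W')" "\<And>i. i \<in> K' \<Longrightarrow> card (X' i) < n"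
      "\<And>i x w. i \<in> K' \<Longrightarrow> x \<in> X' i \<Longrightarrow> x \<in> W \<Longrightarrow> w \<in> W' \<Longrightarrow> c x w = i"
      "\<And>i j. i \<in> K' \<Longrightarrow> j \<in> K' \<Longrightarrow> i \<noteq> j \<Longrightarrow> X' i \<inter> X' j = {}"
  shows "config K' W' X'"
proof -
  note D = configD[OF cfg]
  have "finite (X' i)" if "i \<in> K'" for i
    using finite_subset[OF X'(1)[OF that]] D(2) D(5)[of i] that assms(3) by auto
  moreover have "X' i \<inter> W' = {}" if "i \<in> K'" for i
    using X'(1)[OF that] D(7)[of i] that assms(2,3) by blast
  moreover have "c x w = i" if "i \<in> K'" "x \<in> X' i" "w \<in> W'" for i x w
    using X'(1)[of i] X'(3)[of i x w] D(8)[of i x w] that assms(2,3) by blast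
  moreover have "\<not> has_cycle (coloured c i) (W' \<union> (\<Union>i\<in>K'. X' i)) (2 * n + 1)" if "i \<in> K'" for i
  proof
    assume cyc: "has_cycle (coloured c i) (W' \<union> (\<Union>i\<in>K'. X' i)) (2 * n + 1)"
    have "W' \<union> (\<Union>i\<in>K'. X' i) \<subseteq> W \<union> (\<Union>i\<in>K. X i)"
      using assms(2,3) X'(1) by blast
    then show False
      using has_cycle_mono[OF cyc] D(10)[of i] that assms(3) by blast
  qed
  moreover have "finite K'" "finite W'" "gallai c W'"
    using D(1-3) assms(2,3) finite_subset gallai_mono by blast+
  ultimately show ?thesis
    unfolding config_def using assms(4) X'(2,4) by blast
qed

lemma config_empty:
  assumes "config K W X" "W' \<subseteq> W" "K' \<subseteq> K" "colours c W' \<subseteq> K'"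
  shows "config K' W' (\<lambda>_. {})"
  using n_ge by (intro config_sub[OF assms]) auto

lemma config_mono:
  assumes "config K W X" "W' \<subseteq> W" "K' \<subseteq> K" "colours c W' \<subseteq> K'"
  shows "config K' W' X"
proof (rule config_sub[OF assms])
  show "c x w = i" if "i \<in> K'" "x \<in> X i" "x \<in> W" "w \<in> W'" for i x w
    using configD(7)[OF assms(1), of i] assms(3) that by blast
  show "card (X i) < n" if "i \<in> K'" for i
    using configD(6)[OF assms(1), of i] assms(3) that by blast
  show "X i \<inter> X j = {}" if "i \<in> K'" "j \<in> K'" "i \<noteq> j" for i j
    using configD(9)[OF assms(1), of i j] assms(3) that by blast
qed blast

lemma complete_bipartite_coloured:
  assumes "finite S" "finite T" "S \<inter> T = {}" "\<And>s t. s \<in> S \<Longrightarrow> t \<in> T \<Longrightarrow> c s t = i"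
  shows "complete_bipartite (coloured c i) S T"
proof
  show "symp (coloured c i)"
    using sym by (auto simp: coloured_def symp_def)
qed (use assms in \<open>auto simp: coloured_def\<close>)

lemma no_inner_edge:
  assumes "\<not> has_cycle (coloured c i) V (2 * n + 1)" "finite V" "S \<subseteq> V" "T \<subseteq> V" "S \<inter> T = {}"
    "\<And>s t. s \<in> S \<Longrightarrow> t \<in> T \<Longrightarrow> c s t = i" "card S \<ge> n + 1" "card T \<ge> n"
  shows "i \<notin> colours c S"
proof
  assume "i \<in> colours c S"
  then obtain s s' where s: "s \<in> S" "s' \<in> S" "s \<noteq> s'" "c s s' = i"
    by (auto simp: colours_def)
  have "complete_bipartite (coloured c i) S T"
    using assms finite_subset by (intro complete_bipartite_coloured) auto
  then have "has_cycle (coloured c i) (S \<union> T) (2 * n + 1)"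
    using complete_bipartite.cycle_inner_edge[of "coloured c i" S T s s' n] s assms(7,8) n_ge by (auto simp: coloured_def)
  then show False
    using assms(1) has_cycle_mono[of "coloured c i" "S \<union> T" _ V] assms(3,4) by blast
qed

lemma no_outer_vertex:
  assumes "\<not> has_cycle (coloured c i) V (2 * n + 1)" "finite V" "S \<subseteq> V" "T \<subseteq> V" "S \<inter> T = {}"
    "\<And>s t. s \<in> S \<Longrightarrow> t \<in> T \<Longrightarrow> c s t = i" "card S \<ge> n" "card T \<ge> n" "v \<in> V" "v \<notin> S" "v \<notin> T" "s \<in> S" "t \<in> T"
    "c v s = i" "c v t = i"
  shows False
proof -
  have "complete_bipartite (coloured c i) S T"
    using assms finite_subset by (intro complete_bipartite_coloured) auto
  moreover have "coloured c i v s" "coloured c i v t"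
    using assms by (auto simp: coloured_def)
  ultimately have "has_cycle (coloured c i) (insert v (S \<union> T)) (2 * n + 1)"
    using complete_bipartite.cycle_outer_vertex[of "coloured c i" S T s t v n] assms(7-13) n_ge by auto
  then show False
    using assms(1) has_cycle_mono[of "coloured c i" "insert v (S \<union> T)" _ V] assms(3,4,9) by blast
qed

lemma no_outer_edge:
  assumes "\<not> has_cycle (coloured c i) V (2 * n + 1)" "finite V" "S \<subseteq> V" "T \<subseteq> V" "S \<inter> T = {}"
    "\<And>s t. s \<in> S \<Longrightarrow> t \<in> T \<Longrightarrow> c s t = i" "card S \<ge> n" "card T \<ge> n" "u \<in> V - S - T" "u' \<in> V - S - T" "u \<noteq> u'"
    "s \<in> S" "s' \<in> S" "s \<noteq> s'" "c u u' = i" "c u s = i" "c u' s' = i"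
  shows False
proof -
  have "complete_bipartite (coloured c i) S T"
    using assms finite_subset by (intro complete_bipartite_coloured) auto
  moreover have "coloured c i u u'" "coloured c i u s" "coloured c i u' s'"
    using assms by (auto simp: coloured_def)
  ultimately have "has_cycle (coloured c i) ({u, u'} \<union> S \<union> T) (2 * n + 1)"
    using complete_bipartite.cycle_outer_edge[of "coloured c i" S T s s' u u' n] assms(7-14) n_ge by auto
  then show False
    using assms(1) has_cycle_mono[of "coloured c i" "{u, u'} \<union> S \<union> T" _ V] assms(3,4,9,10) by blast
qed

text \<open>The apex set counts as one class and every vertex of \<open>W\<close> as a class of its
  own, since nothing is known about edges inside the apex set.\<close>

lemma one_colour_bound:
  assumes cfg: "config {r} W X"
  shows "card W + card (X r) \<le> 2 * n"
proof (rule ccontr)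
  assume large: "\<not> ?thesis"
  note D = configD[OF cfg]
  obtain e :: "'a \<Rightarrow> nat" where e: "inj_on e W"
    using finite_imp_inj_to_nat_seg[OF D(2)] by blast
  define q where "q x = (if x \<in> W then Suc (e x) else 0)" for x
  have "has_cycle (coloured c r) (W \<union> X r) (2 * n + 1)"
  proof (rule multipartite_cycle)
    have "card (W \<union> X r) = card W + card (X r)"
      using D(2,5,7) by (intro card_Un_disjoint) auto
    then show "card (W \<union> X r) \<ge> 2 * n + 1"
      using large by linarith
    show "finite (W \<union> X r)" "n \<ge> 1"
      using D(2,5) n_ge by auto
    show "card {x \<in> W \<union> X r. q x = i} \<le> n" for i
    proof (cases i)
      case 0
      then have "card {x \<in> W \<union> X r. q x = i} \<le> card (X r)"
        using D(5) by (intro card_mono) (auto simp: q_def split: if_splits)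
      then show ?thesis
        using D(6)[of r] by simp
    next
      case (Suc j)
      then have "x = y" if "x \<in> {x \<in> W \<union> X r. q x = i}" "y \<in> {x \<in> W \<union> X r. q x = i}" for x y
        using that e by (auto simp: q_def inj_on_def split: if_splits)
      then have "card {x \<in> W \<union> X r. q x = i} \<le> 1"
        using D(2,5) by (auto simp: card_le_Suc0_iff_eq)
      then show ?thesis
        using n_ge by linarith
    qed
    show "coloured c r x y" if "x \<in> W \<union> X r" "y \<in> W \<union> X r" "q x \<noteq> q y" for x y
    proof -
      consider "x \<in> W" "y \<in> W" | "x \<in> W" "y \<in> X r" | "x \<in> X r" "y \<in> W"
        using \<open>x \<in> W \<union> X r\<close> \<open>y \<in> W \<union> X r\<close> \<open>q x \<noteq> q y\<close> by (auto simp: q_def split: if_splits)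
      moreover have "x \<noteq> y"
        using that by auto
      ultimately have "c x y = r"
        using D(4) coloursI[of x W y c] D(8)[of r x y] D(8)[of r y x] sym[of x y] by cases auto
      then show ?thesis
        using \<open>x \<noteq> y\<close> by (simp add: coloured_def)
    qed
  qed
  then show False
    using D(10)[of r] by simp
qed

lemma two_colour_bound:
  assumes cfg: "config {r, b} W X" and "r \<noteq> b"
  shows "card W + card (X r) + card (X b) \<le> 4 * n"
proof -
  note D = configD[OF cfg]
  have V: "W \<union> (\<Union>i\<in>{r, b}. X i) = W \<union> X r \<union> X b"
    by auto
  show ?thesis
  proof (rule two_colours_apex_bound[OF sym n_ge assms(2)])
    show "c x y \<in> {r, b}" if "x \<in> W" "y \<in> W" "x \<noteq> y" for x y
      using D(4) coloursI[OF that, of c] by auto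
    show "\<not> has_cycle (coloured c r) (W \<union> X r \<union> X b) (2 * n + 1)" "\<not> has_cycle (coloured c b) (W \<union> X r \<union> X b) (2 * n + 1)"
      using D(10)[of r] D(10)[of b] unfolding V by auto
  qed (use D assms(2) in auto)
qed

end

text \<open>The situation of a part \<open>M\<close> with at least \<open>n\<close> vertices:
  \<open>R\<close> and \<open>B\<close> are its red and blue neighbourhoods in \<open>W\<close>, and
  \<open>L\<close> contains the remaining colours. The induction hypothesis is a locale assumption,
  so that every statement also holds with red and blue exchanged.\<close>

locale module_config = odd_cycle_colouring +
  fixes r b :: nat and L :: "nat set" and W :: "'a set" and X :: "nat \<Rightarrow> 'a set" and M R B :: "'a set"
  assumes cfg: "config (insert r (insert b L)) W X"
    and distinct_colours: "r \<noteq> b" "r \<notin> L" "b \<notin> L" and L_ne: "L \<noteq> {}"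
    and W_eq: "W = M \<union> R \<union> B" and disj: "M \<inter> R = {}" "M \<inter> B = {}" "R \<inter> B = {}"
    and card_M: "card M \<ge> n" and proper: "R \<union> B \<noteq> {}"
    and red: "\<And>x m. x \<in> R \<Longrightarrow> m \<in> M \<Longrightarrow> c x m = r" and blue: "\<And>x m. x \<in> B \<Longrightarrow> m \<in> M \<Longrightarrow> c x m = b"
    and IH: "\<And>K' W' X'. card W' < card W \<Longrightarrow> config K' W' X' \<Longrightarrow> card W' + (\<Sum>i\<in>K'. card (X' i)) \<le> n * 2 ^ card K'"
begin

lemma swap: "module_config c n b r L W X M B R"
  using cfg distinct_colours L_ne W_eq disj card_M proper red blue IH
  by unfold_locales (auto simp: insert_commute)

lemma finite: "finite L" "finite W" "finite M" "finite R" "finite B" "finite (X r)" "finite (X b)"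
  using configD(1,2,5)[OF cfg] W_eq by auto

lemma card_L: "card L + 1 \<le> 2 ^ card L"
  by (induction "card L") (auto simp: less_eq_Suc_le[symmetric])

lemma card_L_pos: "card L \<ge> 1"
  using L_ne finite(1) by (simp add: Suc_leI card_gt_0_iff)

definition V where "V = W \<union> (\<Union>i\<in>insert r (insert b L). X i)"

lemma V: "W \<subseteq> V" "X r \<subseteq> V" "X b \<subseteq> V" "finite V"
  using configD(1,2,5)[OF cfg] by (auto simp: V_def)

lemma no_cycle: "\<not> has_cycle (coloured c r) V (2 * n + 1)"
  using configD(10)[OF cfg] by (auto simp: V_def)

lemma card_W: "card W = card M + card R + card B"
proof -
  have "(M \<union> R) \<inter> B = {}"
    using disj by blast
  then show ?thesis
    using finite disj unfolding W_eq by (simp add: card_Un_disjoint)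
qed

lemma smaller: "card M < card W" "R' \<subseteq> R \<union> B \<Longrightarrow> card R' < card W"
proof -
  have "card (R \<union> B) = card R + card B"
    using finite disj by (intro card_Un_disjoint) auto
  moreover have "card (R \<union> B) > 0"
    using finite proper by (simp add: card_gt_0_iff)
  ultimately show "card M < card W"
    using card_W by linarith
  have "card M > 0"
    using card_M n_ge by linarith
  then show "card R' < card W" if "R' \<subseteq> R \<union> B"
    using card_mono[OF _ that] finite card_W \<open>card (R \<union> B) = card R + card B\<close> by simp
qed

lemma X_r: "X r \<inter> W = {}" "card (X r) < n" "\<And>x w. x \<in> X r \<Longrightarrow> w \<in> W \<Longrightarrow> c x w = r"
  using configD[OF cfg] by auto

lemma colours_sub: "U \<subseteq> W \<Longrightarrow> colours c U \<subseteq> insert r (insert b L)"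
  using configD(4)[OF cfg] colours_mono by blast

text \<open>\<open>R\<close> and \<open>M\<close> form a red biclique. A red apex vertex sees both
  sides, and a red edge inside a side of \<open>n + 1\<close> vertices closes an odd cycle.\<close>

lemma large_side: "card R \<ge> n \<Longrightarrow> X r = {}" "card R \<ge> n + 1 \<Longrightarrow> r \<notin> colours c R"
proof -
  show "X r = {}" if "card R \<ge> n"
  proof (rule ccontr)
    assume "X r \<noteq> {}"
    then obtain x where x: "x \<in> X r"
      by blast
    have "card R > 0" "card M > 0"
      using that card_M n_ge by linarith+
    then obtain s m where "s \<in> R" "m \<in> M"
      by (metis card_gt_0_iff equals0I)
    then show False
      using that card_M x X_r V W_eq disj red
      by (intro no_outer_vertex[OF no_cycle V(4), of R M x s m]) auto
  qed
  show "r \<notin> colours c R" if "card R \<ge> n + 1"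
    using no_inner_edge[OF no_cycle V(4), of R M] that card_M V W_eq disj red by auto
qed

lemma side_bound: "card R + card (X r) \<le> n * 2 ^ (card L + 1)"
proof (cases "card R \<ge> n + 1")
  case True
  then have "colours c R \<subseteq> insert b L"
    using large_side(2) colours_sub[of R] W_eq by blast
  then have "config (insert b L) R (\<lambda>_. {})"
    using W_eq by (intro config_empty[OF cfg]) auto
  then have "card R + 0 \<le> n * 2 ^ card (insert b L)"
    using IH[of R "insert b L" "\<lambda>_. {}"] smaller(2)[of R] by simp
  then show ?thesis
    using large_side(1) True finite(1) distinct_colours by simp
next
  case False
  then have "card R + card (X r) \<le> 2 * n"
    using X_r(2) by linarith
  also have "2 * n \<le> n * 2 ^ (card L + 1)"
    by simp
  finally show ?thesis .
qed

lemma sum_L_bound: "(\<Sum>i\<in>L. card (X i)) \<le> card L * (n - 1)"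
proof -
  have "card (X i) \<le> n - 1" if "i \<in> L" for i
    using configD(6)[OF cfg, of i] that by auto
  then show ?thesis
    using sum_bounded_above[of L "\<lambda>i. card (X i)" "n - 1"] by simp
qed

lemma no_red_M:
  assumes "card (X r) + card R \<ge> n" "card M \<ge> n + 1"
  shows "r \<notin> colours c M"
proof (rule no_inner_edge[OF no_cycle V(4)])
  show "card (X r \<union> R) \<ge> n"
    using assms(1) X_r(1) W_eq finite by (subst card_Un_disjoint) auto
  show "c s t = r" if "s \<in> M" "t \<in> X r \<union> R" for s t
    using that red[of t s] X_r(3)[of t s] W_eq sym[of s t] by auto
qed (use V W_eq disj X_r(1) assms(2) in auto)

lemma card_Un_b: "card (X b \<union> B) = card (X b) + card B"
  using configD(7)[OF cfg, of b] W_eq finite by (intro card_Un_disjoint) auto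

lemma sum_upd: "a \<notin> L \<Longrightarrow> (\<Sum>i\<in>L. card ((X(a := Y)) i)) = (\<Sum>i\<in>L. card (X i))"
  by (intro sum.cong) auto

text \<open>The red side removes red from \<open>M\<close>, while the small blue side
  \<open>B\<close> is moved into the apex set of \<open>b\<close>; one colour is saved. For
  \<open>M\<close> of at most \<open>n\<close> vertices a direct count suffices.\<close>

lemma mixed_bound:
  assumes "card (X r) + card R \<ge> n" "card (X b) + card B < n"
  shows "card M + (\<Sum>i\<in>L. card (X i)) + card (X b) + card B \<le> n * 2 ^ (card L + 1)"
proof (cases "card M \<ge> n + 1")
  case True
  have "colours c M \<subseteq> insert b L"
    using no_red_M[OF assms(1) True] colours_sub[of M] W_eq by blast
  then have "config (insert b L) M (X(b := X b \<union> B))"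
  proof (intro config_sub[OF cfg])
    fix i assume "i \<in> insert b L"
    then show "(X(b := X b \<union> B)) i \<subseteq> X i \<union> (W - M)" "card ((X(b := X b \<union> B)) i) < n"
      using W_eq disj configD(6)[OF cfg, of i] assms(2) card_Un_b by auto
    show "c x w = i" if "x \<in> (X(b := X b \<union> B)) i" "x \<in> W" "w \<in> M" for x w
      using that blue configD(7)[OF cfg, of i] \<open>i \<in> insert b L\<close> by (auto split: if_splits)
    show "(X(b := X b \<union> B)) i \<inter> (X(b := X b \<union> B)) j = {}" if "j \<in> insert b L" "i \<noteq> j" for j
    proof -
      have "X i \<inter> X j = {}" "X i \<inter> W = {}" "X j \<inter> W = {}"
        using configD(7,9)[OF cfg] that \<open>i \<in> insert b L\<close> by blast+
      then show ?thesis
        using that W_eq by auto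
    qed
  qed (use W_eq in auto)
  then have "card M + (\<Sum>i\<in>insert b L. card ((X(b := X b \<union> B)) i)) \<le> n * 2 ^ card (insert b L)"
    using IH smaller(1) by blast
  then show ?thesis
    using finite(1) distinct_colours sum_upd card_Un_b by simp
next
  case False
  have "card M + (\<Sum>i\<in>L. card (X i)) + card (X b) + card B \<le> n + card L * n + n"
    using False assms(2) sum_L_bound mult_le_mono2[of "n - 1" n "card L"] by linarith
  also have "\<dots> = n * (card L + 2)"
    by (simp add: algebra_simps)
  also have "\<dots> \<le> n * (2 * 2 ^ card L)"
    using card_L by (intro mult_le_mono2) linarith
  finally show ?thesis
    by simp
qed

lemma both_large_M_bound:
  assumes "card (X r) + card R \<ge> n" "card (X b) + card B \<ge> n"
  shows "card M + (\<Sum>i\<in>L. card (X i)) \<le> n * 2 ^ card L"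
proof (cases "card M \<ge> n + 1")
  case True
  interpret sw: module_config c n b r L W X M B R
    by (rule swap)
  have "colours c M \<subseteq> L"
    using no_red_M[OF assms(1) True] sw.no_red_M[OF assms(2) True] colours_sub[of M] W_eq by blast
  then have "config L M X"
    using W_eq by (intro config_mono[OF cfg]) auto
  then show ?thesis
    using IH smaller(1) by blast
next
  case False
  have "card M + (\<Sum>i\<in>L. card (X i)) \<le> n + card L * n"
    using False sum_L_bound mult_le_mono2[of "n - 1" n "card L"] by linarith
  also have "\<dots> = n * (card L + 1)"
    by (simp add: algebra_simps)
  also have "\<dots> \<le> n * 2 ^ card L"
    using card_L by (intro mult_le_mono2)
  finally show ?thesis .
qed

lemma RB_colour: "x \<in> R \<Longrightarrow> y \<in> B \<Longrightarrow> c x y = r \<or> c x y = b"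
proof -
  assume xy: "x \<in> R" "y \<in> B"
  have "card M > 0"
    using card_M n_ge by linarith
  then obtain m where m: "m \<in> M"
    by (metis card_gt_0_iff equals0I)
  have "c x m = c m y \<or> c m y = c x y \<or> c x m = c x y"
    using xy m W_eq disj by (intro configD(3)[OF cfg, unfolded gallai_def, rule_format]) auto
  then show ?thesis
    using red[OF xy(1) m] blue[OF xy(2) m] sym[of m y] distinct_colours(1) by auto
qed

text \<open>A second blue edge would make \<open>x x'\<close> an outer edge attached to two
  different vertices of \<open>B\<close> in the blue biclique of \<open>B\<close> and
  \<open>M\<close>.\<close>

lemma no_blue_connection:
  assumes "card B \<ge> n" "x \<in> R" "x' \<in> R" "x \<noteq> x'" "c x x' = b" "y \<in> B" "y' \<in> B" "y \<noteq> y'" "c x y = b"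
  shows "c x' y' = r"
proof (rule ccontr)
  assume "c x' y' \<noteq> r"
  then have "c x' y' = b"
    using RB_colour assms by blast
  interpret sw: module_config c n b r L W X M B R
    by (rule swap)
  show False
    using \<open>c x' y' = b\<close> assms card_M sw.V W_eq disj blue
    by (intro no_outer_edge[OF sw.no_cycle sw.V(4), of B M x x' y y']) auto
qed

text \<open>All of \<open>R\<close> except \<open>x'\<close> is blue to \<open>y\<close> and
  \<open>y'\<close>, so a blue edge there would have a forbidden connection; \<open>R - {x'}\<close>
  keeps only the colours of \<open>L\<close>. On the other hand \<open>x'\<close> is red to all of
  \<open>B\<close>, so it can join \<open>B\<close> without creating blue edges. The vertex lost on
  one side is gained on the other, and the bound stays exact.\<close>

lemma special_pattern_bound:
  assumes large: "card R \<ge> n + 1" "card B \<ge> n + 1"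
    and x: "x \<in> R" "x' \<in> R" "x \<noteq> x'" "c x x' = b" and y: "y \<in> B" "y' \<in> B" "y \<noteq> y'" "c y y' = r"
    and pattern: "c x y = b" "c x y' = b" "c x' y = r" "c x' y' = r"
  shows "card R + card B \<le> n * 2 ^ card L + n * 2 ^ (card L + 1)"
proof -
  interpret sw: module_config c n b r L W X M B R
    by (rule swap)
  have blue_yy: "c z w = b" if "z \<in> R - {x'}" "w \<in> {y, y'}" for z w
  proof -
    have "c y z = b" "c y' z = b"
      using sw.no_blue_connection[of y' y x' z] sw.no_blue_connection[of y y' x' z] that large x y pattern sym by auto
    then show ?thesis
      using that sym by auto
  qed
  have "b \<notin> colours c (R - {x'})"
  proof
    assume "b \<in> colours c (R - {x'})"
    then obtain u u' where u: "u \<in> R - {x'}" "u' \<in> R - {x'}" "u \<noteq> u'" "c u u' = b"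
      by (auto simp: colours_def)
    then have "c u' y' = r"
      using no_blue_connection[of u u' y y'] blue_yy[of u y] large y by auto
    then show False
      using blue_yy[of u' y'] u distinct_colours by auto
  qed
  moreover have "r \<notin> colours c (R - {x'})"
    using large_side(2)[OF large(1)] by (auto simp: colours_def)
  ultimately have "colours c (R - {x'}) \<subseteq> L"
    using colours_sub[of "R - {x'}"] W_eq by blast
  then have "config L (R - {x'}) (\<lambda>_. {})"
    using W_eq by (intro config_empty[OF cfg]) auto
  then have "card (R - {x'}) + 0 \<le> n * 2 ^ card L"
    using IH[of "R - {x'}" L "\<lambda>_. {}"] smaller(2)[of "R - {x'}"] by auto
  then have R_bound: "card R - 1 \<le> n * 2 ^ card L"
    using x finite by simp
  have x'_red: "c x' z = r" if "z \<in> B" for z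
  proof -
    obtain w where w: "w \<in> {y, y'}" "w \<noteq> z"
      using y(3) by blast
    show ?thesis
      using no_blue_connection[of x x' w z] w that large x y pattern by auto
  qed
  have "b \<notin> colours c (insert x' B)"
  proof
    assume "b \<in> colours c (insert x' B)"
    then obtain u u' where u: "u \<in> insert x' B" "u' \<in> insert x' B" "u \<noteq> u'" "c u u' = b"
      by (auto simp: colours_def)
    then have "u \<in> B" "u' \<in> B"
      using x'_red[of u] x'_red[of u'] sym[of u x'] distinct_colours(1) by auto
    then have "b \<in> colours c B"
      using u coloursI[of u B u' c] by simp
    then show False
      using sw.large_side(2)[OF large(2)] by blast
  qed
  then have "colours c (insert x' B) \<subseteq> insert r L"
    using colours_sub[of "insert x' B"] W_eq x by blast
  then have "config (insert r L) (insert x' B) (\<lambda>_. {})"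
    using W_eq x by (intro config_empty[OF cfg]) auto
  then have "card (insert x' B) + 0 \<le> n * 2 ^ card (insert r L)"
    using IH[of "insert x' B" "insert r L" "\<lambda>_. {}"] smaller(2)[of "insert x' B"] x by auto
  moreover have "x' \<notin> B"
    using x disj by blast
  ultimately have "card B + 1 \<le> n * 2 ^ (card L + 1)"
    using finite distinct_colours by simp
  then show ?thesis
    using R_bound by linarith
qed

text \<open>Each side alone is bounded by \<open>n * 2 ^ (card L + 1)\<close>; half of one such
  bound has to be saved. This is immediate unless \<open>R\<close> has a blue edge and
  \<open>B\<close> a red one. Among the four edges between these two, neither colour contains two
  disjoint ones, so the edges at one of the four vertices are both red and those at its partner both
  blue: the special pattern up to symmetry.\<close>

lemma both_large_bound:
  assumes "card R \<ge> n + 1" "card B \<ge> n + 1"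
  shows "card R + card B \<le> n * 2 ^ card L + n * 2 ^ (card L + 1)"
proof -
  interpret sw: module_config c n b r L W X M B R
    by (rule swap)
  have bounds: "card R \<le> n * 2 ^ (card L + 1)" "card B \<le> n * 2 ^ (card L + 1)"
    using side_bound sw.side_bound by linarith+
  show ?thesis
  proof (cases "b \<in> colours c R \<and> r \<in> colours c B")
    case False
    then have "colours c R \<subseteq> L \<or> colours c B \<subseteq> L"
      using large_side(2)[OF assms(1)] sw.large_side(2)[OF assms(2)] colours_sub[of R] colours_sub[of B] W_eq by blast
    then have "config L R (\<lambda>_. {}) \<or> config L B (\<lambda>_. {})"
      using W_eq config_empty[OF cfg, of R L] config_empty[OF cfg, of B L] by blast
    then have "card R + 0 \<le> n * 2 ^ card L \<or> card B + 0 \<le> n * 2 ^ card L"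
      using IH[of R L "\<lambda>_. {}"] IH[of B L "\<lambda>_. {}"] smaller(2)[of R] smaller(2)[of B] by auto
    then show ?thesis
      using bounds by linarith
  next
    case True
    obtain x x' where x: "x \<in> R" "x' \<in> R" "x \<noteq> x'" "c x x' = b"
      using True by (auto simp: colours_def)
    obtain y y' where y: "y \<in> B" "y' \<in> B" "y \<noteq> y'" "c y y' = r"
      using True by (auto simp: colours_def)
    have x_rev: "c x' x = b" and y_rev: "c y' y = r"
      using x y sym by auto
    have rb: "c u v = r \<or> c u v = b" if "u \<in> {x, x'}" "v \<in> {y, y'}" for u v
      using RB_colour that x y by blast
    have n1: "\<not> (c x y = b \<and> c x' y' = b)" "\<not> (c x y' = b \<and> c x' y = b)"
      using no_blue_connection[of x x' y y'] no_blue_connection[of x x' y' y] assms x y distinct_colours by auto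
    have flip: "c y x = c x y" "c y x' = c x' y" "c y' x = c x y'" "c y' x' = c x' y'"
      by (rule sym)+
    have n2: "\<not> (c x y = r \<and> c x' y' = r)" "\<not> (c x y' = r \<and> c x' y = r)"
      using sw.no_blue_connection[of y y' x x'] sw.no_blue_connection[of y' y x x'] assms x y y_rev distinct_colours(1)
      unfolding flip by auto
    consider "c x y = b" "c x y' = b" "c x' y = r" "c x' y' = r"
      | "c x y = r" "c x y' = r" "c x' y = b" "c x' y' = b"
      | "c x y = r" "c x y' = b" "c x' y = r" "c x' y' = b"
      | "c x y = b" "c x y' = r" "c x' y = b" "c x' y' = r"
      using n1 n2 rb[of x y] rb[of x y'] rb[of x' y] rb[of x' y'] by auto
    then show ?thesis
    proof cases
      case 1
      then show ?thesis
        using special_pattern_bound[OF assms x y] by blast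
    next
      case 2
      then show ?thesis
        using special_pattern_bound[OF assms x(2,1) x(3)[symmetric] x_rev y] by blast
    next
      case 3
      then have "c y x = r" "c y x' = r" "c y' x = b" "c y' x' = b"
        unfolding flip by simp_all
      then show ?thesis
        using sw.special_pattern_bound[OF assms(2,1) y x] by simp
    next
      case 4
      then have "c y x = b" "c y x' = b" "c y' x = r" "c y' x' = r"
        unfolding flip by simp_all
      then show ?thesis
        using sw.special_pattern_bound[OF assms(2,1) y(2,1) y(3)[symmetric] y_rev x] by simp
    qed
  qed
qed

text \<open>A side \<open>R\<close> or \<open>B\<close> with fewer than \<open>n\<close> vertices
  contributes less than \<open>2 * n\<close> with its apex set, which \<open>n * 2 ^ card L\<close>
  absorbs because \<open>L\<close> is nonempty. From \<open>n\<close> vertices on, the apex set is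
  empty.\<close>

lemma both_large_total:
  assumes "card (X r) + card R \<ge> n" "card (X b) + card B \<ge> n"
  shows "card (X r) + card R + card (X b) + card B \<le> n * 2 ^ card L + n * 2 ^ (card L + 1)"
proof -
  interpret sw: module_config c n b r L W X M B R
    by (rule swap)
  have "(2::nat) ^ 1 \<le> 2 ^ card L"
    using card_L_pos by (intro power_increasing) auto
  then have two_n: "2 * n \<le> n * 2 ^ card L"
    by simp
  consider "card R < n" | "card B < n" | "card R \<ge> n" "card B \<ge> n"
    by linarith
  then show ?thesis
  proof cases
    case 1
    then show ?thesis
      using X_r(2) two_n sw.side_bound by linarith
  next
    case 2
    then show ?thesis
      using sw.X_r(2) two_n side_bound by linarith
  next
    case 3
    then have "card (X r) = 0" "card (X b) = 0"
      using large_side(1) sw.large_side(1) by simp_all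
    moreover have "card R + card B \<le> n * 2 ^ card L + n * 2 ^ (card L + 1)"
    proof (cases "card R \<ge> n + 1 \<and> card B \<ge> n + 1")
      case True
      then show ?thesis
        using both_large_bound by blast
    next
      case False
      then show ?thesis
        using 3 side_bound sw.side_bound two_n by linarith
    qed
    ultimately show ?thesis
      by linarith
  qed
qed

text \<open>With \<open>N = n * 2 ^ card L\<close> the goal is \<open>4 * N\<close>. Two small sides
  become apex sets of \<open>M\<close> with all colours kept; one large side gives
  \<open>2 * N + 2 * N\<close>; two large sides give \<open>N\<close> for \<open>M\<close> and
  \<open>3 * N\<close> for the rest.\<close>

lemma module_bound:
  "card W + card (X r) + card (X b) + (\<Sum>i\<in>L. card (X i)) \<le> n * 2 ^ (card L + 2)"
proof -
  interpret sw: module_config c n b r L W X M B R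
    by (rule swap)
  define N where "N = n * 2 ^ card L"
  have N: "n * 2 ^ (card L + 1) = 2 * N" "n * 2 ^ (card L + 2) = 4 * N"
    by (simp_all add: N_def)
  consider "card (X r) + card R < n" "card (X b) + card B < n" | "card (X r) + card R \<ge> n" "card (X b) + card B < n"
    | "card (X r) + card R < n" "card (X b) + card B \<ge> n" | "card (X r) + card R \<ge> n" "card (X b) + card B \<ge> n"
    by linarith
  then show ?thesis
  proof cases
    case 1
    define X' where "X' = X(r := X r \<union> R, b := X b \<union> B)"
    have X': "X' r = X r \<union> R" "X' b = X b \<union> B" "\<And>i. i \<in> L \<Longrightarrow> X' i = X i"
      using distinct_colours by (auto simp: X'_def)
    have sums: "card (X' r) = card (X r) + card R" "card (X' b) = card (X b) + card B"
      using card_Un_b sw.card_Un_b X' by simp_all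
    have "config (insert r (insert b L)) M X'"
    proof (intro config_sub[OF cfg])
      fix i assume i: "i \<in> insert r (insert b L)"
      then show "X' i \<subseteq> X i \<union> (W - M)" "card (X' i) < n"
        using W_eq disj configD(6)[OF cfg, of i] 1 sums X' by auto
      show "c x w = i" if "x \<in> X' i" "x \<in> W" "w \<in> M" for x w
        using that red blue configD(7)[OF cfg, of i] i X' by auto
      show "X' i \<inter> X' j = {}" if "j \<in> insert r (insert b L)" "i \<noteq> j" for j
      proof -
        have "X i \<inter> X j = {}" "X i \<inter> W = {}" "X j \<inter> W = {}"
          using configD(7,9)[OF cfg] that i by blast+
        then show ?thesis
          using that i X' W_eq disj by auto
      qed
    qed (use W_eq colours_sub[of M] in auto)
    then have "card M + (\<Sum>i\<in>insert r (insert b L). card (X' i)) \<le> n * 2 ^ card (insert r (insert b L))"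
      using IH smaller(1) by blast
    moreover have "(\<Sum>i\<in>L. card (X' i)) = (\<Sum>i\<in>L. card (X i))"
      using X'(3) by (intro sum.cong) auto
    ultimately show ?thesis
      using finite(1) distinct_colours sums card_W by simp
  next
    case 2
    then show ?thesis
      using mixed_bound[OF 2] side_bound card_W N by linarith
  next
    case 3
    then show ?thesis
      using sw.mixed_bound sw.side_bound card_W N by linarith
  next
    case 4
    then show ?thesis
      using both_large_M_bound[OF 4] both_large_total[OF 4] card_W N unfolding N_def[symmetric] by linarith
  qed
qed

end

section \<open>Partitions into small parts, and the induction\<close>

context odd_cycle_colouring
begin

text \<open>An apex vertex closes any \<open>2 * n\<close> consecutive vertices of the cycle, so the
  length and its parity do not matter.\<close>

lemma apex_no_long_cycle:
  assumes no_cycle: "\<not> has_cycle (coloured c i) V (2 * n + 1)"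
    and x: "x \<in> V" "x \<notin> W" "\<And>w. w \<in> W \<Longrightarrow> c x w = i" and "W \<subseteq> V" "l \<ge> 2 * n + 1"
  shows "\<not> has_cycle (coloured c i) W l"
proof
  assume "has_cycle (coloured c i) W l"
  then obtain ys where ys: "is_path (coloured c i) ys" "set ys \<subseteq> W" "length ys = l"
    by (auto simp: has_cycle_def is_cycle_def)
  define zs where "zs = take (2 * n) ys"
  have zs: "length zs = 2 * n" "zs \<noteq> []" "set zs \<subseteq> W"
    using ys assms(6) n_ge set_take_subset[of "2 * n" ys] by (auto simp: zs_def)
  have "is_path (coloured c i) zs"
    using is_path_appendD(1)[of "coloured c i" zs "drop (2 * n) ys"] ys(1) zs(2) by (simp add: zs_def)
  moreover have edge: "coloured c i x w" "coloured c i w x" if "w \<in> W" for w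
    using x(2) x(3)[OF that] sym[of w x] that by (auto simp: coloured_def)
  moreover have "hd zs \<in> W" "last zs \<in> W"
    using zs hd_in_set last_in_set by blast+
  ultimately have "is_cycle (coloured c i) ([x] @ zs)"
    using zs x(2) by (intro is_cycle_append) auto
  then have "has_cycle (coloured c i) V (2 * n + 1)"
    using zs x(1) \<open>W \<subseteq> V\<close> by (intro has_cycleI[of _ "[x] @ zs"]) auto
  then show False
    using no_cycle by blast
qed

lemma small_parts_one_apex:
  assumes cfg: "config (insert r (insert b L)) W X" and "r \<noteq> b" and "X b = {}"
    and p: "\<And>x y. x \<in> W \<Longrightarrow> y \<in> W \<Longrightarrow> p x \<noteq> p y \<Longrightarrow> c x y \<in> {r, b}"
      "\<And>x x' y. x \<in> W \<Longrightarrow> x' \<in> W \<Longrightarrow> y \<in> W \<Longrightarrow> p x = p x' \<Longrightarrow> p x \<noteq> p y \<Longrightarrow> c x y = c x' y"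
    and small: "\<And>i :: nat. card {x \<in> W. p x = i} < n"
  shows "card W + card (X r) < 7 * n + 2"
proof (rule ccontr)
  assume large: "\<not> ?thesis"
  note D = configD[OF cfg]
  define q where "q x = (if x \<in> W then Suc (p x) else 0)" for x
  have fin: "finite W" "finite (X r)"
    using D by auto
  have X_r: "c x w = r" "c w x = r" if "x \<in> X r" "w \<in> W" for x w
    using D(8)[of r x w] that sym[of w x] by auto
  have "has_cycle (coloured c r) (W \<union> X r) (2 * n + 1) \<or> has_cycle (coloured c b) (W \<union> X r) (2 * n + 1)"
  proof (rule two_coloured_multipartite[OF _ sym n_ge])
    show "c x y \<in> {r, b}" if "x \<in> W \<union> X r" "y \<in> W \<union> X r" "q x \<noteq> q y" for x y
      using that p(1)[of x y] X_r by (auto simp: q_def split: if_splits)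
    show "c x y = c x' y" if "x \<in> W \<union> X r" "x' \<in> W \<union> X r" "y \<in> W \<union> X r" "q x = q x'" "q x \<noteq> q y" for x x' y
    proof (cases "x \<in> W \<and> y \<in> W")
      case True
      then have "x' \<in> W" "p x = p x'" "p x \<noteq> p y"
        using that by (auto simp: q_def split: if_splits)
      then show ?thesis
        using p(2) True by blast
    next
      case False
      then show ?thesis
        using that X_r by (auto simp: q_def split: if_splits)
    qed
    show "card {x \<in> W \<union> X r. q x = i} < n" for i
    proof (cases i)
      case 0
      then have "card {x \<in> W \<union> X r. q x = i} \<le> card (X r)"
        using fin by (intro card_mono) (auto simp: q_def split: if_splits)
      then show ?thesis
        using D(6)[of r] by simp
    next
      case (Suc j)
      then have "{x \<in> W \<union> X r. q x = i} = {x \<in> W. p x = j}"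
        by (auto simp: q_def split: if_splits)
      then show ?thesis
        using small by simp
    qed
    have "card (W \<union> X r) = card W + card (X r)"
      using fin D(7)[of r] by (intro card_Un_disjoint) auto
    then show "card (W \<union> X r) \<ge> 7 * n + 2"
      using large by linarith
  qed (use fin in auto)
  moreover have "W \<union> X r \<subseteq> W \<union> (\<Union>i\<in>insert r (insert b L). X i)"
    by auto
  ultimately show False
    using D(10)[of r] D(10)[of b] has_cycle_mono by blast
qed

text \<open>In each colour an apex vertex sees both sides of every biclique and shortens every long
  cycle. So any long cycle is a contradiction, and removing a part from \<open>5 * n - 1\<close>
  vertices leaves the degree \<open>4 * n\<close> that produces one.\<close>

lemma small_parts_two_apices:
  assumes cfg: "config (insert r (insert b L)) W X" and "r \<noteq> b" and "X r \<noteq> {}" "X b \<noteq> {}"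
    and p: "\<And>x y. x \<in> W \<Longrightarrow> y \<in> W \<Longrightarrow> p x \<noteq> p y \<Longrightarrow> c x y \<in> {r, b}"
      "\<And>x x' y. x \<in> W \<Longrightarrow> x' \<in> W \<Longrightarrow> y \<in> W \<Longrightarrow> p x = p x' \<Longrightarrow> p x \<noteq> p y \<Longrightarrow> c x y = c x' y"
    and small: "\<And>i :: nat. card {x \<in> W. p x = i} < n"
  shows "card W < 5 * n - 1"
proof (rule ccontr)
  assume large: "\<not> ?thesis"
  note D = configD[OF cfg]
  define V where "V = W \<union> (\<Union>i\<in>insert r (insert b L). X i)"
  have V: "W \<subseteq> V" "finite V"
    using D(1,2,5) by (auto simp: V_def)
  have no_cycle: "\<not> has_cycle (coloured c i) V (2 * n + 1)" if "i \<in> {r, b}" for i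
    using D(10)[of i] that by (auto simp: V_def)
  have apex: "\<exists>x. x \<in> V \<and> x \<notin> W \<and> (\<forall>w\<in>W. c x w = i)" if "i \<in> {r, b}" for i
  proof -
    have "X i \<noteq> {}" "i \<in> insert r (insert b L)"
      using that assms(3,4) by auto
    then show ?thesis
      using D(7)[of i] D(8)[of i] unfolding V_def by blast
  qed
  have no_long: "\<not> has_cycle (coloured c i) W l" if i: "i \<in> {r, b}" and "l \<ge> 2 * n + 1" for i l
  proof -
    obtain x where "x \<in> V" "x \<notin> W" "\<And>w. w \<in> W \<Longrightarrow> c x w = i"
      using apex[OF i] by blast
    then show ?thesis
      using apex_no_long_cycle[OF no_cycle[OF i]] V(1) \<open>l \<ge> 2 * n + 1\<close> by blast
  qed
  have "no_biclique (coloured c i) W n" if i: "i \<in> {r, b}" for i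
    unfolding no_biclique_def
  proof
    assume "\<exists>S T. S \<subseteq> W \<and> T \<subseteq> W \<and> S \<inter> T = {} \<and> card S \<ge> n \<and> card T \<ge> n \<and> (\<forall>s\<in>S. \<forall>t\<in>T. coloured c i s t)"
    then obtain S T where ST: "S \<subseteq> W" "T \<subseteq> W" "S \<inter> T = {}" "card S \<ge> n" "card T \<ge> n" "\<forall>s\<in>S. \<forall>t\<in>T. coloured c i s t"
      by blast
    obtain x where x: "x \<in> V" "x \<notin> W" "\<And>w. w \<in> W \<Longrightarrow> c x w = i"
      using apex[OF i] by blast
    have "card S > 0" "card T > 0"
      using ST(4,5) n_ge by linarith+
    then obtain s t where "s \<in> S" "t \<in> T"
      by (metis card_gt_0_iff equals0I)
    then show False
      using ST x V(1)
      by (intro no_outer_vertex[OF no_cycle[OF i] V(2), of S T x s t]) (auto simp: coloured_def)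
  qed
  then have "\<exists>l \<ge> 2 * n + 1. has_cycle (coloured c r) W l \<or> has_cycle (coloured c b) W l"
    by (intro two_coloured_multipartite_long_cycle[OF D(2) sym n_ge p small]) (use large in auto)
  then show False
    using no_long by blast
qed

text \<open>One further colour is the critical case: \<open>7 * n + 1\<close> vertices in
  \<open>W\<close> and the one apex set, plus \<open>n - 1\<close> for the further colour, give
  exactly \<open>8 * n\<close>.\<close>

lemma small_parts_bound:
  assumes cfg: "config (insert r (insert b L)) W X" and rb: "r \<noteq> b" "r \<notin> L" "b \<notin> L" and "L \<noteq> {}"
    and p: "\<And>x y. x \<in> W \<Longrightarrow> y \<in> W \<Longrightarrow> p x \<noteq> p y \<Longrightarrow> c x y \<in> {r, b}"
      "\<And>x x' y. x \<in> W \<Longrightarrow> x' \<in> W \<Longrightarrow> y \<in> W \<Longrightarrow> p x = p x' \<Longrightarrow> p x \<noteq> p y \<Longrightarrow> c x y = c x' y"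
    and small: "\<And>i :: nat. card {x \<in> W. p x = i} < n"
  shows "card W + card (X r) + card (X b) + (\<Sum>i\<in>L. card (X i)) \<le> n * 2 ^ (card L + 2)"
proof -
  note D = configD[OF cfg]
  have "finite L"
    using D(1) by simp
  define m where "m = card L"
  have "m \<ge> 1"
    using \<open>finite L\<close> \<open>L \<noteq> {}\<close> by (simp add: m_def Suc_leI card_gt_0_iff)
  have sum_L: "(\<Sum>i\<in>L. card (X i)) \<le> m * (n - 1)"
  proof -
    have "card (X i) \<le> n - 1" if "i \<in> L" for i
      using D(6)[of i] that by auto
    then show ?thesis
      using sum_bounded_above[of L "\<lambda>i. card (X i)" "n - 1"] by (simp add: m_def)
  qed
  have "m * (n - 1) + m = m * n"
    using n_ge by (cases n) auto
  have "m + 1 \<le> 2 ^ m"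
    by (induction m) auto
  then have "n * 4 * (m + 1) \<le> n * 4 * 2 ^ m"
    by (intro mult_le_mono2)
  then have target: "4 * (m * n) + 4 * n \<le> n * 2 ^ (card L + 2)"
    by (simp add: m_def algebra_simps)
  have "n \<le> m * n"
    using \<open>m \<ge> 1\<close> by simp
  have X: "card (X r) \<le> n - 1" "card (X b) \<le> n - 1"
    using D(6)[of r] D(6)[of b] by auto
  consider "X b = {}" | "X r = {}" | "X r \<noteq> {}" "X b \<noteq> {}"
    by blast
  then show ?thesis
  proof cases
    case 1
    have "card W + card (X r) < 7 * n + 2"
      by (rule small_parts_one_apex[OF cfg rb(1) 1 p small])
    moreover have "card (X b) = 0"
      using 1 by simp
    ultimately show ?thesis
      using sum_L target \<open>n \<le> m * n\<close> \<open>m * (n - 1) + m = m * n\<close> \<open>m \<ge> 1\<close> by linarith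
  next
    case 2
    have cfg': "config (insert b (insert r L)) W X"
      using cfg by (simp add: insert_commute)
    have p': "c x y \<in> {b, r}" if "x \<in> W" "y \<in> W" "p x \<noteq> p y" for x y
      using p(1)[OF that] by blast
    have "card W + card (X b) < 7 * n + 2"
      by (rule small_parts_one_apex[OF cfg' rb(1)[symmetric] 2 p' p(2) small])
    moreover have "card (X r) = 0"
      using 2 by simp
    ultimately show ?thesis
      using sum_L target \<open>n \<le> m * n\<close> \<open>m * (n - 1) + m = m * n\<close> \<open>m \<ge> 1\<close> by linarith
  next
    case 3
    have "card W < 5 * n - 1"
      by (rule small_parts_two_apices[OF cfg rb(1) 3 p small])
    then show ?thesis
      using sum_L target X \<open>n \<le> m * n\<close> \<open>m * (n - 1) + m = m * n\<close> n_ge by linarith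
  qed
qed

text \<open>Up to two colours are settled directly, since the estimates for Gallai partitions need a
  colour besides red and blue. The induction is on \<open>card W\<close> with colours and apex sets
  arbitrary, as a step may change both.\<close>

theorem config_bound:
  assumes "config K W X"
  shows "card W + (\<Sum>i\<in>K. card (X i)) \<le> n * 2 ^ card K"
  using assms
proof (induction "card W" arbitrary: K W X rule: less_induct)
  case less
  note cfg = less.prems
  note D = configD[OF cfg]
  consider "card K = 0" | "card K = 1" | "card K = 2" | "card K \<ge> 3"
    by linarith
  then show ?case
  proof cases
    case 1
    then have "colours c W = {}" "K = {}"
      using D(1,4) by auto
    then have "card W \<le> 1"
      using D(2) by (auto simp: card_le_Suc0_iff_eq colours_def)
    then show ?thesis
      using \<open>K = {}\<close> n_ge by simp
  next
    case 2
    then obtain r where "K = {r}"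
      by (auto simp: card_1_singleton_iff)
    then show ?thesis
      using one_colour_bound[of r W X] cfg by (simp add: mult.commute)
  next
    case 3
    then obtain r b where "K = {r, b}" "r \<noteq> b"
      by (meson card_2_iff)
    then show ?thesis
      using two_colour_bound[of r b W X] cfg by (simp add: mult.commute)
  next
    case 4
    show ?thesis
    proof (cases "card W \<ge> 2")
      case False
      have "card (X i) \<le> n - 1" if "i \<in> K" for i
        using D(6)[OF that] by simp
      then have "(\<Sum>i\<in>K. card (X i)) \<le> card K * (n - 1)"
        using sum_bounded_above[of K "\<lambda>i. card (X i)" "n - 1"] by simp
      also have "\<dots> + 1 \<le> card K * n"
        using 4 n_ge by (cases n) auto
      finally have "card W + (\<Sum>i\<in>K. card (X i)) \<le> n * card K"
        using False by (simp add: mult.commute)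
      also have "card K \<le> 2 ^ card K"
        using less_exp[of "card K"] by simp
      finally show ?thesis
        by simp
    next
      case True
      have "card K \<ge> 2"
        using 4 by linarith
      obtain p :: "'a \<Rightarrow> nat" and r b where rb: "r \<in> K" "b \<in> K" "r \<noteq> b"
        and p: "\<And>x y. x \<in> W \<Longrightarrow> y \<in> W \<Longrightarrow> p x \<noteq> p y \<Longrightarrow> c x y \<in> {r, b}"
        "\<And>x x' y. x \<in> W \<Longrightarrow> x' \<in> W \<Longrightarrow> y \<in> W \<Longrightarrow> p x = p x' \<Longrightarrow> p x \<noteq> p y \<Longrightarrow> c x y = c x' y"
        "card (p ` W) \<ge> 2"
        by (rule gallai_partition[OF D(2,3) sym True D(4,1) \<open>card K \<ge> 2\<close>]) (rule that)
      define L where "L = K - {r, b}"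
      have K: "K = insert r (insert b L)" and rbL: "r \<notin> L" "b \<notin> L"
        using rb by (auto simp: L_def)
      have "finite L"
        using D(1) by (simp add: L_def)
      then have card_K: "card K = card L + 2"
        using K rb rbL by simp
      then have "L \<noteq> {}"
        using 4 by auto
      have sum_K: "(\<Sum>i\<in>K. card (X i)) = card (X r) + card (X b) + (\<Sum>i\<in>L. card (X i))"
        using \<open>finite L\<close> rb rbL unfolding K by simp
      have "card W + card (X r) + card (X b) + (\<Sum>i\<in>L. card (X i)) \<le> n * 2 ^ (card L + 2)"
      proof (cases "\<exists>i. card {x \<in> W. p x = i} \<ge> n")
        case False
        then have small: "card {x \<in> W. p x = i} < n" for i
          by (meson not_less)
        have "config (insert r (insert b L)) W X"
          using cfg K by simp
        then show ?thesis
          by (rule small_parts_bound[OF _ rb(3) rbL \<open>L \<noteq> {}\<close> p(1,2) small])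
      next
        case True
        then obtain i where i: "card {x \<in> W. p x = i} \<ge> n"
          by blast
        define M where "M = {x \<in> W. p x = i}"
        define R where "R = {x \<in> W - M. \<forall>m\<in>M. c x m = r}"
        define B where "B = W - M - R"
        have "card M > 0"
          using i n_ge unfolding M_def by linarith
        then obtain m0 where m0: "m0 \<in> M"
          by (metis card_gt_0_iff equals0I)
        have same: "c x m = c x m0" if "x \<in> W - M" "m \<in> M" for x m
        proof -
          have "c m x = c m0 x"
            using that m0 by (intro p(2)) (auto simp: M_def)
          then show ?thesis
            using sym by simp
        qed
        have blue: "c x m = b" if x: "x \<in> B" and "m \<in> M" for x m
        proof -
          have "x \<in> W - M" "\<exists>m'\<in>M. c x m' \<noteq> r"
            using x by (auto simp: B_def R_def)
          then have "c x m \<noteq> r"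
            using same \<open>m \<in> M\<close> by metis
          moreover have "c x m \<in> {r, b}"
            using \<open>x \<in> W - M\<close> \<open>m \<in> M\<close> by (intro p(1)) (auto simp: M_def)
          ultimately show ?thesis
            by blast
        qed
        have "R \<union> B \<noteq> {}"
        proof
          assume "R \<union> B = {}"
          then have "W = M"
            by (auto simp: M_def R_def B_def)
          then have "p ` W \<subseteq> {i}"
            by (auto simp: M_def)
          then show False
            using p(3) card_mono[of "{i}" "p ` W"] by simp
        qed
        interpret module_config c n r b L W X M R B
        proof
          show "config (insert r (insert b L)) W X"
            using cfg K by simp
          show "card W' + (\<Sum>i\<in>K'. card (X' i)) \<le> n * 2 ^ card K'" if "card W' < card W" "config K' W' X'" for K' W' X'
            using less.hyps that by blast
          show "W = M \<union> R \<union> B" "M \<inter> R = {}" "M \<inter> B = {}" "R \<inter> B = {}"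
            unfolding M_def R_def B_def by blast+
          show "c x m = r" if "x \<in> R" "m \<in> M" for x m
            using that by (simp add: R_def)
          show "n \<le> card M"
            using i by (simp add: M_def)
        qed (fact rb rbL \<open>L \<noteq> {}\<close> \<open>R \<union> B \<noteq> {}\<close> | rule blue; assumption)+
        show ?thesis
          by (rule module_bound)
      qed
      then show ?thesis
        using card_K sum_K by simp
    qed
  qed
qed

end

lemma gallai_odd_cycle:
  assumes "finite W" "gallai c W" "\<And>x y. c x y = c y x" "colours c W \<subseteq> {..<k}" "n \<ge> 3" "card W > n * 2 ^ k"
  shows "\<exists>i<k. has_cycle (coloured c i) W (2 * n + 1)"
proof (rule ccontr)
  assume contra: "\<not> ?thesis"
  interpret odd_cycle_colouring c n
    using assms(3,5) by unfold_locales
  have "config {..<k} W (\<lambda>_. {})"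
    using assms(1,2,4,5) contra unfolding config_def by auto
  then show False
    using config_bound[of "{..<k}" W "\<lambda>_. {}"] assms(6) by simp
qed

section \<open>The lower bound\<close>

text \<open>\<open>j\<close> is least such that the vertices share a block of
  \<open>n * 2 ^ (j + 1)\<close> consecutive numbers. The exponent starts at 1, so pairs with equal
  quotient by \<open>n\<close>, which differ in no digit, also get colour \<open>0\<close>.\<close>

definition block_colour :: "nat \<Rightarrow> nat set \<Rightarrow> nat" where
  "block_colour n e = (LEAST j. \<exists>q. \<forall>x\<in>e. x div (n * 2 ^ Suc j) = q)"

lemma div_block_mono:
  fixes x y :: nat
  assumes "x div (n * 2 ^ i) = y div (n * 2 ^ i)" "i \<le> j"
  shows "x div (n * 2 ^ j) = y div (n * 2 ^ j)"
proof -
  have "n * 2 ^ j = (n * 2 ^ i) * 2 ^ (j - i)"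
    using assms(2) by (simp flip: power_add)
  then show ?thesis
    using assms(1) by (simp only: div_mult2_eq)
qed

lemma block_colour_le_iff:
  assumes "x < n * 2 ^ k" "y < n * 2 ^ k" "k \<ge> 1"
  shows "block_colour n {x, y} \<le> j \<longleftrightarrow> x div (n * 2 ^ Suc j) = y div (n * 2 ^ Suc j)"
proof -
  define P where "P j \<longleftrightarrow> (\<exists>q. \<forall>z\<in>{x, y}. z div (n * 2 ^ Suc j) = q)" for j
  have P: "P j \<longleftrightarrow> x div (n * 2 ^ Suc j) = y div (n * 2 ^ Suc j)" for j
    by (auto simp: P_def)
  have "P (k - 1)"
    using assms unfolding P by simp
  then have "P (LEAST j. P j)"
    by (rule LeastI)
  then show ?thesis
    using div_block_mono[of x n "Suc (LEAST j. P j)" y "Suc j"] Least_le[of P j]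
    unfolding block_colour_def P_def[symmetric] P by auto
qed

lemma block_colour_less:
  assumes "x < n * 2 ^ k" "y < n * 2 ^ k" "k \<ge> 1"
  shows "block_colour n {x, y} < k"
proof -
  have "block_colour n {x, y} \<le> k - 1"
    using assms by (subst block_colour_le_iff[OF assms]) simp
  then show ?thesis
    using assms(3) by linarith
qed

text \<open>Of three values in an ultrametric the two largest coincide, so no triangle is
  rainbow.\<close>

lemma block_colour_ultrametric:
  assumes "x < n * 2 ^ k" "y < n * 2 ^ k" "z < n * 2 ^ k" "k \<ge> 1"
  shows "block_colour n {x, z} \<le> max (block_colour n {x, y}) (block_colour n {y, z})"
  using block_colour_le_iff[OF assms(1,3,4)] block_colour_le_iff[OF assms(1,2,4)] block_colour_le_iff[OF assms(2,3,4)]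
  by (metis max.cobounded1 max.cobounded2)

lemma no_block_colour_cycle:
  assumes v: "\<And>i. v i < n * 2 ^ k" "\<And>i j. v i = v j \<longleftrightarrow> i mod (2 * n + 1) = j mod (2 * n + 1)"
    and col: "\<And>i. block_colour n {v i, v (Suc i)} = j" and "k \<ge> 1" "n \<ge> 1"
  shows False
proof (cases j)
  case 0
  have step: "v (Suc i) div (2 * n) = v i div (2 * n)" for i
    using block_colour_le_iff[OF v(1) v(1) \<open>k \<ge> 1\<close>, of i "Suc i" 0] col[of i] 0 by (simp add: mult.commute)
  have "v i div (2 * n) = v 0 div (2 * n)" for i
    by (induction i) (simp_all add: step)
  then have "v i \<in> {v 0 div (2 * n) * (2 * n)..<v 0 div (2 * n) * (2 * n) + 2 * n}" for i
    using \<open>n \<ge> 1\<close> by (metis atLeastLessThan_iff div_times_less_eq_dividend dividend_less_div_times mult_pos_pos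
      less_le_trans zero_less_numeral zero_less_one add.commute)
  then have "v ` {..<2 * n + 1} \<subseteq> {v 0 div (2 * n) * (2 * n)..<v 0 div (2 * n) * (2 * n) + 2 * n}"
    by blast
  moreover have "inj_on v {..<2 * n + 1}"
    using v(2) by (auto simp: inj_on_def)
  ultimately have "card {..<2 * n + 1} \<le> card {v 0 div (2 * n) * (2 * n)..<v 0 div (2 * n) * (2 * n) + 2 * n}"
    by (intro card_inj_on_le) auto
  then show False
    by simp
next
  case (Suc j')
  have step: "even (v (Suc i) div (n * 2 ^ j)) \<longleftrightarrow> odd (v i div (n * 2 ^ j))" for i
  proof -
    have "v i div (n * 2 ^ j) div 2 = v (Suc i) div (n * 2 ^ j) div 2"
      using block_colour_le_iff[OF v(1) v(1) \<open>k \<ge> 1\<close>, of i "Suc i" j] col[of i]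
      by (simp add: div_mult2_eq[symmetric] mult_ac)
    moreover have "v i div (n * 2 ^ j) \<noteq> v (Suc i) div (n * 2 ^ j)"
      using block_colour_le_iff[OF v(1) v(1) \<open>k \<ge> 1\<close>, of i "Suc i" j'] col[of i] Suc by simp
    moreover have "even y \<longleftrightarrow> odd x" if "x div 2 = y div 2" "x \<noteq> y" for x y :: nat
      using that by presburger
    ultimately show ?thesis
      by blast
  qed
  \<comment> \<open>The digit \<open>j\<close> alternates along the cycle, which is impossible for
    the odd period \<open>2 * n + 1\<close>.\<close>
  have "even (v i div (n * 2 ^ j)) \<longleftrightarrow> (even i \<longleftrightarrow> even (v 0 div (n * 2 ^ j)))" for i
    by (induction i) (use step in auto)
  from this[of "2 * n + 1"] show False
    using v(2)[of "2 * n + 1" 0] by simp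
qed

section \<open>The Gallai-Ramsey number of odd cycles\<close>

lemma mem_complete_graph: "{x, y} \<in> snd (complete_graph N) \<longleftrightarrow> x < N \<and> y < N \<and> x \<noteq> y"
  by (auto simp: complete_graph_def nsets_def card_insert_if)

lemma monochromatic_cycleI:
  assumes "i < k" "has_cycle (coloured (\<lambda>x y. f {x, y}) i) {..<N} m"
  shows "has_monochromatic_copy (cycle_graph m) (complete_graph N) f"
proof -
  obtain v where v: "cyclic_enum (coloured (\<lambda>x y. f {x, y}) i) m v" "range v \<subseteq> {..<N}"
    using has_cycle_imp_cyclic_enum[OF assms(2)] by blast
  have "inj_on v {..<m}"
    using cyclic_enum_eq_iff[OF v(1)] by (auto simp: inj_on_def)
  moreover have "v ` {j, (j + 1) mod m} \<in> snd (complete_graph N) \<and> f (v ` {j, (j + 1) mod m}) = i" for j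
  proof -
    have "v ((j + 1) mod m) = v (Suc j)"
      using cyclic_enum_eq_iff[OF v(1)] by simp
    then show ?thesis
      using cyclic_enum_step[OF v(1), of j] v(2) by (auto simp: coloured_def mem_complete_graph)
  qed
  ultimately show ?thesis
    using v(2) unfolding has_monochromatic_copy_def
    by (intro exI[of _ v] exI[of _ i]) (auto simp: cycle_graph_def complete_graph_def)
qed

lemma gallai_ramsey_upper:
  assumes "gallai_coloring k (n * 2 ^ k + 1) f" "n \<ge> 3"
  shows "has_monochromatic_copy (cycle_graph (2 * n + 1)) (complete_graph (n * 2 ^ k + 1)) f"
proof -
  define N where "N = n * 2 ^ k + 1"
  define c where "c x y = f {x, y}" for x y
  have "f {x, y} < k" if "x < N" "y < N" "x \<noteq> y" for x y
    using assms(1) that mem_complete_graph[of x y N] unfolding gallai_coloring_def N_def by (auto simp: Pi_iff)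
  then have "colours c {..<N} \<subseteq> {..<k}"
    by (auto simp: colours_def c_def)
  moreover have "gallai c {..<N}"
    unfolding gallai_def
  proof (intro ballI impI)
    fix x y z assume xyz: "x \<in> {..<N}" "y \<in> {..<N}" "z \<in> {..<N}" "x \<noteq> y" "y \<noteq> z" "x \<noteq> z"
    have "\<not> rainbow_triangle (complete_graph N) f x y z"
      using assms(1) by (auto simp: gallai_coloring_def N_def)
    then show "c x y = c y z \<or> c y z = c x z \<or> c x y = c x z"
      using xyz by (auto simp: rainbow_triangle_def mem_complete_graph c_def)
  qed
  moreover have "c x y = c y x" for x y
    by (simp add: c_def insert_commute)
  ultimately obtain i where "i < k" "has_cycle (coloured c i) {..<N} (2 * n + 1)"
    using gallai_odd_cycle[of "{..<N}" c k n] assms(2) by (auto simp: N_def)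
  then show ?thesis
    using monochromatic_cycleI[of i k f N "2 * n + 1"] by (simp add: c_def[abs_def] N_def)
qed

text \<open>Every \<open>N\<close> up to \<open>n * 2 ^ k\<close> is covered, because a least number
  with the Ramsey property is sought and all smaller ones have to be refuted individually.\<close>

lemma gallai_ramsey_lower:
  assumes "k \<ge> 1" "n \<ge> 1" "N \<le> n * 2 ^ k"
  shows "gallai_coloring k N (block_colour n)"
    and "\<not> has_monochromatic_copy (cycle_graph (2 * n + 1)) (complete_graph N) (block_colour n)"
proof -
  have le: "x < n * 2 ^ k" if "x < N" for x
    using that assms(3) by linarith
  show "gallai_coloring k N (block_colour n)"
    unfolding gallai_coloring_def
  proof (intro conjI notI)
    show "block_colour n \<in> snd (complete_graph N) \<rightarrow> {..<k}"
    proof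
      fix e assume "e \<in> snd (complete_graph N)"
      then obtain x y where "e = {x, y}" "x < N" "y < N"
        by (auto simp: complete_graph_def nsets_def card_2_iff)
      then show "block_colour n e \<in> {..<k}"
        using block_colour_less[OF le le assms(1)] by simp
    qed
    assume "\<exists>x y z. rainbow_triangle (complete_graph N) (block_colour n) x y z"
    then obtain x y z where xyz: "x < N" "y < N" "z < N" and rainbow: "block_colour n {x, y} \<noteq> block_colour n {y, z}"
      "block_colour n {y, z} \<noteq> block_colour n {x, z}" "block_colour n {x, y} \<noteq> block_colour n {x, z}"
      unfolding rainbow_triangle_def mem_complete_graph by blast
    note ultra = block_colour_ultrametric[OF le le le assms(1)]
    have "{z, y} = {y, z}" "{y, x} = {x, y}" "{z, x} = {x, z}"
      by auto
    then show False
      using ultra[OF xyz(1,2,3)] ultra[OF xyz(1,3,2)] ultra[OF xyz(2,1,3)] rainbow by (auto simp: max_def split: if_splits)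
  qed
  show "\<not> has_monochromatic_copy (cycle_graph (2 * n + 1)) (complete_graph N) (block_colour n)"
  proof
    define m where "m = 2 * n + 1"
    assume "has_monochromatic_copy (cycle_graph (2 * n + 1)) (complete_graph N) (block_colour n)"
    then have "\<exists>g i. inj_on g (fst (cycle_graph m)) \<and> g ` fst (cycle_graph m) \<subseteq> fst (complete_graph N) \<and>
        (\<forall>e\<in>snd (cycle_graph m). g ` e \<in> snd (complete_graph N) \<and> block_colour n (g ` e) = i)"
      unfolding has_monochromatic_copy_def m_def .
    then obtain g i where copy: "inj_on g (fst (cycle_graph m)) \<and> g ` fst (cycle_graph m) \<subseteq> fst (complete_graph N) \<and>
        (\<forall>e\<in>snd (cycle_graph m). g ` e \<in> snd (complete_graph N) \<and> block_colour n (g ` e) = i)"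
      by (elim exE)
    have g: "inj_on g {..<m}" "g ` {..<m} \<subseteq> {..<N}"
      using copy by (simp_all add: cycle_graph_def complete_graph_def)
    have edges: "block_colour n (g ` e) = i" if "e \<in> snd (cycle_graph m)" for e
      using copy that by simp
    have col: "block_colour n (g ` {j, (j + 1) mod m}) = i" if "j < m" for j
      using that by (intro edges) (auto simp: cycle_graph_def)
    define v where "v j = g (j mod m)" for j
    have "m > 0"
      by (simp add: m_def)
    have "v j < n * 2 ^ k" for j
    proof -
      have "j mod m \<in> {..<m}"
        using \<open>m > 0\<close> by simp
      then show ?thesis
        using g(2) unfolding v_def by (intro le) blast
    qed
    moreover have "v j = v l \<longleftrightarrow> j mod (2 * n + 1) = l mod (2 * n + 1)" for j l
      using inj_on_eq_iff[OF g(1), of "j mod m" "l mod m"] \<open>m > 0\<close> by (simp add: v_def m_def)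
    moreover have "block_colour n {v j, v (Suc j)} = i" for j
      using col[of "j mod m"] \<open>m > 0\<close> by (simp add: v_def mod_Suc_eq)
    ultimately show False
      using no_block_colour_cycle[of v n k i] assms(1,2) by blast
  qed
qed

theorem theorem1p10:
  fixes k n :: nat
  assumes "k \<ge> 1" and "n \<ge> 3"
  shows "gallai_ramsey k (cycle_graph (2 * n + 1)) = n * 2 ^ k + 1"
  unfolding gallai_ramsey_def
proof (rule Least_equality)
  show "0 < n * 2 ^ k + 1 \<and> (\<forall>f. gallai_coloring k (n * 2 ^ k + 1) f \<longrightarrow>
    has_monochromatic_copy (cycle_graph (2 * n + 1)) (complete_graph (n * 2 ^ k + 1)) f)"
    using gallai_ramsey_upper assms(2) by simp
  fix N assume N: "0 < N \<and> (\<forall>f. gallai_coloring k N f \<longrightarrow>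
    has_monochromatic_copy (cycle_graph (2 * n + 1)) (complete_graph N) f)"
  show "n * 2 ^ k + 1 \<le> N"
  proof (rule ccontr)
    assume "\<not> n * 2 ^ k + 1 \<le> N"
    then have "N \<le> n * 2 ^ k" "n \<ge> 1"
      using assms(2) by linarith+
    then show False
      using gallai_ramsey_lower[OF assms(1)] N by blast
  qed
qed

end
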